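(* Let $(y_t,\boldsymbol{x}_t)$, $t=1,\dots,n$, be a time series with $y_t\in\mathbb{R}$ and $\boldsymbol{x}_t\in\mathbb{R}^K$, let $w_n>0$ be the tail cut-off point, which possibly depends on the sample size $n$, and let $\boldsymbol\beta\in\mathbb{R}^K$. Let $\{(y_\tau,\boldsymbol{x}_\tau)\}_{\tau=1}^{n_0}$ be the tail subsample, i.e. the $n_0\le n$ pairs with $y_t>w_n$, relabelled in their original order. Suppose that, conditionally on $\boldsymbol{x}_t$ and on $y_t>w_n$, $y_t$ has the Pareto distribution function $$F(y\mid \boldsymbol{x}_t,w_n)=1-(y/w_n)^{-\exp(\boldsymbol{x}_t'\boldsymbol\beta)}\ \text{ if } y\ge w_n,\qquad F(y\mid \boldsymbol{x}_t,w_n)=0\ \text{ if } y<w_n .$$ Put $z_\tau=-\ln\big(\ln(y_\tau/w_n)\big)-\gamma$, where $\gamma$ is Euler's constant, $\xi_\tau=z_\tau-\boldsymbol{x}_\tau'\boldsymbol\beta$, $\boldsymbol{g}_\tau=\boldsymbol{x}_\tau\xi_\tau$, and $$\hat{\boldsymbol\beta}_{OLS}=\arg\min_{\boldsymbol b\in\mathbb{R}^K}\sum_{\tau=1}^{n_0}(z_\tau-\boldsymbol{x}_\tau'\boldsymbol b)^2 .$$ Consider the following assumptions. (A1) $\{(y_\tau,\boldsymbol{x}_\tau)\}_{\tau=1}^{n_0}$ is an ergodic stationary process. (A2) $E(\xi_\tau\mid\boldsymbol{x}_\tau)=0$, $\tau=1,\dots,n_0$. (A3) The $K\times K$ matrix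 $\boldsymbol\Sigma_{xx}=E(\boldsymbol{x}_\tau\boldsymbol{x}_\tau')$, $\tau=1,\dots,n_0$, is finite and nonsingular. (A4a) With $\boldsymbol\Gamma(j)=E(\boldsymbol{g}_\tau\boldsymbol{g}_{\tau-j}')$ for $j=0,\pm1,\dots$, one has $\sum_{j=-\infty}^{\infty}\|\boldsymbol\Gamma(j)\|<\infty$, where $\|\cdot\|$ is the $L_1$ norm, and the long-run variance-covariance matrix $\boldsymbol V=\sum_{j=-\infty}^{\infty}\boldsymbol\Gamma(j)$ is positive definite. (A4b) $E(\boldsymbol{g}_\tau\mid\boldsymbol{g}_{\tau-j},\boldsymbol{g}_{\tau-j-1},\dots)\to\boldsymbol 0$ in quadratic mean as $j\to\infty$. (A4c) $\sum_{j=0}^{\infty}\big(E(\boldsymbol{r}_j'\boldsymbol{r}_j)\big)^{1/2}<\infty$, where $\boldsymbol{r}_j=E(\boldsymbol{g}_\tau\mid\boldsymbol{g}_{\tau-j},\boldsymbol{g}_{\tau-j-1},\dots)-E(\boldsymbol{g}_\tau\mid\boldsymbol{g}_{\tau-j-1},\boldsymbol{g}_{\tau-j-2},\dots)$. Then, as $n\to\infty$ (and $n_0\to\infty$): (i) under (A1), (A2), (A3) and (A4a), $\hat{\boldsymbol\beta}_{OLS}\to\boldsymbol\beta$ in probability; (ii) if in addition (A4b) and (A4c) hold, then $\sqrt{n_0}\,(\hat{\boldsymbol\beta}_{OLS}-\boldsymbol\beta)$ converges in distribution to $N\big(\boldsymbol 0,\ \boldsymbol\Sigma_{xx}^{-1}\boldsymbol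 V\boldsymbol\Sigma_{xx}^{-1}\big)$.
   Context: Tail subsample: from the full sample $t=1,\dots,n$ one keeps only the observations with $y_t>w_n$; with $S=\{t\in\{1,\dots,n\}: y_t>w_n\}$ having $n_0$ elements, $\tau=1$ denotes the first element of $S$, $\tau=2$ the second, and so on. In this exact Pareto case the subsample size is $n_0=\lfloor\kappa n\rfloor$ with $\kappa\in(0,1]$, and $w_n$ is the $((1-\kappa)100)$th percentile of $\{y_t\}$. Expectations of subsample quantities are understood within the subsample, i.e. conditionally on exceeding the threshold: for instance $E(\boldsymbol{x}_\tau\boldsymbol{x}_\tau')$ stands for $E(\boldsymbol{x}_t\boldsymbol{x}_t'\mid y_t>w_n)$, not for $E(\boldsymbol{x}_t\boldsymbol{x}_t' I_{(y_t>w_n)})$. The Pareto law implies $-\ln(\ln(y_\tau/w_n))=\boldsymbol{x}_\tau'\boldsymbol\beta+a_\tau$ with $a_\tau$ standard Gumbel (mean $\gamma$), so $\xi_\tau=a_\tau-\gamma$ and the model is the linear regression $z_\tau=\boldsymbol{x}_\tau'\boldsymbol\beta+\xi_\tau$. A prime denotes transpose. *)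

theory Defs
  imports "HOL-Probability.Probability"
begin

section \<open>Convergence of random vectors\<close>

definition tendsto_in_prob ::
  "'w measure \<Rightarrow> (nat \<Rightarrow> 'w \<Rightarrow> 'b::metric_space) \<Rightarrow> 'b \<Rightarrow> bool" where
  "tendsto_in_prob M T c \<longleftrightarrow>
     (\<forall>\<epsilon>>0. (\<lambda>n. measure M {\<omega> \<in> space M. dist (T n \<omega>) c > \<epsilon>}) \<longlonglongrightarrow> 0)"

definition tendsto_in_distribution ::
  "'w measure \<Rightarrow> (nat \<Rightarrow> 'w \<Rightarrow> 'b::topological_space) \<Rightarrow> 'b measure \<Rightarrow> bool" where
  "tendsto_in_distribution M T \<mu> \<longleftrightarrow>
     (\<forall>f :: 'b \<Rightarrow> real. continuous_on UNIV f \<and> bounded (range f) \<longrightarrow>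
        (\<lambda>n. \<integral>\<omega>. f (T n \<omega>) \<partial>M) \<longlonglongrightarrow> (\<integral>v. f v \<partial>\<mu>))"


section \<open>Matrices and the multivariate normal law\<close>

definition outer :: "real^'k \<Rightarrow> real^'k \<Rightarrow> real^'k^'k" where
  "outer u v = (\<chi> i j. u $ i * v $ j)"

definition L1_matrix_norm :: "real^'k^'k \<Rightarrow> real" where
  "L1_matrix_norm A = (\<Sum>i\<in>UNIV. \<Sum>j\<in>UNIV. \<bar>A $ i $ j\<bar>)"

definition pos_def :: "real^'k^'k \<Rightarrow> bool" where
  "pos_def A \<longleftrightarrow> transpose A = A \<and> (\<forall>v. v \<noteq> 0 \<longrightarrow> 0 < v \<bullet> (A *v v))"

text \<open>The density form of \<open>N(\<mu>, \<Omega>)\<close>, to be used for positive definite \<open>\<Omega>\<close> only.\<close>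

definition multi_normal :: "real^'k \<Rightarrow> real^'k^'k \<Rightarrow> (real^'k) measure" where
  "multi_normal \<mu> \<Omega> = density lborel (\<lambda>v. ennreal
     (exp (- ((v - \<mu>) \<bullet> (matrix_inv \<Omega> *v (v - \<mu>))) / 2)
        / sqrt ((2 * pi) ^ CARD('k) * det \<Omega>)))"


section \<open>Stationary and ergodic processes\<close>

definition path_law :: "'v measure \<Rightarrow> (int \<Rightarrow> 'v \<Rightarrow> 'b::topological_space) \<Rightarrow> (int \<Rightarrow> 'b) measure" where
  "path_law N Z = distr N (\<Pi>\<^sub>M \<tau>\<in>UNIV. borel) (\<lambda>\<omega> \<tau>. Z \<tau> \<omega>)"

text \<open>Processes are indexed by all integers, so that the infinite past is available. Every
  one-sided stationary process of real vectors extends to a two-sided one, and the extension is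
  ergodic iff the one-sided process is.\<close>

definition ergodic_stationary :: "'v measure \<Rightarrow> (int \<Rightarrow> 'v \<Rightarrow> 'b::topological_space) \<Rightarrow> bool" where
  "ergodic_stationary N Z \<longleftrightarrow>
     prob_space N \<and> (\<forall>\<tau>. Z \<tau> \<in> borel_measurable N) \<and>
     path_law N (\<lambda>\<tau>. Z (\<tau> + 1)) = path_law N Z \<and>
     (\<forall>A \<in> sets (\<Pi>\<^sub>M \<tau>\<in>UNIV. borel).
        (\<lambda>p (\<tau>::int). p (\<tau> + 1)) -` A = A \<longrightarrow> measure (path_law N Z) A \<in> {0, 1})"

text \<open>\<open>past_mean N g \<tau> j\<close> is \<open>E(g\<^sub>\<tau> | g\<^bsub>\<tau>-j\<^esub>, g\<^bsub>\<tau>-j-1\<^esub>, \<dots>)\<close>, taken componentwise.\<close>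

definition past_mean ::
  "'v measure \<Rightarrow> (int \<Rightarrow> 'v \<Rightarrow> real^'k) \<Rightarrow> int \<Rightarrow> nat \<Rightarrow> 'v \<Rightarrow> real^'k" where
  "past_mean N g \<tau> j \<omega> = (\<chi> l. real_cond_exp N
     (vimage_algebra (space N) (\<lambda>\<omega> (i::nat). g (\<tau> - int j - int i) \<omega>) (\<Pi>\<^sub>M i\<in>UNIV. borel))
     (\<lambda>\<omega>. g \<tau> \<omega> $ l) \<omega>)"

definition past_revision ::
  "'v measure \<Rightarrow> (int \<Rightarrow> 'v \<Rightarrow> real^'k) \<Rightarrow> int \<Rightarrow> nat \<Rightarrow> 'v \<Rightarrow> real^'k" where
  "past_revision N g \<tau> j \<omega> = past_mean N g \<tau> j \<omega> - past_mean N g \<tau> (j + 1) \<omega>"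


section \<open>Tail subsample, Pareto tail and tail-index regression\<close>

text \<open>The threshold \<open>w n\<close> is a random variable, since it may be a sample percentile; a
  deterministic threshold is a constant function. Observations carry the indices \<open>1, \<dots>, n\<close>.\<close>

definition tail_set :: "(nat \<Rightarrow> 'w \<Rightarrow> real) \<Rightarrow> (nat \<Rightarrow> 'w \<Rightarrow> real) \<Rightarrow> nat \<Rightarrow> 'w \<Rightarrow> nat set" where
  "tail_set y w n \<omega> = {t \<in> {1..n}. y t \<omega> > w n \<omega>}"

definition tail_size :: "real \<Rightarrow> nat \<Rightarrow> nat" where
  "tail_size \<kappa> n = nat \<lfloor>\<kappa> * real n\<rfloor>"

text \<open>The entry with number \<open>\<tau> = 1, 2, \<dots>\<close> of a series \<open>s\<close>, after relabelling along the tail set.\<close>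

definition subsample ::
  "(nat \<Rightarrow> 'w \<Rightarrow> real) \<Rightarrow> (nat \<Rightarrow> 'w \<Rightarrow> real) \<Rightarrow> (nat \<Rightarrow> 'w \<Rightarrow> 'b) \<Rightarrow> nat \<Rightarrow> nat \<Rightarrow> 'w \<Rightarrow> 'b" where
  "subsample y w s n \<tau> \<omega> = s (sorted_list_of_set (tail_set y w n \<omega>) ! (\<tau> - 1)) \<omega>"

definition pareto_cdf :: "real^'k \<Rightarrow> real \<Rightarrow> real^'k \<Rightarrow> real \<Rightarrow> real" where
  "pareto_cdf \<beta> u v c = (if u \<ge> c then 1 - (u / c) powr (- exp (v \<bullet> \<beta>)) else 0)"

text \<open>The conditional distribution function of \<open>y t\<close> given \<open>x t\<close> and \<open>w n\<close>, under the
  probability conditioned on the event \<open>y t > w n\<close>. For a deterministic threshold the generated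
  \<open>\<sigma>\<close>-algebra is that of \<open>x t\<close>.\<close>

definition pareto_tail ::
  "'w measure \<Rightarrow> (nat \<Rightarrow> 'w \<Rightarrow> real) \<Rightarrow> (nat \<Rightarrow> 'w \<Rightarrow> real^'k) \<Rightarrow> (nat \<Rightarrow> 'w \<Rightarrow> real) \<Rightarrow> real^'k \<Rightarrow> bool" where
  "pareto_tail M y x w \<beta> \<longleftrightarrow>
     (\<forall>n. \<forall>t\<in>{1..n}.
        let E = {\<omega> \<in> space M. y t \<omega> > w n \<omega>}; M' = uniform_measure M E in
        measure M E > 0 \<longrightarrow>
          (\<forall>u. AE \<omega> in M'.
             real_cond_exp M' (vimage_algebra (space M) (\<lambda>\<omega>. (x t \<omega>, w n \<omega>)) borel)
               (indicat_real {\<omega> \<in> space M. y t \<omega> \<le> u}) \<omega>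
             = pareto_cdf \<beta> u (x t \<omega>) (w n \<omega>)))"

definition loglog :: "real \<Rightarrow> real \<Rightarrow> real" where
  "loglog u c = - ln (ln (u / c)) - euler_mascheroni"

definition ssr ::
  "(nat \<Rightarrow> 'w \<Rightarrow> real) \<Rightarrow> (nat \<Rightarrow> 'w \<Rightarrow> real^'k) \<Rightarrow> (nat \<Rightarrow> 'w \<Rightarrow> real) \<Rightarrow> real \<Rightarrow> nat \<Rightarrow> 'w \<Rightarrow> real^'k \<Rightarrow> real" where
  "ssr y x w \<kappa> n \<omega> b =
     (\<Sum>\<tau> = 1..tail_size \<kappa> n.
        (loglog (subsample y w y n \<tau> \<omega>) (w n \<omega>) - subsample y w x n \<tau> \<omega> \<bullet> b)\<^sup>2)"

text \<open>An OLS estimator is any measurable selection of minimisers: the minimiser need not be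
  unique on the event that the sample second moment matrix is singular.\<close>

definition ols_estimator ::
  "'w measure \<Rightarrow> (nat \<Rightarrow> 'w \<Rightarrow> real) \<Rightarrow> (nat \<Rightarrow> 'w \<Rightarrow> real^'k) \<Rightarrow> (nat \<Rightarrow> 'w \<Rightarrow> real) \<Rightarrow> real
     \<Rightarrow> (nat \<Rightarrow> 'w \<Rightarrow> real^'k) \<Rightarrow> bool" where
  "ols_estimator M y x w \<kappa> bhat \<longleftrightarrow>
     (\<forall>n. bhat n \<in> borel_measurable M \<and>
        (AE \<omega> in M. is_arg_min (ssr y x w \<kappa> n \<omega>) (\<lambda>_. True) (bhat n \<omega>)))"


section \<open>The assumptions\<close>

text \<open>\<open>(Y, X)\<close> is the process of which the tail subsample, with \<open>y\<close> measured in units of the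
  threshold, is the stretch \<open>\<tau> = 1, \<dots>, n\<^sub>0\<close>. The rescaling is what allows one process to serve
  every \<open>n\<close> while \<open>w n\<close> varies: the Pareto law has scale parameter \<open>w n\<close>, and \<open>z\<^sub>\<tau>\<close> depends on
  \<open>y\<^sub>\<tau>\<close> only through \<open>y\<^sub>\<tau> / w n\<close>.\<close>

definition A1 ::
  "'w measure \<Rightarrow> (nat \<Rightarrow> 'w \<Rightarrow> real) \<Rightarrow> (nat \<Rightarrow> 'w \<Rightarrow> real^'k) \<Rightarrow> (nat \<Rightarrow> 'w \<Rightarrow> real) \<Rightarrow> real
     \<Rightarrow> 'v measure \<Rightarrow> (int \<Rightarrow> 'v \<Rightarrow> real) \<Rightarrow> (int \<Rightarrow> 'v \<Rightarrow> real^'k) \<Rightarrow> bool" where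
  "A1 M y x w \<kappa> N Y X \<longleftrightarrow>
     ergodic_stationary N (\<lambda>\<tau> \<omega>. (Y \<tau> \<omega>, X \<tau> \<omega>)) \<and>
     (\<forall>n. distr M (\<Pi>\<^sub>M \<tau>\<in>{1..tail_size \<kappa> n}. borel)
             (\<lambda>\<omega>. \<lambda>\<tau>\<in>{1..tail_size \<kappa> n}.
                (subsample y w y n \<tau> \<omega> / w n \<omega>, subsample y w x n \<tau> \<omega>))
          = distr N (\<Pi>\<^sub>M \<tau>\<in>{1..tail_size \<kappa> n}. borel)
             (\<lambda>\<omega>. \<lambda>\<tau>\<in>{1..tail_size \<kappa> n}. (Y (int \<tau>) \<omega>, X (int \<tau>) \<omega>)))"

text \<open>\<open>Y\<close> is already relative to the threshold, hence the second argument \<open>1\<close> of \<open>loglog\<close>.\<close>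

definition resid :: "real^'k \<Rightarrow> (int \<Rightarrow> 'v \<Rightarrow> real) \<Rightarrow> (int \<Rightarrow> 'v \<Rightarrow> real^'k) \<Rightarrow> int \<Rightarrow> 'v \<Rightarrow> real" where
  "resid \<beta> Y X \<tau> \<omega> = loglog (Y \<tau> \<omega>) 1 - X \<tau> \<omega> \<bullet> \<beta>"

definition score :: "real^'k \<Rightarrow> (int \<Rightarrow> 'v \<Rightarrow> real) \<Rightarrow> (int \<Rightarrow> 'v \<Rightarrow> real^'k) \<Rightarrow> int \<Rightarrow> 'v \<Rightarrow> real^'k" where
  "score \<beta> Y X \<tau> \<omega> = resid \<beta> Y X \<tau> \<omega> *\<^sub>R X \<tau> \<omega>"

definition A2 :: "real^'k \<Rightarrow> 'v measure \<Rightarrow> (int \<Rightarrow> 'v \<Rightarrow> real) \<Rightarrow> (int \<Rightarrow> 'v \<Rightarrow> real^'k) \<Rightarrow> bool" where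
  "A2 \<beta> N Y X \<longleftrightarrow>
     (\<forall>\<tau>. integrable N (resid \<beta> Y X \<tau>) \<and>
        (AE \<omega> in N. real_cond_exp N (vimage_algebra (space N) (X \<tau>) borel) (resid \<beta> Y X \<tau>) \<omega> = 0))"

definition A3 :: "'v measure \<Rightarrow> (int \<Rightarrow> 'v \<Rightarrow> real^'k) \<Rightarrow> real^'k^'k \<Rightarrow> bool" where
  "A3 N X \<Sigma>xx \<longleftrightarrow>
     (\<forall>\<tau>. has_bochner_integral N (\<lambda>\<omega>. outer (X \<tau> \<omega>) (X \<tau> \<omega>)) \<Sigma>xx) \<and> invertible \<Sigma>xx"

definition A4a ::
  "real^'k \<Rightarrow> 'v measure \<Rightarrow> (int \<Rightarrow> 'v \<Rightarrow> real) \<Rightarrow> (int \<Rightarrow> 'v \<Rightarrow> real^'k) \<Rightarrow> (int \<Rightarrow> real^'k^'k) \<Rightarrow> real^'k^'k \<Rightarrow> bool" where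
  "A4a \<beta> N Y X \<Gamma> V \<longleftrightarrow>
     (\<forall>\<tau> j. has_bochner_integral N (\<lambda>\<omega>. outer (score \<beta> Y X \<tau> \<omega>) (score \<beta> Y X (\<tau> - j) \<omega>)) (\<Gamma> j)) \<and>
     (\<lambda>j. L1_matrix_norm (\<Gamma> j)) summable_on UNIV \<and>
     (\<Gamma> has_sum V) UNIV \<and> pos_def V"

definition A4b :: "real^'k \<Rightarrow> 'v measure \<Rightarrow> (int \<Rightarrow> 'v \<Rightarrow> real) \<Rightarrow> (int \<Rightarrow> 'v \<Rightarrow> real^'k) \<Rightarrow> bool" where
  "A4b \<beta> N Y X \<longleftrightarrow>
     (\<forall>\<tau>. (\<forall>j. integrable N (\<lambda>\<omega>. (norm (past_mean N (score \<beta> Y X) \<tau> j \<omega>))\<^sup>2)) \<and>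
        (\<lambda>j. \<integral>\<omega>. (norm (past_mean N (score \<beta> Y X) \<tau> j \<omega>))\<^sup>2 \<partial>N) \<longlonglongrightarrow> 0)"

definition A4c :: "real^'k \<Rightarrow> 'v measure \<Rightarrow> (int \<Rightarrow> 'v \<Rightarrow> real) \<Rightarrow> (int \<Rightarrow> 'v \<Rightarrow> real^'k) \<Rightarrow> bool" where
  "A4c \<beta> N Y X \<longleftrightarrow>
     (\<forall>\<tau>. let r = past_revision N (score \<beta> Y X) \<tau> in
        (\<forall>j. integrable N (\<lambda>\<omega>. r j \<omega> \<bullet> r j \<omega>)) \<and>
        summable (\<lambda>j. sqrt (\<integral>\<omega>. r j \<omega> \<bullet> r j \<omega> \<partial>N)))"

end

theory Submission
  imports Defs
begin

text \<open>
  The law of the tail subsample is that of a stretch of the ergodic stationary process \<open>(Y, X)\<close>, so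
  by the normal equations \<open>bhat - \<beta>\<close> solves a linear system whose matrix is the sample second moment
  of \<open>X\<close> and whose right-hand side is the sample mean of the scores. The matrix converges to
  \<open>\<Sigma>\<^sub>x\<^sub>x\<close> by the ergodic theorem, and summability of the autocovariances makes the variance of the
  score mean \<open>O(1/n)\<close>; this gives consistency.

  For the limit law, Gordin's method replaces the score sum by a sum of stationary ergodic martingale
  differences, with an \<open>L\<^sub>2\<close> error that is a small multiple of \<open>sqrt n\<close> by summability of the
  revisions. The characteristic function of that sum is found by telescoping. The passage from
  characteristic functions to bounded continuous test functions uses tightness and uniform
  approximation by trigonometric polynomials.
\<close>

section \<open>Ergodic averages\<close>

text \<open>The ergodic and martingale arguments need an invertible measure-preserving map, while
  the process is given only as random variables on \<open>N\<close>. They are therefore carried out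
  for the coordinate shift on the path law; integrals, almost sure statements and conditional
  expectations given the past are then pulled back along the sample path map. Two-sidedness matters:
  the revision with index j is measurable at time -j, and the shift by j brings all of them to time
  0, where they add up to a single martingale difference. The variance of that difference is never
  computed from conditional expectations. It is identified in the limit, because the normalised
  variance of the score sum tends to \<open>c \<bullet> (V *v c)\<close> by Cesaro averaging of the
  autocovariances. On the regression side the sample moment matrix may be singular, so it is never
  inverted. On events of probability close to one it is so near to the invertible limit that it is
  still bounded below, and this lower bound does the work of an inverse.\<close>

lemma norm_integral_le_integral:
  fixes f :: "'a \<Rightarrow> 'b::{banach, second_countable_topology}"
  assumes "integrable M f" "integrable M g" "\<And>x. x \<in> space M \<Longrightarrow> norm (f x) \<le> g x"
  shows "norm (\<integral>x. f x \<partial>M) \<le> (\<integral>x. g x \<partial>M)"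
  by (rule order_trans[OF integral_norm_bound integral_mono]) (use assms in auto)

text \<open>A whole group of maps instead of one transformation: \<open>\<theta> (- k)\<close> is
  the inverse of \<open>\<theta> k\<close>, which is what allows functions of the past to be moved
  backwards in time. Ergodicity is required in its weak form, for strictly invariant sets
  only.\<close>

locale ergodic_flow = prob_space M for M :: "'a measure" +
  fixes \<theta> :: "int \<Rightarrow> 'a \<Rightarrow> 'a"
  assumes flow_measurable [measurable]: "\<And>k. \<theta> k \<in> M \<rightarrow>\<^sub>M M"
    and flow_zero [simp]: "\<And>x. \<theta> 0 x = x"
    and flow_add: "\<And>i j x. \<theta> i (\<theta> j x) = \<theta> (i + j) x"
    and flow_distr: "\<And>k. distr M M (\<theta> k) = M"
    and flow_ergodic: "\<And>A. A \<in> sets M \<Longrightarrow> \<theta> 1 -` A \<inter> space M = A \<Longrightarrow> prob A = 0 \<or> prob A = 1"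
begin

lemma integrable_flow_iff:
  fixes f :: "'a \<Rightarrow> 'b::{banach, second_countable_topology}"
  assumes "f \<in> borel_measurable M"
  shows "integrable M (\<lambda>x. f (\<theta> k x)) \<longleftrightarrow> integrable M f"
  using integrable_distr_eq[OF flow_measurable[of k] assms] by (simp add: flow_distr)

lemma integrable_flow:
  fixes f :: "'a \<Rightarrow> 'b::{banach, second_countable_topology}"
  assumes "integrable M f"
  shows "integrable M (\<lambda>x. f (\<theta> k x))"
  using assms integrable_flow_iff[of f k] by (simp add: borel_measurable_integrable)

lemma integral_flow:
  fixes f :: "'a \<Rightarrow> 'b::{banach, second_countable_topology}"
  assumes "f \<in> borel_measurable M"
  shows "(\<integral>x. f (\<theta> k x) \<partial>M) = (\<integral>x. f x \<partial>M)"
  using integral_distr[OF flow_measurable[of k] assms] by (simp add: flow_distr)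

lemma AE_flow:
  assumes "AE x in M. P x"
  shows "AE x in M. P (\<theta> k x)"
proof -
  obtain A where A: "A \<in> null_sets M" "{x \<in> space M. \<not> P x} \<subseteq> A"
    using assms by (auto simp: eventually_ae_filter)
  have "AE x in M. x \<notin> A" using A(1) by (rule AE_not_in)
  then have "AE x in distr M M (\<theta> k). x \<notin> A" unfolding flow_distr .
  moreover have "{x \<in> space M. x \<notin> A} \<in> sets M" using A(1) by auto
  ultimately have "AE x in M. \<theta> k x \<notin> A"
    by (simp add: AE_distr_iff[OF flow_measurable])
  moreover have "AE x in M. \<theta> k x \<in> space M"
    using measurable_space[OF flow_measurable[of k]] by auto
  ultimately show ?thesis
  proof eventually_elim
    case (elim x)
    then show ?case using A(2) by auto
  qed
qed

text \<open>The maximum of the partial sums of \<open>f\<close> along the orbit with 1 to n+1 terms.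
  Recursion on the first summand makes the comparison of the maximum at \<open>x\<close> with the
  one at \<open>\<theta> 1 x\<close> immediate.\<close>

primrec running_max :: "('a \<Rightarrow> real) \<Rightarrow> nat \<Rightarrow> 'a \<Rightarrow> real" where
  "running_max f 0 x = f x"
| "running_max f (Suc n) x = f x + max 0 (running_max f n (\<theta> 1 x))"

lemma running_max_measurable [measurable]:
  assumes [measurable]: "f \<in> borel_measurable M"
  shows "running_max f n \<in> borel_measurable M"
  by (induction n) (auto simp: fun_eq_iff cong: measurable_cong)

lemma running_max_integrable:
  assumes "integrable M f"
  shows "integrable M (running_max f n)"
proof (induction n)
  case 0
  then show ?case using assms by (simp cong: integrable_cong)
next
  case (Suc n)
  have "integrable M (\<lambda>x. f x + max 0 (running_max f n (\<theta> 1 x)))"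
    using assms integrable_flow[OF Suc, of 1] by (intro Bochner_Integration.integrable_add integrable_max) auto
  then show ?case by (simp cong: integrable_cong)
qed

lemma running_max_mono: "running_max f n x \<le> running_max f (Suc n) x"
proof (induction n arbitrary: x)
  case (Suc n)
  from Suc[of "\<theta> 1 x"] show ?case unfolding running_max.simps by linarith
qed simp

lemma running_max_incseq: "m \<le> n \<Longrightarrow> running_max f m x \<le> running_max f n x"
  using lift_Suc_mono_le[of "\<lambda>n. running_max f n x"] running_max_mono by blast

lemma partial_sum_le_running_max: "(\<Sum>i<Suc n. f (\<theta> (int i) x)) \<le> running_max f n x"
proof (induction n arbitrary: x)
  case (Suc n)
  have "(\<Sum>i<Suc (Suc n). f (\<theta> (int i) x)) = f x + (\<Sum>i<Suc n. f (\<theta> (int i) (\<theta> 1 x)))"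
    by (subst sum.lessThan_Suc_shift) (simp add: flow_add add.commute)
  then show ?case using Suc[of "\<theta> 1 x"] by (simp add: max_def)
qed simp

text \<open>Moving from \<open>x\<close> to \<open>\<theta> 1 x\<close> changes the maxima by the
  finite number \<open>f x\<close>, up to truncation at 0 and one index. The event of unboundedness
  is thus strictly invariant, as the ergodicity axiom demands.\<close>

lemma running_max_unbounded_flow:
  "(\<forall>C. \<exists>n. running_max f n x > C) \<longleftrightarrow> (\<forall>C. \<exists>n. running_max f n (\<theta> 1 x) > C)" (is "?L \<longleftrightarrow> ?R")
proof
  assume L: ?L
  show ?R
  proof
    fix C
    obtain n where n: "running_max f n x > f x + max 0 C" using L by blast
    have "running_max f (Suc n) x > f x + max 0 C" using n running_max_mono[of f n x] by linarith
    then have "running_max f n (\<theta> 1 x) > C" by (auto simp: max_def split: if_splits)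
    then show "\<exists>n. running_max f n (\<theta> 1 x) > C" ..
  qed
next
  assume R: ?R
  show ?L
  proof
    fix C
    obtain n where n: "running_max f n (\<theta> 1 x) > C - f x" using R by blast
    then have "running_max f (Suc n) x > C" by (auto simp: max_def)
    then show "\<exists>n. running_max f n x > C" ..
  qed
qed

text \<open>If the running maxima were unbounded with probability one, then
  \<open>M\<^bsub>n+1\<^esub> - M\<^sub>n \<circ> \<theta>\<close>, which has nonnegative mean, would decrease to \<open>f\<close>.\<close>

lemma AE_partial_sums_bounded:
  fixes f :: "'a \<Rightarrow> real"
  assumes f: "integrable M f" and neg: "expectation f < 0"
  shows "AE x in M. \<exists>C. \<forall>n. (\<Sum>i<n. f (\<theta> (int i) x)) \<le> C"
proof -
  note [measurable] = borel_measurable_integrable[OF f]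
  \<comment> \<open>Natural number bounds keep the condition countable, hence measurable;
    \<open>A_alt\<close> returns to real bounds.\<close>
  define A where "A = {x \<in> space M. \<forall>C::nat. \<exists>n. running_max f n x > real C}"
  have A_alt: "x \<in> A \<longleftrightarrow> x \<in> space M \<and> (\<forall>C. \<exists>n. running_max f n x > C)" for x
    unfolding A_def by (auto, meson dual_order.strict_trans1 reals_Archimedean2 less_imp_le order_less_trans)
  have [measurable]: "A \<in> sets M" unfolding A_def by measurable
  have "\<theta> 1 -` A \<inter> space M = A"
    using running_max_unbounded_flow[of f] measurable_space[OF flow_measurable[of 1]]
    by (auto simp: A_alt)
  then consider "prob A = 0" | "prob A = 1" using flow_ergodic[of A] by auto
  then show ?thesis
  proof cases
    case 1
    then have "AE x in M. x \<notin> A"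
      by (intro AE_not_in) (simp add: emeasure_eq_measure null_sets_def)
    moreover have "AE x in M. x \<in> space M" by simp
    ultimately show ?thesis
    proof eventually_elim
      case (elim x)
      then obtain C where C: "\<And>n. running_max f n x \<le> C"
        using A_alt by (meson not_less)
      have "(\<Sum>i<n. f (\<theta> (int i) x)) \<le> max 0 C" for n
        using partial_sum_le_running_max[where f=f and x=x] C
        by (cases n) (auto simp del: sum.lessThan_Suc intro: order_trans max.coboundedI2)
      then show ?case by blast
    qed
  next
    case 2
    have A1: "AE x in M. x \<in> A" using 2 by (simp add: prob_eq_1 Collect_mem_eq cong: conj_cong)
    define d where "d n x = f x + max 0 (- running_max f n (\<theta> 1 x))" for n x
    have int_rm: "integrable M (\<lambda>x. running_max f n (\<theta> 1 x))" for n
      by (rule integrable_flow[OF running_max_integrable[OF f]])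
    have "0 \<le> (\<integral>x. d n x \<partial>M)" for n
    proof -
      have "0 \<le> (\<integral>x. running_max f (Suc n) x - running_max f n x \<partial>M)"
        by (intro integral_nonneg_AE AE_I2) (use running_max_mono in auto)
      also have "\<dots> = (\<integral>x. running_max f (Suc n) x \<partial>M) - (\<integral>x. running_max f n x \<partial>M)"
        by (intro Bochner_Integration.integral_diff running_max_integrable f)
      also have "(\<integral>x. running_max f n x \<partial>M) = (\<integral>x. running_max f n (\<theta> 1 x) \<partial>M)"
        by (rule integral_flow[symmetric]) simp
      also have "(\<integral>x. running_max f (Suc n) x \<partial>M) - \<dots> = (\<integral>x. running_max f (Suc n) x - running_max f n (\<theta> 1 x) \<partial>M)"
        by (intro Bochner_Integration.integral_diff[symmetric] running_max_integrable f int_rm)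
      also have "\<dots> = (\<integral>x. d n x \<partial>M)"
        by (intro Bochner_Integration.integral_cong) (auto simp: d_def max_def)
      finally show ?thesis .
    qed
    moreover have "(\<lambda>n. \<integral>x. d n x \<partial>M) \<longlonglongrightarrow> (\<integral>x. f x \<partial>M)"
    \<comment> \<open>The running maxima increase from \<open>f\<close>, so the negative part of the
      one at \<open>\<theta> 1 x\<close> is at most \<open>\<bar>f (\<theta> 1 x)\<bar>\<close> for
      every \<open>n\<close>.\<close>
    proof (rule integral_dominated_convergence[where w="\<lambda>x. \<bar>f x\<bar> + \<bar>f (\<theta> 1 x)\<bar>"])
      show "d n \<in> borel_measurable M" for n unfolding d_def by measurable
      show "integrable M (\<lambda>x. \<bar>f x\<bar> + \<bar>f (\<theta> 1 x)\<bar>)"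
        using f integrable_flow[OF f] by auto
      show "AE x in M. norm (d n x) \<le> \<bar>f x\<bar> + \<bar>f (\<theta> 1 x)\<bar>" for n
      proof (rule AE_I2)
        fix x
        have "f (\<theta> 1 x) \<le> running_max f n (\<theta> 1 x)"
          using running_max_incseq[of 0 n f "\<theta> 1 x"] by simp
        then show "norm (d n x) \<le> \<bar>f x\<bar> + \<bar>f (\<theta> 1 x)\<bar>" by (auto simp: d_def)
      qed
      show "AE x in M. (\<lambda>n. d n x) \<longlonglongrightarrow> f x"
        using A1
      proof eventually_elim
        case (elim x)
        then have "\<exists>n. running_max f n (\<theta> 1 x) > 0"
          using running_max_unbounded_flow[of f x] A_alt by blast
        then obtain n where "running_max f n (\<theta> 1 x) > 0" by blast
        then have "d m x = f x" if "m \<ge> n" for m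
          using running_max_incseq[OF that, of f "\<theta> 1 x"] by (auto simp: d_def)
        then show ?case
          by (intro tendsto_eventually) (auto simp: eventually_sequentially)
      qed
    qed auto
    ultimately have "0 \<le> expectation f"
      by (intro LIMSEQ_le_const) auto
    with neg show ?thesis by simp
  qed
qed

text \<open>Subtracting slightly more than the mean makes the mean negative, so the corrected
  partial sums are bounded above and the averages exceed the mean by at most that margin in the
  limit. Applying this to \<open>f\<close> and \<open>- f\<close> with the countably many margins
  1/(k+1) gives both inequalities.\<close>

theorem birkhoff_AE:
  fixes f :: "'a \<Rightarrow> real"
  assumes f: "integrable M f"
  shows "AE x in M. (\<lambda>n. (\<Sum>i<n. f (\<theta> (int i) x)) / real n) \<longlonglongrightarrow> expectation f"
proof -
  have bd: "AE x in M. \<exists>C. \<forall>n. (\<Sum>i<n. g (\<theta> (int i) x)) - real n * (expectation g + 1 / real (Suc k)) \<le> C"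
    if g: "integrable M g" for g :: "'a \<Rightarrow> real" and k
  proof -
    have "AE x in M. \<exists>C. \<forall>n. (\<Sum>i<n. g (\<theta> (int i) x) - (expectation g + 1 / real (Suc k))) \<le> C"
      by (rule AE_partial_sums_bounded) (use g in \<open>auto simp: prob_space field_simps\<close>)
    then show ?thesis by (simp add: sum_subtractf)
  qed
  have 1: "AE x in M. \<forall>k. \<exists>C. \<forall>n. (\<Sum>i<n. f (\<theta> (int i) x)) - real n * (expectation f + 1 / real (Suc k)) \<le> C"
    using bd[OF f] by (subst AE_all_countable) auto
  have 2: "AE x in M. \<forall>k. \<exists>C. \<forall>n. (\<Sum>i<n. - f (\<theta> (int i) x)) - real n * (expectation (\<lambda>x. - f x) + 1 / real (Suc k)) \<le> C"
    using bd[of "\<lambda>x. - f x"] f by (subst AE_all_countable) auto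
  from 1 2 show ?thesis
  proof eventually_elim
    case (elim x)
    define S where "S n = (\<Sum>i<n. f (\<theta> (int i) x))" for n
    show ?case unfolding S_def[symmetric]
    proof (rule LIMSEQ_I)
      fix r :: real assume "r > 0"
      then obtain k where k: "1 / real (Suc k) < r / 2"
        using nat_approx_posE[of "r/2"] by (auto simp: field_simps)
      obtain C where C: "\<And>n. S n - real n * (expectation f + 1 / real (Suc k)) \<le> C"
        using elim(1) by (auto simp: S_def)
      obtain C' where C': "\<And>n. - S n - real n * (- expectation f + 1 / real (Suc k)) \<le> C'"
        using elim(2) by (auto simp: S_def sum_negf)
      define B where "B = max 1 (max C C')"
      obtain N where N: "real N > 2 * B / r" using reals_Archimedean2 by blast
      have "norm (S n / real n - expectation f) < r" if n: "n \<ge> Suc N" for n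
      proof -
        have n0: "real n > 0" using n by simp
        have "2 * B / r < real n" using N n by linarith
        then have "B / real n < r / 2" using n0 \<open>r > 0\<close> by (simp add: field_simps)
        moreover have "S n \<le> B + real n * (expectation f + 1 / real (Suc k))"
          using C[of n] unfolding B_def by linarith
        then have "S n / real n \<le> (B + real n * (expectation f + 1 / real (Suc k))) / real n"
          using n0 by (intro divide_right_mono) auto
        then have "S n / real n \<le> B / real n + (expectation f + 1 / real (Suc k))"
          using n0 by (simp add: add_divide_distrib)
        moreover have "- S n \<le> B + real n * (- expectation f + 1 / real (Suc k))"
          using C'[of n] unfolding B_def by linarith
        then have "- S n / real n \<le> (B + real n * (- expectation f + 1 / real (Suc k))) / real n"
          using n0 by (intro divide_right_mono) auto
        then have "- S n / real n \<le> B / real n + (- expectation f + 1 / real (Suc k))"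
          using n0 by (simp add: add_divide_distrib)
        ultimately show ?thesis using k unfolding real_norm_def by linarith
      qed
      then show "\<exists>no. \<forall>n\<ge>no. norm (S n / real n - expectation f) < r" by blast
    qed
  qed
qed

text \<open>Scheffe's argument: with average A and mean m,
  \<open>\<bar>A - m\<bar> = A + m - 2 * min A m\<close>. The averages have mean exactly m, and for
  nonnegative \<open>f\<close> the minimum lies between 0 and m, so dominated convergence applies to
  it.\<close>

lemma birkhoff_L1_nonneg:
  fixes f :: "'a \<Rightarrow> real"
  assumes f: "integrable M f" and nn: "\<And>x. f x \<ge> 0"
  shows "(\<lambda>n. \<integral>x. \<bar>(\<Sum>i<n. f (\<theta> (int i) x)) / real n - expectation f\<bar> \<partial>M) \<longlonglongrightarrow> 0"
proof -
  note [measurable] = borel_measurable_integrable[OF f]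
  define A where "A n x = (\<Sum>i<n. f (\<theta> (int i) x)) / real n" for n x
  define m where "m = expectation f"
  have m0: "m \<ge> 0" unfolding m_def using nn by simp
  have A0: "A n x \<ge> 0" for n x unfolding A_def using nn by (simp add: sum_nonneg)
  have A_int: "integrable M (A n)" for n
    unfolding A_def using integrable_flow[OF f] by auto
  have EA: "expectation (A n) = m" if "n > 0" for n
    unfolding A_def using that integrable_flow[OF f] by (simp add: integral_flow m_def)
  have "(\<lambda>n. \<integral>x. min (A n x) m \<partial>M) \<longlonglongrightarrow> (\<integral>x. m \<partial>M)"
  proof (rule integral_dominated_convergence[where w="\<lambda>_. m"])
    show "AE x in M. (\<lambda>n. min (A n x) m) \<longlonglongrightarrow> m"
      using birkhoff_AE[OF f]
    proof eventually_elim
      case (elim x)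
      then have "(\<lambda>n. min (A n x) m) \<longlonglongrightarrow> min m m"
        unfolding A_def m_def by (intro tendsto_min tendsto_const)
      then show ?case by simp
    qed
    show "(\<lambda>x. min (A n x) m) \<in> borel_measurable M" for n unfolding A_def by measurable
  qed (use A0 m0 in auto)
  then have "(\<lambda>n. 2 * m - 2 * (\<integral>x. min (A n x) m \<partial>M)) \<longlonglongrightarrow> 2 * m - 2 * m"
    by (intro tendsto_intros) (simp add: prob_space)
  moreover have "eventually (\<lambda>n. (\<integral>x. \<bar>A n x - m\<bar> \<partial>M) = 2 * m - 2 * (\<integral>x. min (A n x) m \<partial>M)) sequentially"
    using eventually_gt_at_top[of 0]
  proof eventually_elim
    case (elim n)
    have "(\<integral>x. \<bar>A n x - m\<bar> \<partial>M) = (\<integral>x. A n x + m - 2 * min (A n x) m \<partial>M)"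
      by (intro Bochner_Integration.integral_cong) (auto simp: min_def)
    also have "\<dots> = 2 * m - 2 * (\<integral>x. min (A n x) m \<partial>M)"
      using A_int EA[OF elim] by (simp add: prob_space)
    finally show ?case .
  qed
  ultimately show ?thesis
    unfolding A_def[symmetric] m_def[symmetric] using tendsto_cong by force
qed

end

section \<open>Square-integrable functions\<close>

definition square_integrable :: "'a measure \<Rightarrow> ('a \<Rightarrow> real) \<Rightarrow> bool" where
  "square_integrable M f \<longleftrightarrow> f \<in> borel_measurable M \<and> integrable M (\<lambda>x. (f x)\<^sup>2)"

definition L2norm :: "'a measure \<Rightarrow> ('a \<Rightarrow> real) \<Rightarrow> real" where
  "L2norm M f = sqrt (\<integral>x. (f x)\<^sup>2 \<partial>M)"

lemma square_integrableD:
  assumes "square_integrable M f"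
  shows "f \<in> borel_measurable M" "integrable M (\<lambda>x. (f x)\<^sup>2)"
  using assms by (auto simp: square_integrable_def)

lemma L2norm_nonneg [simp]: "L2norm M f \<ge> 0"
  by (simp add: L2norm_def)

lemma L2norm_power2: "(L2norm M f)\<^sup>2 = (\<integral>x. (f x)\<^sup>2 \<partial>M)"
  by (simp add: L2norm_def)

lemma L2norm_cong_AE:
  assumes "f \<in> borel_measurable M" "g \<in> borel_measurable M" "AE x in M. f x = g x"
  shows "L2norm M f = L2norm M g"
  unfolding L2norm_def using assms by (intro arg_cong[where f=sqrt] integral_cong_AE) auto

lemma square_integrable_mult_integrable:
  assumes f: "square_integrable M f" and g: "square_integrable M g"
  shows "integrable M (\<lambda>x. f x * g x)"
proof (rule Bochner_Integration.integrable_bound)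
  note [measurable] = square_integrableD(1)[OF f] square_integrableD(1)[OF g]
  show "integrable M (\<lambda>x. (f x)\<^sup>2 + (g x)\<^sup>2)"
    using f g by (auto simp: square_integrable_def)
  show "(\<lambda>x. f x * g x) \<in> borel_measurable M" by measurable
  have "norm (f x * g x) \<le> norm ((f x)\<^sup>2 + (g x)\<^sup>2)" for x
  proof -
    have "2 * (\<bar>f x\<bar> * \<bar>g x\<bar>) \<le> (f x)\<^sup>2 + (g x)\<^sup>2"
      using sum_squares_bound[of "\<bar>f x\<bar>" "\<bar>g x\<bar>"] by (simp add: mult.assoc)
    moreover have "0 \<le> \<bar>f x\<bar> * \<bar>g x\<bar>" by simp
    ultimately have "\<bar>f x\<bar> * \<bar>g x\<bar> \<le> (f x)\<^sup>2 + (g x)\<^sup>2" by linarith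
    then show ?thesis by (simp add: abs_mult)
  qed
  then show "AE x in M. norm (f x * g x) \<le> norm ((f x)\<^sup>2 + (g x)\<^sup>2)" by simp
qed

lemma square_integrable_cmult [intro]:
  "square_integrable M f \<Longrightarrow> square_integrable M (\<lambda>x. c * f x)"
  by (auto simp: square_integrable_def power_mult_distrib)

lemma square_integrable_add [intro]:
  assumes f: "square_integrable M f" and g: "square_integrable M g"
  shows "square_integrable M (\<lambda>x. f x + g x)"
  using f g square_integrable_mult_integrable[OF f g]
  by (auto simp: square_integrable_def power2_sum mult.assoc)

lemma square_integrable_diff [intro]:
  assumes f: "square_integrable M f" and g: "square_integrable M g"
  shows "square_integrable M (\<lambda>x. f x - g x)"
  using square_integrable_add[OF f square_integrable_cmult[OF g, of "-1"]] by simp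

lemma square_integrable_sum [intro]:
  assumes "\<And>i. i \<in> I \<Longrightarrow> square_integrable M (f i)"
  shows "square_integrable M (\<lambda>x. \<Sum>i\<in>I. f i x)"
  using assms by (induction I rule: infinite_finite_induct) (auto simp: square_integrable_def[of _ "\<lambda>x. 0"])

lemma integral_power2_add:
  assumes f: "square_integrable M f" and g: "square_integrable M g"
  shows "(\<integral>x. (f x + g x)\<^sup>2 \<partial>M) = (\<integral>x. (f x)\<^sup>2 \<partial>M) + 2 * (\<integral>x. f x * g x \<partial>M) + (\<integral>x. (g x)\<^sup>2 \<partial>M)"
proof -
  have "(\<integral>x. (f x + g x)\<^sup>2 \<partial>M) = (\<integral>x. (f x)\<^sup>2 + 2 * (f x * g x) + (g x)\<^sup>2 \<partial>M)"
    by (simp add: power2_sum algebra_simps)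
  then show ?thesis
    using square_integrableD(2)[OF f] square_integrableD(2)[OF g] square_integrable_mult_integrable[OF f g]
    by simp
qed

text \<open>Cauchy-Schwarz: the quadratic \<open>A + 2 * l * B + l\<^sup>2 * C\<close> is
  nonnegative for every l. The minimiser l = -B/C gives the bound; if C = 0 and B were nonzero, the
  chosen l would make the value -1.\<close>

lemma abs_integral_mult_le_L2norm:
  assumes f: "square_integrable M f" and g: "square_integrable M g"
  shows "\<bar>\<integral>x. f x * g x \<partial>M\<bar> \<le> L2norm M f * L2norm M g"
proof -
  define A B C where "A = (\<integral>x. (f x)\<^sup>2 \<partial>M)" and "B = (\<integral>x. f x * g x \<partial>M)" and "C = (\<integral>x. (g x)\<^sup>2 \<partial>M)"
  have A0: "A \<ge> 0" and C0: "C \<ge> 0" by (simp_all add: A_def C_def)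
  have q: "0 \<le> A + 2 * l * B + l\<^sup>2 * C" for l
  proof -
    have "0 \<le> (\<integral>x. (f x + l * g x)\<^sup>2 \<partial>M)" by simp
    also have "\<dots> = A + 2 * l * B + l\<^sup>2 * C"
      using integral_power2_add[OF f square_integrable_cmult[OF g, of l]]
      by (simp add: A_def B_def C_def power_mult_distrib mult.left_commute[of _ l])
    finally show ?thesis .
  qed
  have "B\<^sup>2 \<le> A * C"
  proof (cases "C = 0")
    case True
    have "B = 0"
    proof (rule ccontr)
      assume "B \<noteq> 0"
      then have "0 \<le> A - (A + 1)" using q[of "- (A + 1) / (2 * B)"] True by (simp add: field_simps)
      then show False by simp
    qed
    then show ?thesis using A0 C0 by simp
  next
    case False
    then have "0 < C" using C0 by simp
    have "0 \<le> A + 2 * (- B / C) * B + (- B / C)\<^sup>2 * C" by (rule q)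
    also have "\<dots> = A - B\<^sup>2 / C" using \<open>0 < C\<close> by (simp add: power2_eq_square field_simps)
    finally show ?thesis using \<open>0 < C\<close> by (simp add: field_simps)
  qed
  then have "sqrt (B\<^sup>2) \<le> sqrt (A * C)" by (rule real_sqrt_le_mono)
  then show ?thesis by (simp add: L2norm_def A_def B_def C_def real_sqrt_mult)
qed

lemma L2norm_cmult: "L2norm M (\<lambda>x. c * f x) = \<bar>c\<bar> * L2norm M f"
  by (simp add: L2norm_def power_mult_distrib real_sqrt_mult)

lemma L2norm_minus_commute: "L2norm M (\<lambda>x. f x - g x) = L2norm M (\<lambda>x. g x - f x)"
  by (simp add: L2norm_def power2_commute)

lemma L2norm_triangle:
  assumes f: "square_integrable M f" and g: "square_integrable M g"
  shows "L2norm M (\<lambda>x. f x + g x) \<le> L2norm M f + L2norm M g"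
proof (rule power2_le_imp_le)
  have "(L2norm M (\<lambda>x. f x + g x))\<^sup>2 = (L2norm M f)\<^sup>2 + 2 * (\<integral>x. f x * g x \<partial>M) + (L2norm M g)\<^sup>2"
    unfolding L2norm_power2 by (rule integral_power2_add[OF f g])
  also have "\<dots> \<le> (L2norm M f + L2norm M g)\<^sup>2"
    using abs_integral_mult_le_L2norm[OF f g] by (simp add: power2_sum)
  finally show "(L2norm M (\<lambda>x. f x + g x))\<^sup>2 \<le> (L2norm M f + L2norm M g)\<^sup>2" .
qed simp

lemma L2norm_triangle_diff:
  assumes f: "square_integrable M f" and g: "square_integrable M g"
  shows "L2norm M f \<le> L2norm M (\<lambda>x. f x - g x) + L2norm M g"
  using L2norm_triangle[OF square_integrable_diff[OF f g] g] by simp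

lemma L2norm_sum_le:
  assumes "\<And>i. i \<in> I \<Longrightarrow> square_integrable M (f i)"
  shows "L2norm M (\<lambda>x. \<Sum>i\<in>I. f i x) \<le> (\<Sum>i\<in>I. L2norm M (f i))"
  using assms
proof (induction I rule: infinite_finite_induct)
  case (insert a A)
  have "L2norm M (\<lambda>x. f a x + (\<Sum>i\<in>A. f i x)) \<le> L2norm M (f a) + L2norm M (\<lambda>x. \<Sum>i\<in>A. f i x)"
    using insert.prems by (intro L2norm_triangle square_integrable_sum) auto
  with insert show ?case by fastforce
qed (auto simp: L2norm_def)

lemma (in prob_space) square_integrable_bounded:
  assumes "f \<in> borel_measurable M" "\<And>x. \<bar>f x\<bar> \<le> B"
  shows "square_integrable M f"
  unfolding square_integrable_def
proof
  show "integrable M (\<lambda>x. (f x)\<^sup>2)"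
    by (rule integrable_const_bound[where B="B\<^sup>2"])
      (use assms in \<open>auto simp: abs_le_square_iff[symmetric] intro: order_trans[OF _ abs_ge_self]\<close>)
qed fact

lemma (in prob_space) square_integrable_integrable:
  "square_integrable M f \<Longrightarrow> integrable M f"
  by (auto simp: square_integrable_def intro: square_integrable_imp_integrable)

lemma (in prob_space) expectation_abs_le_L2norm:
  assumes f: "square_integrable M f"
  shows "expectation (\<lambda>x. \<bar>f x\<bar>) \<le> L2norm M f"
proof -
  have "square_integrable M (\<lambda>x. \<bar>f x\<bar>)" "square_integrable M (\<lambda>x. 1)"
    using f by (auto simp: square_integrable_def)
  from abs_integral_mult_le_L2norm[OF this] show ?thesis
    by (simp add: L2norm_def prob_space)
qed

context ergodic_flow
begin

lemma square_integrable_flow [intro]: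
  "square_integrable M f \<Longrightarrow> square_integrable M (\<lambda>x. f (\<theta> k x))"
  using integrable_flow[of "\<lambda>x. (f x)\<^sup>2" k] by (auto simp: square_integrable_def)

lemma L2norm_flow:
  assumes "f \<in> borel_measurable M"
  shows "L2norm M (\<lambda>x. f (\<theta> k x)) = L2norm M f"
  unfolding L2norm_def using assms by (subst integral_flow[of "\<lambda>x. (f x)\<^sup>2"]) auto

text \<open>A shift by one step alters the sum only at its two ends, so the cost of j steps is 2j
  norms uniformly in \<open>n\<close>. After division by \<open>sqrt n\<close> it
  disappears.\<close>

lemma L2norm_sum_flow_shift_le:
  assumes f: "square_integrable M f"
  shows "L2norm M (\<lambda>x. (\<Sum>i<n. f (\<theta> (int i) x)) - (\<Sum>i<n. f (\<theta> (int i + int j) x))) \<le> 2 * real j * L2norm M f"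
proof (induction j)
  case 0
  then show ?case by (simp add: L2norm_def)
next
  case (Suc j)
  note f_meas = square_integrableD(1)[OF f]
  let ?B = "\<lambda>j x. \<Sum>i<n. f (\<theta> (int i + int j) x)"
  have B_sq: "square_integrable M (?B j)" for j
    using f by (intro square_integrable_sum square_integrable_flow)
  have sq0: "square_integrable M (\<lambda>x. \<Sum>i<n. f (\<theta> (int i) x))"
    using f by (intro square_integrable_sum square_integrable_flow)
  have fl: "square_integrable M (\<lambda>x. f (\<theta> k x))" for k
    using f by (rule square_integrable_flow)
  have eq: "?B j x - ?B (Suc j) x = f (\<theta> (int j) x) - f (\<theta> (int n + int j) x)" for x
  proof -
    have "?B j x + f (\<theta> (int n + int j) x) = (\<Sum>i<Suc n. f (\<theta> (int i + int j) x))" by simp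
    also have "\<dots> = f (\<theta> (int j) x) + ?B (Suc j) x"
      by (subst sum.lessThan_Suc_shift) (simp add: algebra_simps)
    finally show ?thesis by simp
  qed
  have "L2norm M (\<lambda>x. (\<Sum>i<n. f (\<theta> (int i) x)) - ?B (Suc j) x)
     = L2norm M (\<lambda>x. ((\<Sum>i<n. f (\<theta> (int i) x)) - ?B j x) + (f (\<theta> (int j) x) - f (\<theta> (int n + int j) x)))"
    unfolding eq[symmetric] by (simp add: algebra_simps)
  also have "\<dots> \<le> 2 * real j * L2norm M f + L2norm M (\<lambda>x. f (\<theta> (int j) x) - f (\<theta> (int n + int j) x))"
    by (rule order_trans[OF L2norm_triangle add_right_mono[OF Suc]])
      (intro square_integrable_diff sq0 B_sq fl)+
  also have "L2norm M (\<lambda>x. f (\<theta> (int j) x) - f (\<theta> (int n + int j) x)) \<le> L2norm M f + L2norm M f"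
    using L2norm_triangle[OF fl[of "int j"] square_integrable_cmult[OF fl[of "int n + int j"], of "-1"]]
      L2norm_cmult[of M "-1" "\<lambda>x. f (\<theta> (int n + int j) x)"]
    by (simp add: L2norm_flow f_meas)
  finally show ?case by (simp add: algebra_simps)
qed

end

section \<open>Filtrations moved by the flow, and their innovations\<close>

locale filtered_flow = ergodic_flow M \<theta> for M :: "'a measure" and \<theta> +
  fixes F :: "int \<Rightarrow> 'a measure"
  assumes subalg: "\<And>i. subalgebra M (F i)"
    and filtration_mono: "\<And>i j. i \<le> j \<Longrightarrow> subalgebra (F j) (F i)"
    and flow_filtration: "\<And>i k. \<theta> k \<in> F (i + k) \<rightarrow>\<^sub>M F i"
begin

lemma measurable_filtration_mono:
  assumes "i \<le> j" "f \<in> F i \<rightarrow>\<^sub>M N"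
  shows "f \<in> F j \<rightarrow>\<^sub>M N"
  using measurable_from_subalg[OF filtration_mono[OF assms(1)] assms(2)] .

lemma measurable_flow_filtration:
  assumes "f \<in> F i \<rightarrow>\<^sub>M N" "j = i + k"
  shows "(\<lambda>x. f (\<theta> k x)) \<in> F j \<rightarrow>\<^sub>M N"
  using measurable_compose[OF flow_filtration assms(1)] assms(2) by simp

text \<open>A square-integrable martingale difference at time \<open>i\<close>, expressed through
  orthogonality to the square-integrable functions of the past. In this form the central limit
  theorem can be proved by testing with bounded functions, without conditional expectations.\<close>

definition innovation :: "int \<Rightarrow> ('a \<Rightarrow> real) \<Rightarrow> bool" where
  "innovation i f \<longleftrightarrow> f \<in> borel_measurable (F i) \<and> square_integrable M f \<and>
     (\<forall>\<phi> \<in> borel_measurable (F (i - 1)). square_integrable M \<phi> \<longrightarrow> (\<integral>x. \<phi> x * f x \<partial>M) = 0)"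

text \<open>A test function of the past of \<open>j\<close> is carried by
  \<open>\<theta> (- k)\<close> to one of the past of \<open>i\<close>, and invariance of the
  measure equates the two integrals.\<close>

lemma innovation_flow:
  assumes f: "innovation i f" and j: "j = i + k"
  shows "innovation j (\<lambda>x. f (\<theta> k x))"
  unfolding innovation_def
proof (intro conjI ballI impI)
  show "(\<lambda>x. f (\<theta> k x)) \<in> borel_measurable (F j)"
    using f j unfolding innovation_def by (blast intro: measurable_flow_filtration)
  show "square_integrable M (\<lambda>x. f (\<theta> k x))"
    using f unfolding innovation_def by blast
  fix \<phi> assume \<phi>: "\<phi> \<in> borel_measurable (F (j - 1))" "square_integrable M \<phi>"
  have 1: "(\<lambda>x. \<phi> (\<theta> (- k) x)) \<in> borel_measurable (F (i - 1))"
    using \<phi>(1) by (rule measurable_flow_filtration) (simp add: j)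
  note [measurable] = square_integrableD(1)[OF \<phi>(2)]
  have [measurable]: "f \<in> borel_measurable M" using f unfolding innovation_def by (blast intro: square_integrableD)
  have "(\<integral>x. \<phi> x * f (\<theta> k x) \<partial>M) = (\<integral>x. \<phi> (\<theta> (- k) (\<theta> k x)) * f (\<theta> k x) \<partial>M)"
    by (simp add: flow_add)
  also have "\<dots> = (\<integral>x. \<phi> (\<theta> (- k) x) * f x \<partial>M)"
    by (rule integral_flow) measurable
  also have "\<dots> = 0"
    using f 1 square_integrable_flow[OF \<phi>(2)] unfolding innovation_def by blast
  finally show "(\<integral>x. \<phi> x * f (\<theta> k x) \<partial>M) = 0" .
qed

lemma innovation_sum:
  assumes "\<And>j. j \<in> I \<Longrightarrow> innovation i (f j)"
  shows "innovation i (\<lambda>x. \<Sum>j\<in>I. f j x)"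
  unfolding innovation_def
proof (intro conjI ballI impI)
  show "(\<lambda>x. \<Sum>j\<in>I. f j x) \<in> borel_measurable (F i)"
    using assms unfolding innovation_def by (intro borel_measurable_sum) blast
  show "square_integrable M (\<lambda>x. \<Sum>j\<in>I. f j x)"
    using assms unfolding innovation_def by (intro square_integrable_sum) blast
  fix \<phi> assume \<phi>: "\<phi> \<in> borel_measurable (F (i - 1))" "square_integrable M \<phi>"
  have "(\<integral>x. \<phi> x * (\<Sum>j\<in>I. f j x) \<partial>M) = (\<Sum>j\<in>I. \<integral>x. \<phi> x * f j x \<partial>M)"
    unfolding sum_distrib_left using assms \<phi>(2)
    by (intro Bochner_Integration.integral_sum square_integrable_mult_integrable) (auto simp: innovation_def)
  also have "\<dots> = 0"
    using assms \<phi> unfolding innovation_def by (intro sum.neutral) blast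
  finally show "(\<integral>x. \<phi> x * (\<Sum>j\<in>I. f j x) \<partial>M) = 0" .
qed

text \<open>Pythagoras: the sum of the first n terms is measurable at time i+n-1, hence orthogonal
  to the next term. The identity is exact; it yields both the variance of the approximating
  martingale and the size of the neglected tail.\<close>

lemma L2norm_sum_innovation:
  assumes f: "innovation i f"
  shows "L2norm M (\<lambda>x. \<Sum>k<n. f (\<theta> (int k) x)) = sqrt (real n) * L2norm M f"
proof -
  have sq: "square_integrable M f" and f_F: "f \<in> borel_measurable (F i)"
    using f by (auto simp: innovation_def)
  note fm = square_integrableD(1)[OF sq]
  have "(\<integral>x. (\<Sum>k<n. f (\<theta> (int k) x))\<^sup>2 \<partial>M) = real n * (\<integral>x. (f x)\<^sup>2 \<partial>M)"
  proof (induction n)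
    case (Suc n)
    let ?S = "\<lambda>x. \<Sum>k<n. f (\<theta> (int k) x)"
    have S_F: "?S \<in> borel_measurable (F (i + int n - 1))"
    proof (rule borel_measurable_sum)
      fix k assume "k \<in> {..<n}"
      then have "i + int k \<le> i + int n - 1" by auto
      moreover have "(\<lambda>x. f (\<theta> (int k) x)) \<in> borel_measurable (F (i + int k))"
        by (rule measurable_flow_filtration[OF f_F]) simp
      ultimately show "(\<lambda>x. f (\<theta> (int k) x)) \<in> borel_measurable (F (i + int n - 1))"
        by (rule measurable_filtration_mono)
    qed
    have S_sq: "square_integrable M ?S" using sq by (intro square_integrable_sum square_integrable_flow)
    have "(\<integral>x. ?S x * f (\<theta> (int n) x) \<partial>M) = 0"
      using innovation_flow[OF f refl, of "int n"] S_F S_sq unfolding innovation_def by blast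
    moreover have "(\<integral>x. (f (\<theta> (int n) x))\<^sup>2 \<partial>M) = (\<integral>x. (f x)\<^sup>2 \<partial>M)"
      using fm by (intro integral_flow[of "\<lambda>x. (f x)\<^sup>2"]) auto
    ultimately show ?case
      using Suc integral_power2_add[OF S_sq square_integrable_flow[OF sq, of "int n"]]
      by (simp add: algebra_simps)
  qed simp
  then show ?thesis by (simp add: L2norm_def real_sqrt_mult)
qed

end

section \<open>A central limit theorem for stationary martingale differences\<close>

lemma sum_lessThan_blocks:
  fixes f :: "nat \<Rightarrow> 'b::comm_monoid_add"
  assumes "q * m \<le> n"
  shows "(\<Sum>k<n. f k) = (\<Sum>b<q. \<Sum>l<m. f (b * m + l)) + (\<Sum>k\<in>{q * m..<n}. f k)"
proof -
  have "(\<Sum>l<m. f (b * m + l)) = sum f {b * m..<b * m + m}" for b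
    using sum.shift_bounds_nat_ivl[of f 0 "b * m" m] by (simp add: atLeast0LessThan add.commute)
  then have "(\<Sum>b<q. \<Sum>l<m. f (b * m + l)) = sum f {..<q * m}"
    by (simp add: sum.nat_group)
  moreover have "{..<n} = {..<q * m} \<union> {q * m..<n}" using assms by auto
  then have "sum f {..<n} = sum f ({..<q * m} \<union> {q * m..<n})" by (rule arg_cong)
  then have "sum f {..<n} = sum f {..<q * m} + sum f {q * m..<n}"
    by (subst (asm) sum.union_disjoint) auto
  ultimately show ?thesis by simp
qed

text \<open>On a block of fixed length \<open>m\<close> the slowly varying weight is frozen at the
  left end, which leaves the block sum of \<open>Q\<close>, small in \<open>L\<^sub>1\<close>
  relative to \<open>m\<close> by \<open>avg\<close>. The length \<open>m\<close> is chosen before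
  \<open>n\<close>, so the increments of the weight within a block tend to 0.\<close>

lemma (in ergodic_flow) block_average_tendsto_0:
  fixes c :: "nat \<Rightarrow> nat \<Rightarrow> 'a \<Rightarrow> complex"
  assumes Q: "integrable M Q"
    and avg: "(\<lambda>m. \<integral>x. \<bar>(\<Sum>i<m. Q (\<theta> (int i) x)) / real m\<bar> \<partial>M) \<longlonglongrightarrow> 0"
    and c_meas [measurable]: "\<And>n k. c n k \<in> borel_measurable M"
    and c_le: "\<And>n k x. norm (c n k x) \<le> 1"
    and W [measurable]: "W \<in> borel_measurable M" and W0: "\<And>x. W x \<ge> 0"
    and s: "s \<longlonglongrightarrow> 0" and s0: "\<And>n. s n \<ge> 0"
    and slow: "\<And>n k l x. k + l < n \<Longrightarrow>
        norm (c n (k + l) x - c n k x) \<le> s n * (\<Sum>i<l. W (\<theta> (int k + int i) x))"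
  shows "(\<lambda>n. (\<Sum>k<n. \<integral>x. c n k x * Q (\<theta> (int k) x) \<partial>M) / real n) \<longlonglongrightarrow> 0"
proof (rule tendsto_norm_zero_cancel, rule LIMSEQ_I)
  let ?A = "\<lambda>n. \<Sum>k<n. \<integral>x. c n k x * Q (\<theta> (int k) x) \<partial>M"
  note [measurable] = borel_measurable_integrable[OF Q]
  fix r :: real assume "r > 0"
  define \<delta> where "\<delta> m = (\<integral>x. \<bar>\<Sum>i<m. Q (\<theta> (int i) x)\<bar> \<partial>M)" for m
  have "(\<lambda>m. \<delta> m / real m) \<longlonglongrightarrow> 0"
    using avg by (simp add: \<delta>_def)
  then have "eventually (\<lambda>m. \<delta> m / real m < r / 3 \<and> m > 0) sequentially"
    using \<open>r > 0\<close> by (intro eventually_conj order_tendstoD eventually_gt_at_top) auto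
  then obtain m where m: "\<delta> m / real m < r / 3" "m > 0"
    by (auto simp: eventually_sequentially)
  define V where "V x = (\<Sum>i<m. \<bar>Q (\<theta> (int i) x)\<bar>)" for x
  define U where "U x = (\<Sum>i<m. W (\<theta> (int i) x))" for x
  have V_int: "integrable M V" unfolding V_def by (intro Bochner_Integration.integrable_sum integrable_abs integrable_flow Q)
  have [measurable]: "V \<in> borel_measurable M" "U \<in> borel_measurable M" unfolding V_def U_def by measurable
  have V0: "V x \<ge> 0" and U0: "U x \<ge> 0" for x unfolding V_def U_def using W0 by (auto intro: sum_nonneg)
  \<comment> \<open>An increment of \<open>c\<close> is bounded both by 2 and by
    \<open>s n * U\<close>. Keeping the minimum of the two gives the dominating function
    \<open>2 * V\<close>, so that the product \<open>U * V\<close> never has to be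
    integrated.\<close>
  define \<eta> where "\<eta> n = (\<integral>x. min 2 (s n * U x) * V x \<partial>M)" for n
  have mn: "0 \<le> min 2 (s n * U x)" "min 2 (s n * U x) \<le> 2" for n x using s0 U0 by (auto simp: min_def)
  have mnV: "norm (min 2 (s n * U x) * V x) \<le> 2 * V x" for n x
  proof -
    have "\<bar>min 2 (s n * U x)\<bar> \<le> 2" using mn[of n x] by linarith
    then have "\<bar>min 2 (s n * U x)\<bar> * V x \<le> 2 * V x" by (rule mult_right_mono[OF _ V0])
    then show ?thesis by (simp only: real_norm_def abs_mult abs_of_nonneg[OF V0])
  qed
  have \<eta>_int: "integrable M (\<lambda>x. min 2 (s n * U x) * V x)" for n
  proof (rule Bochner_Integration.integrable_bound[OF integrable_mult_right[OF V_int, of 2]])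
    show "AE x in M. norm (min 2 (s n * U x) * V x) \<le> norm (2 * V x)"
      by (rule AE_I2, rule order_trans[OF mnV]) simp
  qed measurable
  have "\<eta> \<longlonglongrightarrow> (\<integral>x. 0 \<partial>M)" unfolding \<eta>_def
  proof (rule integral_dominated_convergence[where w="\<lambda>x. 2 * V x"])
    show "AE x in M. (\<lambda>n. min 2 (s n * U x) * V x) \<longlonglongrightarrow> 0"
    proof (rule AE_I2)
      fix x
      have "(\<lambda>n. min 2 (s n * U x) * V x) \<longlonglongrightarrow> min 2 (0 * U x) * V x"
        by (intro tendsto_intros s)
      then show "(\<lambda>n. min 2 (s n * U x) * V x) \<longlonglongrightarrow> 0" by simp
    qed
    show "AE x in M. norm (min 2 (s n * U x) * V x) \<le> 2 * V x" for n
      by (rule AE_I2, rule mnV)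
  qed (use V_int in auto)
  then have "\<eta> \<longlonglongrightarrow> 0" by simp
  have cQ_int: "integrable M (\<lambda>x. c n k x * complex_of_real (Q (\<theta> j x)))" for n k j
    by (rule Bochner_Integration.integrable_bound[OF integrable_flow[OF Q, of j]])
      (auto simp: norm_mult intro!: mult_left_le_one_le c_le)
  have block: "norm (\<Sum>l<m. \<integral>x. c n (b * m + l) x * Q (\<theta> (int (b * m + l)) x) \<partial>M) \<le> \<eta> n + \<delta> m"
    if le: "b * m + m \<le> n" for b n
  proof -
    define k where "k = b * m"
    have "(\<Sum>l<m. \<integral>x. c n (k + l) x * Q (\<theta> (int (k + l)) x) \<partial>M)
        = (\<integral>x. (\<Sum>l<m. c n (k + l) x * Q (\<theta> (int (k + l)) x)) \<partial>M)"
      by (rule Bochner_Integration.integral_sum[symmetric]) (rule cQ_int)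
    also have "norm \<dots> \<le> (\<integral>x. min 2 (s n * U (\<theta> (int k) x)) * V (\<theta> (int k) x)
        + \<bar>\<Sum>i<m. Q (\<theta> (int i) (\<theta> (int k) x))\<bar> \<partial>M)"
    proof (rule norm_integral_le_integral)
      show "integrable M (\<lambda>x. \<Sum>l<m. c n (k + l) x * Q (\<theta> (int (k + l)) x))"
        by (intro Bochner_Integration.integrable_sum cQ_int)
      show "integrable M (\<lambda>x. min 2 (s n * U (\<theta> (int k) x)) * V (\<theta> (int k) x)
        + \<bar>\<Sum>i<m. Q (\<theta> (int i) (\<theta> (int k) x))\<bar>)"
        by (intro Bochner_Integration.integrable_add integrable_flow[OF \<eta>_int] integrable_abs Bochner_Integration.integrable_sum)
          (simp add: flow_add integrable_flow Q)
      fix x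
      have "(\<Sum>l<m. c n (k + l) x * Q (\<theta> (int (k + l)) x)) =
         (\<Sum>l<m. (c n (k + l) x - c n k x) * Q (\<theta> (int (k + l)) x)) + c n k x * complex_of_real (\<Sum>l<m. Q (\<theta> (int l) (\<theta> (int k) x)))"
        by (simp add: sum_distrib_left flow_add add.commute sum.distrib[symmetric] algebra_simps)
      also have "norm \<dots> \<le> (\<Sum>l<m. min 2 (s n * U (\<theta> (int k) x)) * \<bar>Q (\<theta> (int l) (\<theta> (int k) x))\<bar>)
           + 1 * \<bar>\<Sum>i<m. Q (\<theta> (int i) (\<theta> (int k) x))\<bar>"
      proof (rule order_trans[OF norm_triangle_ineq], rule add_mono)
        show "norm (\<Sum>l<m. (c n (k + l) x - c n k x) * Q (\<theta> (int (k + l)) x)) \<le>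
          (\<Sum>l<m. min 2 (s n * U (\<theta> (int k) x)) * \<bar>Q (\<theta> (int l) (\<theta> (int k) x))\<bar>)"
        proof (rule sum_norm_le)
          fix l assume l: "l \<in> {..<m}"
          have "norm (c n (k + l) x - c n k x) \<le> s n * (\<Sum>i<l. W (\<theta> (int k + int i) x))"
            using l le by (intro slow) (simp add: k_def)
          also have "\<dots> \<le> s n * U (\<theta> (int k) x)"
            unfolding U_def using l W0 s0 by (intro mult_left_mono sum_mono2) (auto simp: flow_add add.commute intro!: sum_mono2)
          finally have "norm (c n (k + l) x - c n k x) \<le> min 2 (s n * U (\<theta> (int k) x))"
            using norm_triangle_ineq4[of "c n (k + l) x" "c n k x"] c_le[of n "k + l" x] c_le[of n k x] by linarith
          then show "norm ((c n (k + l) x - c n k x) * Q (\<theta> (int (k + l)) x)) \<le> min 2 (s n * U (\<theta> (int k) x)) * \<bar>Q (\<theta> (int l) (\<theta> (int k) x))\<bar>"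
            by (simp add: norm_mult flow_add add.commute mult_right_mono)
        qed
        show "norm (c n k x * complex_of_real (\<Sum>l<m. Q (\<theta> (int l) (\<theta> (int k) x)))) \<le> 1 * \<bar>\<Sum>i<m. Q (\<theta> (int i) (\<theta> (int k) x))\<bar>"
          unfolding norm_mult norm_of_real by (intro mult_right_mono c_le) auto
      qed
      also have "\<dots> = min 2 (s n * U (\<theta> (int k) x)) * V (\<theta> (int k) x) + \<bar>\<Sum>i<m. Q (\<theta> (int i) (\<theta> (int k) x))\<bar>"
        by (simp add: V_def sum_distrib_left)
      finally show "norm (\<Sum>l<m. c n (k + l) x * Q (\<theta> (int (k + l)) x)) \<le> \<dots>" .
    qed
    also have "\<dots> = (\<integral>x. min 2 (s n * U x) * V x + \<bar>\<Sum>i<m. Q (\<theta> (int i) x)\<bar> \<partial>M)"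
      by (rule integral_flow) measurable
    also have "\<dots> = \<eta> n + \<delta> m"
      unfolding \<eta>_def \<delta>_def
      by (intro Bochner_Integration.integral_add \<eta>_int integrable_abs Bochner_Integration.integrable_sum integrable_flow Q)
    finally show ?thesis by (simp add: k_def)
  qed
  define K where "K = (\<integral>x. \<bar>Q x\<bar> \<partial>M)"
  have K0: "K \<ge> 0" unfolding K_def by simp
  have total: "norm (?A n / real n) \<le> \<eta> n + \<delta> m / real m + real m * K / real n"
    if n: "n > 0" for n
  proof -
    define q where "q = n div m"
    have q: "q * m \<le> n" "n - q * m \<le> m"
      using m(2) by (auto simp: q_def minus_div_mult_eq_mod less_imp_le)
    have single: "norm (\<integral>x. c n k x * Q (\<theta> (int k) x) \<partial>M) \<le> K" for k
    proof -
      have "norm (\<integral>x. c n k x * Q (\<theta> (int k) x) \<partial>M) \<le> (\<integral>x. \<bar>Q (\<theta> (int k) x)\<bar> \<partial>M)"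
        by (rule norm_integral_le_integral[OF cQ_int])
          (auto simp: norm_mult intro!: integrable_abs integrable_flow Q mult_left_le_one_le c_le)
      also have "\<dots> = K" unfolding K_def by (rule integral_flow) measurable
      finally show ?thesis .
    qed
    have "norm (?A n) \<le> (\<Sum>b<q. \<eta> n + \<delta> m) + (\<Sum>k\<in>{q * m..<n}. K)"
      unfolding sum_lessThan_blocks[OF q(1)]
    proof (rule order_trans[OF norm_triangle_ineq], rule add_mono)
      show "norm (\<Sum>b<q. \<Sum>l<m. \<integral>x. c n (b * m + l) x * Q (\<theta> (int (b * m + l)) x) \<partial>M) \<le> (\<Sum>b<q. \<eta> n + \<delta> m)"
      proof (rule sum_norm_le, rule block)
        fix b assume "b \<in> {..<q}"
        then have "Suc b * m \<le> q * m" by (intro mult_le_mono1) auto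
        then show "b * m + m \<le> n" using q(1) by simp
      qed
      show "norm (\<Sum>k\<in>{q * m..<n}. \<integral>x. c n k x * Q (\<theta> (int k) x) \<partial>M) \<le> (\<Sum>k\<in>{q * m..<n}. K)"
        by (rule sum_norm_le, rule single)
    qed
    also have "\<dots> \<le> real n * \<eta> n + real n * (\<delta> m / real m) + real m * K"
    proof -
      have "\<eta> n \<ge> 0" unfolding \<eta>_def using mn V0 by (intro integral_nonneg_AE AE_I2) auto
      have "q \<le> n" by (simp add: q_def)
      then have "real q * \<eta> n \<le> real n * \<eta> n" using \<open>\<eta> n \<ge> 0\<close> by (intro mult_right_mono) auto
      moreover have "real q * \<delta> m = real (q * m) * (\<delta> m / real m)" using m(2) by simp
      moreover have "\<dots> \<le> real n * (\<delta> m / real m)"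
        using q(1) by (intro mult_right_mono of_nat_mono divide_nonneg_nonneg) (auto simp: \<delta>_def)
      moreover have "real (n - q * m) * K \<le> real m * K" using q(2) K0 by (intro mult_right_mono) auto
      moreover have "(\<Sum>b<q. \<eta> n + \<delta> m) = real q * \<eta> n + real q * \<delta> m"
        by (simp add: distrib_left)
      moreover have "(\<Sum>k\<in>{q * m..<n}. K) = real (n - q * m) * K" by simp
      ultimately show ?thesis by linarith
    qed
    finally have "norm (?A n) / real n \<le> (real n * \<eta> n + real n * (\<delta> m / real m) + real m * K) / real n"
      using n by (intro divide_right_mono) auto
    then show ?thesis using n by (simp add: norm_divide add_divide_distrib)
  qed
  have "(\<lambda>n. real m * K / real n) \<longlonglongrightarrow> 0"
    by (rule real_tendsto_divide_at_top[OF tendsto_const filterlim_real_sequentially])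
  then have "eventually (\<lambda>n. real m * K / real n < r / 3) sequentially"
    using \<open>r > 0\<close> by (intro order_tendstoD) auto
  moreover have "eventually (\<lambda>n. \<eta> n < r / 3) sequentially"
    using \<open>\<eta> \<longlonglongrightarrow> 0\<close> \<open>r > 0\<close> by (intro order_tendstoD) auto
  ultimately have "eventually (\<lambda>n. norm (norm (?A n / real n) - 0) < r) sequentially"
    using eventually_gt_at_top[of 0]
  proof eventually_elim
    case (elim n)
    have "norm (?A n / real n) < r"
      using total[OF elim(3)] m(1) elim(1,2) by linarith
    then show ?case by (simp only: diff_0_right real_norm_def abs_norm_cancel)
  qed
  then show "\<exists>no. \<forall>n\<ge>no. norm (norm (?A n / real n) - 0) < r"
    by (simp add: eventually_sequentially)
qed


text \<open>Discrete variation of constants: the summands are the defects of \<open>E\<close> in the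
  recursion with factor \<open>a\<close>.\<close>

lemma telescope_geometric:
  fixes a :: complex and E :: "nat \<Rightarrow> complex"
  shows "E n - a ^ n * E 0 = (\<Sum>k<n. a ^ (n - Suc k) * (E (Suc k) - a * E k))"
proof (induction n)
  case (Suc n)
  have "(\<Sum>k<Suc n. a ^ (Suc n - Suc k) * (E (Suc k) - a * E k))
      = a * (\<Sum>k<n. a ^ (n - Suc k) * (E (Suc k) - a * E k)) + (E (Suc n) - a * E n)"
    by (simp add: sum_distrib_left mult.assoc[symmetric] power_Suc[symmetric] Suc_diff_Suc del: power_Suc)
  then show ?case unfolding Suc[symmetric] by (simp add: algebra_simps)
qed simp

lemma exp_minus_quadratic_error:
  fixes x :: real
  assumes "x \<ge> 0"
  shows "\<bar>1 - x - exp (- x)\<bar> \<le> x\<^sup>2"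
proof -
  have "1 + x \<le> exp x" by (rule exp_ge_add_one_self)
  then have "exp (- x) \<le> 1 / (1 + x)" using assms
    by (simp add: exp_minus field_simps)
  also have "\<dots> \<le> 1 - x + x\<^sup>2"
  proof -
    have "1 \<le> (1 - x + x\<^sup>2) * (1 + x)" using assms by (simp add: algebra_simps power2_eq_square)
    then show ?thesis using assms by (simp add: divide_le_eq)
  qed
  finally show ?thesis using exp_ge_add_one_self[of "- x"] by simp
qed

text \<open>The two bounds have different tasks. The square dominates n times the remainder at
  \<open>t / sqrt n * D\<close> by a multiple of \<open>D\<^sup>2\<close>, and the cube makes it
  tend to 0 pointwise, so second moments of \<open>D\<close> are enough.\<close>

lemma iexp_quadratic_error:
  "norm (iexp y - (1 + \<i> * of_real y - of_real (y\<^sup>2 / 2))) \<le> min (y\<^sup>2) (\<bar>y\<bar> ^ 3)"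
proof -
  have eq: "(\<Sum>k\<le>2. (\<i> * complex_of_real y) ^ k / fact k) = 1 + \<i> * of_real y - of_real (y\<^sup>2 / 2)"
    by (simp add: numeral_2_eq_2 algebra_simps complex_eq_iff)
  have "norm (iexp y - (1 + \<i> * of_real y - of_real (y\<^sup>2 / 2))) \<le> y\<^sup>2"
    using iexp_approx2[of y 2] unfolding eq by (simp add: fact_numeral)
  moreover have "norm (iexp y - (1 + \<i> * of_real y - of_real (y\<^sup>2 / 2))) \<le> \<bar>y\<bar> ^ 3"
  proof -
    have 6: "(fact (Suc 2) :: real) = 6" and 3: "Suc 2 = 3"
      by (simp_all add: eval_nat_numeral)
    have "0 \<le> \<bar>y\<bar> ^ 3" by simp
    then show ?thesis using iexp_approx1[of y 2] unfolding eq 6 unfolding 3 by linarith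
  qed
  ultimately show ?thesis by simp
qed

lemma norm_iexp_diff_le: "norm (iexp a - iexp b) \<le> \<bar>a - b\<bar>"
proof -
  have "iexp a - iexp b = iexp b * (iexp (a - b) - 1)"
    by (simp add: algebra_simps exp_add[symmetric])
  moreover have "norm (iexp (a - b) - 1) \<le> \<bar>a - b\<bar>"
    using iexp_approx1[of "a - b" 0] by simp
  ultimately show ?thesis by (simp add: norm_mult)
qed

text \<open>With \<open>e\<^sub>k = exp (i u S\<^sub>k)\<close> and \<open>a = exp (- u\<^sup>2 \<sigma>\<^sup>2 / 2)\<close>, \<open>u = t / sqrt n\<close>, the difference
  \<open>E e\<^sub>n - a\<^sup>n\<close> telescopes into \<open>\<Sum>\<^sub>k a\<^bsup>n-1-k\<^esup> E (e\<^sub>k (exp (i u D\<^sub>k) - a))\<close>. In the Taylor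
  expansion of the bracket the linear term vanishes by the martingale property and the quadratic
  one by averaging \<open>D\<^sub>k\<^sup>2 - \<sigma>\<^sup>2\<close> over blocks on which \<open>e\<^sub>k\<close> is almost constant.\<close>

theorem (in filtered_flow) martingale_clt:
  assumes D: "innovation 0 D"
  defines "\<sigma>2 \<equiv> expectation (\<lambda>x. (D x)\<^sup>2)"
  shows "(\<lambda>n. \<integral>x. iexp (t / sqrt (real n) * (\<Sum>i<n. D (\<theta> (int i) x))) \<partial>M)
           \<longlonglongrightarrow> of_real (exp (- (t\<^sup>2 * \<sigma>2 / 2)))"
proof -
  have D_F: "D \<in> borel_measurable (F 0)" and D1: "integrable M D"
    and D2: "integrable M (\<lambda>x. (D x)\<^sup>2)"
    using D by (auto simp: innovation_def intro: square_integrable_integrable square_integrableD)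
  have D_meas [measurable]: "D \<in> borel_measurable M" using D1 by simp
  have \<sigma>2_nn: "\<sigma>2 \<ge> 0" unfolding \<sigma>2_def by simp
  define S where "S k x = (\<Sum>i<k. D (\<theta> (int i) x))" for k x
  define u where "u n = t / sqrt (real n)" for n
  define a where "a n = exp (- ((u n)\<^sup>2 * \<sigma>2 / 2))" for n
  define Q where "Q x = (D x)\<^sup>2 - \<sigma>2" for x
  define R where "R y = iexp y - (1 + \<i> * of_real y - of_real (y\<^sup>2 / 2))" for y
  have R2: "norm (R y) \<le> y\<^sup>2" and R3: "norm (R y) \<le> \<bar>y\<bar> ^ 3" for y
    using iexp_quadratic_error[of y] unfolding R_def by simp_all
  define E where "E n k = (\<integral>x. iexp (u n * S k x) \<partial>M)" for n k
  have [measurable]: "S k \<in> borel_measurable M" "Q \<in> borel_measurable M" "R \<in> borel_measurable borel" for k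
    unfolding S_def Q_def R_def by measurable
  have S_F: "(\<lambda>x. S k x) \<in> borel_measurable (F (int k - 1))" for k
    unfolding S_def
  proof (rule borel_measurable_sum)
    fix i assume "i \<in> {..<k}"
    then have "int i \<le> int k - 1" by auto
    moreover have "(\<lambda>x. D (\<theta> (int i) x)) \<in> borel_measurable (F (int i))"
      by (rule measurable_flow_filtration[OF D_F]) simp
    ultimately show "(\<lambda>x. D (\<theta> (int i) x)) \<in> borel_measurable (F (int k - 1))"
      by (rule measurable_filtration_mono)
  qed
  have Q_int: "integrable M Q" unfolding Q_def using D2 by auto
  have u2: "(u n)\<^sup>2 = t\<^sup>2 / real n" for n by (simp add: u_def power_divide)
  have a01: "0 \<le> a n" "a n \<le> 1" for n using \<sigma>2_nn by (auto simp: a_def)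
  have a_pow: "a n ^ n = exp (- (t\<^sup>2 * \<sigma>2 / 2))" if "n > 0" for n
    using that by (simp add: a_def u2 exp_of_nat_mult[symmetric])
  have e_int: "integrable M (\<lambda>x. iexp (u n * S k x) * f x)" if "integrable M f" for n k and f :: "'a \<Rightarrow> complex"
    by (rule Bochner_Integration.integrable_bound[OF that]) (use that in \<open>auto simp: norm_mult\<close>)
  have iexp_int: "integrable M (\<lambda>x. iexp (f x))" if [measurable]: "f \<in> borel_measurable M" for f
    by (rule integrable_const_bound[where B=1]) auto
  have R_int: "integrable M (\<lambda>x. R (u n * D x))" for n
  proof (rule Bochner_Integration.integrable_bound)
    show "integrable M (\<lambda>x. (u n)\<^sup>2 * (D x)\<^sup>2)" using D2 by simp
    show "AE x in M. norm (R (u n * D x)) \<le> norm ((u n)\<^sup>2 * (D x)\<^sup>2)"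
    proof (rule AE_I2)
      fix x
      show "norm (R (u n * D x)) \<le> norm ((u n)\<^sup>2 * (D x)\<^sup>2)"
        using R2[of "u n * D x"] by (simp add: power_mult_distrib)
    qed
  qed measurable
  have lin0: "(\<integral>x. iexp (u n * S k x) * of_real (D (\<theta> (int k) x)) \<partial>M) = 0" for n k
  proof -
    \<comment> \<open>Innovations are orthogonal to real test functions, so the complex exponential
      is tested through its cosine and its sine.\<close>
    have orth: "(\<integral>x. f (u n * S k x) * D (\<theta> (int k) x) \<partial>M) = 0"
      if [measurable]: "f \<in> borel_measurable borel" and "\<And>y. \<bar>f y\<bar> \<le> 1" for f :: "real \<Rightarrow> real"
    proof -
      have "innovation (int k) (\<lambda>x. D (\<theta> (int k) x))" by (rule innovation_flow[OF D]) simp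
      moreover have "(\<lambda>x. f (u n * S k x)) \<in> borel_measurable (F (int k - 1))"
        using S_F[of k] by measurable
      moreover have "square_integrable M (\<lambda>x. f (u n * S k x))"
        by (rule square_integrable_bounded[where B=1]) (use that in measurable)
      ultimately show ?thesis unfolding innovation_def by blast
    qed
    have c: "(\<integral>x. cos (u n * S k x) * D (\<theta> (int k) x) \<partial>M) = 0"
      and s: "(\<integral>x. sin (u n * S k x) * D (\<theta> (int k) x) \<partial>M) = 0"
      by (rule orth; simp)+
    have i: "integrable M (\<lambda>x. iexp (u n * S k x) * of_real (D (\<theta> (int k) x)))"
      using integrable_flow[OF D1, of "int k"] by (intro e_int) auto
    show ?thesis
    proof (rule complex_eqI)
      have "Re (\<integral>x. iexp (u n * S k x) * of_real (D (\<theta> (int k) x)) \<partial>M)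
          = (\<integral>x. Re (iexp (u n * S k x) * of_real (D (\<theta> (int k) x))) \<partial>M)"
        by (rule integral_Re[OF i, symmetric])
      also have "\<dots> = (\<integral>x. cos (u n * S k x) * D (\<theta> (int k) x) \<partial>M)"
        by (simp add: Re_exp)
      finally show "Re (\<integral>x. iexp (u n * S k x) * of_real (D (\<theta> (int k) x)) \<partial>M) = Re 0"
        using c by simp
      have "Im (\<integral>x. iexp (u n * S k x) * of_real (D (\<theta> (int k) x)) \<partial>M)
          = (\<integral>x. Im (iexp (u n * S k x) * of_real (D (\<theta> (int k) x))) \<partial>M)"
        by (rule integral_Im[OF i, symmetric])
      also have "\<dots> = (\<integral>x. sin (u n * S k x) * D (\<theta> (int k) x) \<partial>M)"
        by (simp add: Im_exp)
      finally show "Im (\<integral>x. iexp (u n * S k x) * of_real (D (\<theta> (int k) x)) \<partial>M) = Im 0"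
        using s by simp
    qed
  qed
  \<comment> \<open>The square is centred at \<open>\<sigma>2\<close>: the compensating
    \<open>v\<^sup>2 * \<sigma>2 / 2\<close> goes into the coefficient of \<open>z\<close>, where it
    is compared with \<open>a n\<close>.\<close>
  have taylor: "z * w = z * (w - (1 + \<i> * of_real (v * d) - of_real ((v * d)\<^sup>2 / 2)))
      + \<i> * of_real v * (z * of_real d)
      - of_real (v\<^sup>2 / 2) * (z * of_real (d\<^sup>2 - \<sigma>2)) + of_real (1 - v\<^sup>2 * \<sigma>2 / 2) * z"
    for z w :: complex and v d
    by (simp add: algebra_simps power_mult_distrib)
  have step: "E n (Suc k) - a n * E n k
      = (\<integral>x. iexp (u n * S k x) * R (u n * D (\<theta> (int k) x)) \<partial>M)
        - of_real ((u n)\<^sup>2 / 2) * (\<integral>x. iexp (u n * S k x) * of_real (Q (\<theta> (int k) x)) \<partial>M)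
        + of_real (1 - (u n)\<^sup>2 * \<sigma>2 / 2 - a n) * E n k" for n k
  proof -
    have "E n (Suc k) = (\<integral>x. iexp (u n * S k x) * R (u n * D (\<theta> (int k) x))
      + \<i> * of_real (u n) * (iexp (u n * S k x) * of_real (D (\<theta> (int k) x)))
      - of_real ((u n)\<^sup>2 / 2) * (iexp (u n * S k x) * of_real (Q (\<theta> (int k) x)))
      + of_real (1 - (u n)\<^sup>2 * \<sigma>2 / 2) * iexp (u n * S k x) \<partial>M)"
      unfolding E_def
    proof (rule Bochner_Integration.integral_cong[OF refl])
      fix x
      have "iexp (u n * S (Suc k) x) = iexp (u n * S k x) * iexp (u n * D (\<theta> (int k) x))"
        by (simp add: S_def distrib_left exp_add)
      then show "iexp (u n * S (Suc k) x) = iexp (u n * S k x) * R (u n * D (\<theta> (int k) x))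
      + \<i> * of_real (u n) * (iexp (u n * S k x) * of_real (D (\<theta> (int k) x)))
      - of_real ((u n)\<^sup>2 / 2) * (iexp (u n * S k x) * of_real (Q (\<theta> (int k) x)))
      + of_real (1 - (u n)\<^sup>2 * \<sigma>2 / 2) * iexp (u n * S k x)"
        unfolding R_def Q_def by (simp only: taylor[symmetric])
    qed
    also have "\<dots> = (\<integral>x. iexp (u n * S k x) * R (u n * D (\<theta> (int k) x)) \<partial>M)
        + \<i> * of_real (u n) * (\<integral>x. iexp (u n * S k x) * of_real (D (\<theta> (int k) x)) \<partial>M)
        - of_real ((u n)\<^sup>2 / 2) * (\<integral>x. iexp (u n * S k x) * of_real (Q (\<theta> (int k) x)) \<partial>M)
        + of_real (1 - (u n)\<^sup>2 * \<sigma>2 / 2) * E n k"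
    proof -
      have i1: "integrable M (\<lambda>x. iexp (u n * S k x) * R (u n * D (\<theta> (int k) x)))"
        by (rule e_int, rule integrable_flow[OF R_int])
      have i2: "integrable M (\<lambda>x. iexp (u n * S k x) * of_real (D (\<theta> (int k) x)))"
        using integrable_flow[OF D1, of "int k"] by (intro e_int) auto
      have i3: "integrable M (\<lambda>x. iexp (u n * S k x) * of_real (Q (\<theta> (int k) x)))"
        using integrable_flow[OF Q_int, of "int k"] by (intro e_int) auto
      have i4: "integrable M (\<lambda>x. iexp (u n * S k x))" by (rule iexp_int) measurable
      show ?thesis unfolding E_def
        by (simp only: Bochner_Integration.integral_add Bochner_Integration.integral_diff
            Bochner_Integration.integrable_add Bochner_Integration.integrable_diff
            integrable_mult_right integral_mult_right_zero i1 i2 i3 i4)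
    qed
    finally have "E n (Suc k) = (\<integral>x. iexp (u n * S k x) * R (u n * D (\<theta> (int k) x)) \<partial>M)
        - of_real ((u n)\<^sup>2 / 2) * (\<integral>x. iexp (u n * S k x) * of_real (Q (\<theta> (int k) x)) \<partial>M)
        + of_real (1 - (u n)\<^sup>2 * \<sigma>2 / 2) * E n k"
      unfolding lin0 by (simp only: mult_zero_right add_0_right)
    moreover have "of_real (1 - (u n)\<^sup>2 * \<sigma>2 / 2 - a n) * E n k
        = of_real (1 - (u n)\<^sup>2 * \<sigma>2 / 2) * E n k - of_real (a n) * E n k"
      by (simp only: of_real_diff left_diff_distrib)
    ultimately show ?thesis by (simp only: add_diff_eq)
  qed
  \<comment> \<open>The power of \<open>a n\<close> from the telescoping sum is part of the weight.
    It varies slowly as well, since \<open>1 - a n ^ l\<close> is at most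
    \<open>l * ((u n)\<^sup>2 * \<sigma>2 / 2)\<close>.\<close>
  define c where "c n k x = of_real (a n ^ (n - Suc k)) * iexp (u n * S k x)" for n k x
  let ?A = "\<lambda>n. \<Sum>k<n. \<integral>x. c n k x * Q (\<theta> (int k) x) \<partial>M"
  have block: "(\<lambda>n. ?A n / real n) \<longlonglongrightarrow> 0"
  \<comment> \<open>In \<open>W\<close> the term \<open>\<bar>D x\<bar>\<close> accounts for the
    change of the exponential, and the added 1 counts steps for the change of the powers of
    \<open>a n\<close>.\<close>
  proof (rule block_average_tendsto_0[where W="\<lambda>x. \<bar>D x\<bar> + 1" and s="\<lambda>n. \<bar>u n\<bar> + (u n)\<^sup>2 * \<sigma>2 / 2"])
    show "integrable M Q" by fact
    have "(\<lambda>m. \<integral>x. \<bar>(\<Sum>i<m. (D (\<theta> (int i) x))\<^sup>2) / real m - \<sigma>2\<bar> \<partial>M) \<longlonglongrightarrow> 0"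
      unfolding \<sigma>2_def by (rule birkhoff_L1_nonneg[OF D2]) simp
    moreover have "eventually (\<lambda>m. (\<integral>x. \<bar>(\<Sum>i<m. (D (\<theta> (int i) x))\<^sup>2) / real m - \<sigma>2\<bar> \<partial>M)
       = (\<integral>x. \<bar>(\<Sum>i<m. Q (\<theta> (int i) x)) / real m\<bar> \<partial>M)) sequentially"
      using eventually_gt_at_top[of 0]
      by eventually_elim (simp add: Q_def sum_subtractf diff_divide_distrib)
    ultimately show "(\<lambda>m. \<integral>x. \<bar>(\<Sum>i<m. Q (\<theta> (int i) x)) / real m\<bar> \<partial>M) \<longlonglongrightarrow> 0"
      using tendsto_cong by force
    show "c n k \<in> borel_measurable M" for n k unfolding c_def by measurable
    show "norm (c n k x) \<le> 1" for n k x
      using a01[of n] by (simp add: c_def norm_mult power_le_one del: of_real_power)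
    have u0: "u \<longlonglongrightarrow> 0"
      unfolding u_def
      by (rule real_tendsto_divide_at_top[OF tendsto_const])
        (rule filterlim_compose[OF sqrt_at_top filterlim_real_sequentially])
    have "(\<lambda>n. \<bar>u n\<bar> + (u n)\<^sup>2 * \<sigma>2 / 2) \<longlonglongrightarrow> \<bar>0\<bar> + 0\<^sup>2 * \<sigma>2 / 2"
      by (intro tendsto_intros u0) simp
    then show "(\<lambda>n. \<bar>u n\<bar> + (u n)\<^sup>2 * \<sigma>2 / 2) \<longlonglongrightarrow> 0" by simp
    show "0 \<le> \<bar>u n\<bar> + (u n)\<^sup>2 * \<sigma>2 / 2" for n using \<sigma>2_nn by simp
    fix n k l :: nat and x assume kl: "k + l < n"
    define W where "W = (\<Sum>i<l. \<bar>D (\<theta> (int k + int i) x)\<bar>)"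
    have W0: "W \<ge> 0" unfolding W_def by (simp add: sum_nonneg)
    have S_add: "S (k + l) x - S k x = (\<Sum>i<l. D (\<theta> (int k + int i) x))"
      unfolding S_def by (induction l) (auto simp: algebra_simps)
    have "1 - a n ^ l \<le> real l * ((u n)\<^sup>2 * \<sigma>2 / 2)"
      using exp_ge_add_one_self[of "- (real l * ((u n)\<^sup>2 * \<sigma>2 / 2))"]
      by (simp add: a_def exp_of_nat_mult[symmetric])
    moreover have "a n ^ l \<le> 1" using a01[of n] by (simp add: power_le_one)
    ultimately have al: "\<bar>1 - a n ^ l\<bar> \<le> real l * ((u n)\<^sup>2 * \<sigma>2 / 2)" by simp
    have pw: "a n ^ (n - Suc k) = a n ^ (n - Suc (k + l)) * a n ^ l"
      using kl by (simp add: power_add[symmetric])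
    have "c n (k + l) x - c n k x = of_real (a n ^ (n - Suc (k + l))) *
       ((iexp (u n * S (k + l) x) - iexp (u n * S k x)) + of_real (1 - a n ^ l) * iexp (u n * S k x))"
      unfolding c_def pw by (simp add: algebra_simps)
    also have "norm \<dots> \<le> 1 * (\<bar>u n * S (k + l) x - u n * S k x\<bar> + \<bar>1 - a n ^ l\<bar>)"
      unfolding norm_mult
    proof (rule mult_mono)
      show "norm (complex_of_real (a n ^ (n - Suc (k + l)))) \<le> 1"
        using a01[of n] by (simp add: power_le_one del: of_real_power)
      show "norm ((iexp (u n * S (k + l) x) - iexp (u n * S k x)) + of_real (1 - a n ^ l) * iexp (u n * S k x))
        \<le> \<bar>u n * S (k + l) x - u n * S k x\<bar> + \<bar>1 - a n ^ l\<bar>"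
        by (rule order_trans[OF norm_triangle_ineq], rule add_mono, rule norm_iexp_diff_le)
          (simp add: norm_mult del: of_real_diff)
    qed auto
    also have "\<bar>u n * S (k + l) x - u n * S k x\<bar> = \<bar>u n\<bar> * \<bar>\<Sum>i<l. D (\<theta> (int k + int i) x)\<bar>"
      unfolding S_add[symmetric] by (simp add: abs_mult[symmetric] right_diff_distrib)
    also have "1 * (\<bar>u n\<bar> * \<bar>\<Sum>i<l. D (\<theta> (int k + int i) x)\<bar> + \<bar>1 - a n ^ l\<bar>)
      \<le> \<bar>u n\<bar> * W + real l * ((u n)\<^sup>2 * \<sigma>2 / 2)"
      unfolding W_def mult_1 by (intro add_mono mult_left_mono sum_abs al) auto
    also have "\<dots> \<le> (\<bar>u n\<bar> + (u n)\<^sup>2 * \<sigma>2 / 2) * (W + real l)"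
    proof -
      have "\<bar>u n\<bar> * W + real l * b \<le> (\<bar>u n\<bar> + b) * (W + real l)" if "b \<ge> 0" for b
        using W0 mult_nonneg_nonneg[OF that W0] by (simp add: algebra_simps)
      from this[of "(u n)\<^sup>2 * \<sigma>2 / 2"] show ?thesis using \<sigma>2_nn by simp
    qed
    also have "W + real l = (\<Sum>i<l. \<bar>D (\<theta> (int k + int i) x)\<bar> + 1)"
      by (simp add: W_def sum.distrib)
    finally show "norm (c n (k + l) x - c n k x) \<le> (\<bar>u n\<bar> + (u n)\<^sup>2 * \<sigma>2 / 2) * (\<Sum>i<l. \<bar>D (\<theta> (int k + int i) x)\<bar> + 1)" .
  qed auto
  define \<rho> where "\<rho> n = (\<integral>x. real n * norm (R (u n * D x)) \<partial>M)" for n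
  have "\<rho> \<longlonglongrightarrow> (\<integral>x. 0 \<partial>M)" unfolding \<rho>_def
  proof (rule integral_dominated_convergence[where w="\<lambda>x. t\<^sup>2 * (D x)\<^sup>2"])
    show "AE x in M. (\<lambda>n. real n * norm (R (u n * D x))) \<longlonglongrightarrow> 0"
    proof (rule AE_I2, rule tendsto_sandwich[OF _ _ tendsto_const])
      fix x
      show "eventually (\<lambda>n. 0 \<le> real n * norm (R (u n * D x))) sequentially" by simp
      show "eventually (\<lambda>n. real n * norm (R (u n * D x)) \<le> \<bar>t * D x\<bar> ^ 3 / sqrt (real n)) sequentially"
        using eventually_gt_at_top[of 0]
      proof eventually_elim
        case (elim n)
        have "real n * norm (R (u n * D x)) \<le> real n * \<bar>u n * D x\<bar> ^ 3"
          using R3[of "u n * D x"] by (intro mult_left_mono) auto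
        also have "\<dots> = \<bar>t * D x\<bar> ^ 3 * (real n / sqrt (real n) ^ 3)"
          by (simp add: u_def abs_mult power_mult_distrib power_divide)
        also have "real n / sqrt (real n) ^ 3 = 1 / sqrt (real n)"
          using elim by (simp add: power3_eq_cube)
        finally show ?case by simp
      qed
      show "(\<lambda>n. \<bar>t * D x\<bar> ^ 3 / sqrt (real n)) \<longlonglongrightarrow> 0"
        by (rule real_tendsto_divide_at_top[OF tendsto_const])
          (rule filterlim_compose[OF sqrt_at_top filterlim_real_sequentially])
    qed
    show "AE x in M. norm (real n * norm (R (u n * D x))) \<le> t\<^sup>2 * (D x)\<^sup>2" for n
    proof (rule AE_I2)
      fix x
      have "real n * norm (R (u n * D x)) \<le> real n * (u n * D x)\<^sup>2"
        using R2[of "u n * D x"] by (intro mult_left_mono) auto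
      also have "\<dots> \<le> t\<^sup>2 * (D x)\<^sup>2" by (simp add: power_mult_distrib u2)
      finally show "norm (real n * norm (R (u n * D x))) \<le> t\<^sup>2 * (D x)\<^sup>2" by simp
    qed
  qed (use D2 in auto)
  then have \<rho>0: "\<rho> \<longlonglongrightarrow> 0" by simp
  \<comment> \<open>The last term collects n gaps between
    \<open>1 - (u n)\<^sup>2 * \<sigma>2 / 2\<close> and \<open>a n\<close>, each at most
    \<open>(t\<^sup>2 * \<sigma>2 / 2 / n)\<^sup>2\<close>.\<close>
  have main: "norm (E n n - of_real (exp (- (t\<^sup>2 * \<sigma>2 / 2)))) \<le> \<rho> n
     + t\<^sup>2 / 2 * norm (?A n / real n)
     + (t\<^sup>2 * \<sigma>2 / 2)\<^sup>2 / real n" if n: "n > 0" for n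
  proof -
    have E_le: "norm (E n k) \<le> 1" for k
    proof -
      have "norm (E n k) \<le> (\<integral>x. 1 \<partial>M)" unfolding E_def
        by (rule norm_integral_le_integral[OF iexp_int]) auto
      then show ?thesis by (simp add: prob_space)
    qed
    have E0: "E n 0 = 1" by (simp add: E_def S_def prob_space)
    define A where "A k = a n ^ (n - Suc k)" for k
    have A01: "0 \<le> A k" "A k \<le> 1" for k using a01[of n] by (auto simp: A_def power_le_one)
    define x1 where "x1 k = (\<integral>x. iexp (u n * S k x) * R (u n * D (\<theta> (int k) x)) \<partial>M)" for k
    define x3 where "x3 = 1 - (u n)\<^sup>2 * \<sigma>2 / 2 - a n"
    have x1: "norm (x1 k) \<le> \<rho> n / real n" for k
    proof -
      have "norm (x1 k) \<le> (\<integral>x. norm (R (u n * D (\<theta> (int k) x))) \<partial>M)" unfolding x1_def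
        by (rule norm_integral_le_integral[OF e_int[OF integrable_flow[OF R_int]] integrable_norm[OF integrable_flow[OF R_int]]])
          (simp add: norm_mult)
      also have "\<dots> = (\<integral>x. norm (R (u n * D x)) \<partial>M)" by (rule integral_flow) measurable
      finally show ?thesis using n by (simp add: \<rho>_def)
    qed
    have x3: "\<bar>x3\<bar> \<le> ((t\<^sup>2 * \<sigma>2 / 2) / real n)\<^sup>2"
      using exp_minus_quadratic_error[of "(u n)\<^sup>2 * \<sigma>2 / 2"] \<sigma>2_nn unfolding x3_def a_def by (simp add: u2 mult.commute)
    have "E n n - of_real (exp (- (t\<^sup>2 * \<sigma>2 / 2))) = E n n - of_real (a n) ^ n * E n 0"
      by (simp add: E0 a_pow[OF n, symmetric])
    also have "\<dots> = (\<Sum>k<n. of_real (A k) * (E n (Suc k) - a n * E n k))"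
      unfolding telescope_geometric A_def by simp
    also have "\<dots> = (\<Sum>k<n. of_real (A k) * x1 k)
        - of_real ((u n)\<^sup>2 / 2) * ?A n
        + (\<Sum>k<n. of_real (A k * x3) * E n k)"
    proof -
      have "(\<integral>x. c n k x * Q (\<theta> (int k) x) \<partial>M) = of_real (A k) * (\<integral>x. iexp (u n * S k x) * of_real (Q (\<theta> (int k) x)) \<partial>M)" for k
        unfolding c_def A_def by (simp add: mult.assoc del: of_real_power)
      then show ?thesis unfolding step x1_def[symmetric] x3_def[symmetric]
        by (simp add: algebra_simps sum.distrib sum_subtractf sum_distrib_left)
    qed
    also have "norm \<dots> \<le> (\<Sum>k<n. \<rho> n / real n)
        + norm (of_real ((u n)\<^sup>2 / 2) * ?A n)
        + (\<Sum>k<n. ((t\<^sup>2 * \<sigma>2 / 2) / real n)\<^sup>2)"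
    proof (rule order_trans[OF norm_triangle_ineq], rule add_mono, rule order_trans[OF norm_triangle_ineq4], rule add_mono)
      show "norm (\<Sum>k<n. of_real (A k) * x1 k) \<le> (\<Sum>k<n. \<rho> n / real n)"
      proof (rule sum_norm_le)
        fix k
        have "norm (of_real (A k) * x1 k) \<le> 1 * (\<rho> n / real n)"
          unfolding norm_mult using A01[of k] x1[of k] by (intro mult_mono) auto
        then show "norm (of_real (A k) * x1 k) \<le> \<rho> n / real n" by simp
      qed
      show "norm (\<Sum>k<n. of_real (A k * x3) * E n k) \<le> (\<Sum>k<n. ((t\<^sup>2 * \<sigma>2 / 2) / real n)\<^sup>2)"
      proof (rule sum_norm_le)
        fix k
        have "norm (of_real (A k * x3) * E n k) = A k * (\<bar>x3\<bar> * norm (E n k))"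
          using A01[of k] by (simp add: norm_mult abs_mult)
        also have "\<dots> \<le> 1 * (((t\<^sup>2 * \<sigma>2 / 2) / real n)\<^sup>2 * 1)"
          using A01[of k] x3 E_le[of k] by (intro mult_mono) auto
        finally show "norm (of_real (A k * x3) * E n k) \<le> ((t\<^sup>2 * \<sigma>2 / 2) / real n)\<^sup>2" by simp
      qed
    qed simp
    also have "\<dots> = \<rho> n
     + t\<^sup>2 / 2 * norm (?A n / real n)
     + (t\<^sup>2 * \<sigma>2 / 2)\<^sup>2 / real n"
    proof -
      have "norm (of_real ((u n)\<^sup>2 / 2) * z) = t\<^sup>2 / 2 * norm (z / real n)" for z :: complex
        unfolding norm_mult norm_of_real u2 by (simp add: norm_divide)
      moreover have "(\<Sum>k<n. (y / real n)\<^sup>2) = y\<^sup>2 / real n" for y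
        using n by (simp add: power_divide power2_eq_square[of "real n"])
      moreover have "(\<Sum>k<n. \<rho> n / real n) = \<rho> n" using n by simp
      ultimately show ?thesis by (simp only:)
    qed
    finally show ?thesis .
  qed
  have "(\<lambda>n. \<rho> n + t\<^sup>2 / 2 * norm (?A n / real n)
     + (t\<^sup>2 * \<sigma>2 / 2)\<^sup>2 / real n) \<longlonglongrightarrow> 0 + t\<^sup>2 / 2 * norm (0 :: complex) + 0"
    by (intro tendsto_intros \<rho>0 block real_tendsto_divide_at_top[OF tendsto_const filterlim_real_sequentially])
  then have lim: "(\<lambda>n. \<rho> n + t\<^sup>2 / 2 * norm (?A n / real n)
     + (t\<^sup>2 * \<sigma>2 / 2)\<^sup>2 / real n) \<longlonglongrightarrow> 0"
    by (simp only: norm_zero mult_zero_right add_0_right)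
  have "eventually (\<lambda>n. norm (E n n - of_real (exp (- (t\<^sup>2 * \<sigma>2 / 2)))) \<le> \<rho> n
     + t\<^sup>2 / 2 * norm (?A n / real n)
     + (t\<^sup>2 * \<sigma>2 / 2)\<^sup>2 / real n) sequentially"
    using eventually_gt_at_top[of 0] by eventually_elim (rule main)
  then have "(\<lambda>n. E n n - of_real (exp (- (t\<^sup>2 * \<sigma>2 / 2)))) \<longlonglongrightarrow> 0"
    by (rule Lim_null_comparison[OF _ lim])
  then have "(\<lambda>n. E n n) \<longlonglongrightarrow> of_real (exp (- (t\<^sup>2 * \<sigma>2 / 2)))"
    by (rule LIM_zero_cancel)
  then show ?thesis
    unfolding E_def u_def S_def .
qed

section \<open>Martingale approximation\<close>

context filtered_flow
begin

sublocale cond: finite_measure_subalgebra M "F i" for i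
  by unfold_locales (rule subalg)

lemma cond_exp_measurable: "real_cond_exp M (F i) h \<in> borel_measurable (F i)"
  by (rule borel_measurable_cond_exp)

text \<open>A function of the past at time i-1 is also measurable at time i, and against it both
  conditional expectations have the same integral as \<open>h\<close> itself.\<close>

lemma innovation_cond_exp_diff:
  assumes h: "square_integrable M h"
    and sq: "square_integrable M (real_cond_exp M (F i) h)"
      "square_integrable M (real_cond_exp M (F (i - 1)) h)"
  shows "innovation i (\<lambda>x. real_cond_exp M (F i) h x - real_cond_exp M (F (i - 1)) h x)"
  unfolding innovation_def
proof (intro conjI ballI impI)
  have "real_cond_exp M (F (i - 1)) h \<in> borel_measurable (F i)"
    by (rule measurable_filtration_mono[OF _ cond_exp_measurable]) simp
  then show "(\<lambda>x. real_cond_exp M (F i) h x - real_cond_exp M (F (i - 1)) h x) \<in> borel_measurable (F i)"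
    using cond_exp_measurable[of i h] by measurable
  show "square_integrable M (\<lambda>x. real_cond_exp M (F i) h x - real_cond_exp M (F (i - 1)) h x)"
    using sq by (rule square_integrable_diff)
  fix \<phi> assume \<phi>: "\<phi> \<in> borel_measurable (F (i - 1))" "square_integrable M \<phi>"
  have \<phi>': "\<phi> \<in> borel_measurable (F i)"
    using \<phi>(1) by (rule measurable_filtration_mono[rotated]) simp
  have hm: "h \<in> borel_measurable M" and \<phi>h: "integrable M (\<lambda>x. \<phi> x * h x)"
    using h \<phi>(2) square_integrableD square_integrable_mult_integrable by blast+
  have "(\<integral>x. \<phi> x * (real_cond_exp M (F i) h x - real_cond_exp M (F (i - 1)) h x) \<partial>M)
    = (\<integral>x. \<phi> x * real_cond_exp M (F i) h x - \<phi> x * real_cond_exp M (F (i - 1)) h x \<partial>M)"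
    by (simp add: right_diff_distrib)
  also have "\<dots> = (\<integral>x. \<phi> x * real_cond_exp M (F i) h x \<partial>M) - (\<integral>x. \<phi> x * real_cond_exp M (F (i - 1)) h x \<partial>M)"
    by (intro Bochner_Integration.integral_diff cond.real_cond_exp_intg(1)[OF \<phi>h \<phi>' hm]
        cond.real_cond_exp_intg(1)[OF \<phi>h \<phi>(1) hm])
  also have "\<dots> = 0"
    using cond.real_cond_exp_intg(2)[OF \<phi>h \<phi>' hm] cond.real_cond_exp_intg(2)[OF \<phi>h \<phi>(1) hm] by simp
  finally show "(\<integral>x. \<phi> x * (real_cond_exp M (F i) h x - real_cond_exp M (F (i - 1)) h x) \<partial>M) = 0" .
qed

text \<open>The map \<open>iexp\<close> is 1-Lipschitz and the \<open>L\<^sub>1\<close> norm is at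
  most the \<open>L\<^sub>2\<close> norm on a probability space. An approximation in
  \<open>L\<^sub>2\<close> therefore controls characteristic functions.\<close>

lemma norm_expectation_iexp_diff_le:
  assumes f: "square_integrable M f" and g: "square_integrable M g"
  shows "norm ((\<integral>x. iexp (u * f x) \<partial>M) - (\<integral>x. iexp (u * g x) \<partial>M)) \<le> \<bar>u\<bar> * L2norm M (\<lambda>x. f x - g x)"
proof -
  note [measurable] = square_integrableD(1)[OF f] square_integrableD(1)[OF g]
  have fg: "square_integrable M (\<lambda>x. u * (f x - g x))"
    using f g by (intro square_integrable_cmult square_integrable_diff)
  have i: "integrable M (\<lambda>x. iexp (u * f x))" "integrable M (\<lambda>x. iexp (u * g x))"
    by (rule integrable_const_bound[where B=1]; simp)+
  have "(\<integral>x. iexp (u * f x) \<partial>M) - (\<integral>x. iexp (u * g x) \<partial>M) = (\<integral>x. iexp (u * f x) - iexp (u * g x) \<partial>M)"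
    by (rule Bochner_Integration.integral_diff[symmetric]) (rule i)+
  also have "norm \<dots> \<le> (\<integral>x. \<bar>u * (f x - g x)\<bar> \<partial>M)"
  proof (rule norm_integral_le_integral)
    show "integrable M (\<lambda>x. iexp (u * f x) - iexp (u * g x))" using i by (rule Bochner_Integration.integrable_diff)
    show "integrable M (\<lambda>x. \<bar>u * (f x - g x)\<bar>)" using square_integrable_integrable[OF fg] by (rule integrable_abs)
    show "norm (iexp (u * f x) - iexp (u * g x)) \<le> \<bar>u * (f x - g x)\<bar>" for x
      using norm_iexp_diff_le[of "u * f x" "u * g x"] by (simp only: right_diff_distrib)
  qed
  also have "\<dots> \<le> L2norm M (\<lambda>x. u * (f x - g x))" by (rule expectation_abs_le_L2norm[OF fg])
  also have "\<dots> = \<bar>u\<bar> * L2norm M (\<lambda>x. f x - g x)" by (rule L2norm_cmult)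
  finally show ?thesis .
qed

text \<open>Gordin's martingale approximation: up to an error of \<open>L\<^sub>2\<close> norm
  \<open>sqrt n \<Sum>\<^bsub>j\<ge>J\<^esub> \<rho>\<^sub>j + O(1)\<close>, the partial sums of \<open>h\<close> are those of the martingale difference
  \<open>\<Sum>\<^bsub>j<J\<^esub> r\<^sub>j \<circ> \<theta>\<^sub>j\<close>.\<close>

theorem gordin_clt:
  fixes h :: "'a \<Rightarrow> real"
  defines "p \<equiv> \<lambda>j::nat. real_cond_exp M (F (- int j)) h"
  defines "r \<equiv> \<lambda>j x. p j x - p (Suc j) x"
  assumes h_F: "h \<in> borel_measurable (F 0)" and h: "square_integrable M h"
    and p_sq: "\<And>j. integrable M (\<lambda>x. (p j x)\<^sup>2)"
    and p_0: "(\<lambda>j. \<integral>x. (p j x)\<^sup>2 \<partial>M) \<longlonglongrightarrow> 0"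
    and r_summable: "summable (\<lambda>j. L2norm M (r j))"
    and var: "(\<lambda>n. (\<integral>x. (\<Sum>i<n. h (\<theta> (int i) x))\<^sup>2 \<partial>M) / real n) \<longlonglongrightarrow> s"
  shows "(\<lambda>n. \<integral>x. iexp (t / sqrt (real n) * (\<Sum>i<n. h (\<theta> (int i) x))) \<partial>M)
           \<longlonglongrightarrow> of_real (exp (- (t\<^sup>2 * s / 2)))"
proof -
  define S where "S n x = (\<Sum>i<n. h (\<theta> (int i) x))" for n x
  define \<rho> where "\<rho> j = L2norm M (r j)" for j
  have p_meas [measurable]: "p j \<in> borel_measurable M" for j unfolding p_def by simp
  have hm [measurable]: "h \<in> borel_measurable M" using square_integrableD(1)[OF h] .
  have p_sq': "square_integrable M (p j)" for j
    using p_sq by (simp add: square_integrable_def)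
  have r_inn: "innovation (- int j) (r j)" for j
  proof -
    have Suc: "- int (Suc j) = - int j - 1" by simp
    show ?thesis
      using innovation_cond_exp_diff[OF h, of "- int j"] p_sq'[of j] p_sq'[of "Suc j"]
      unfolding r_def p_def Suc by blast
  qed
  have r_sq: "square_integrable M (r j)" for j
    using r_inn by (simp add: innovation_def)
  have r_meas [measurable]: "r j \<in> borel_measurable M" for j
    using square_integrableD(1)[OF r_sq] .
  have S_sq: "square_integrable M (S n)" for n
    unfolding S_def using h by (intro square_integrable_sum square_integrable_flow)
  have rS_sq: "square_integrable M (\<lambda>x. \<Sum>i<n. r j (\<theta> (int i + k) x))" for n j k
    using r_sq by (intro square_integrable_sum square_integrable_flow)
  have rS_sq0: "square_integrable M (\<lambda>x. \<Sum>i<n. r j (\<theta> (int i) x))" for n j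
    using r_sq by (intro square_integrable_sum square_integrable_flow)
  have p0_h: "AE x in M. p 0 x = h x"
    unfolding p_def using h_F square_integrable_integrable[OF h] by (intro cond.real_cond_exp_F_meas) simp_all
  define T where "T J = (\<Sum>j. \<rho> (j + J))" for J
  have \<rho>_nn: "\<rho> j \<ge> 0" for j by (simp add: \<rho>_def)
  have \<rho>_sum: "summable \<rho>" using r_summable unfolding \<rho>_def .
  have T0: "T \<longlonglongrightarrow> 0"
  proof -
    have "T = (\<lambda>J. (\<Sum>j. \<rho> j) - (\<Sum>j<J. \<rho> j))"
      unfolding T_def using suminf_minus_initial_segment[OF \<rho>_sum] by blast
    moreover have "(\<lambda>J. (\<Sum>j. \<rho> j) - (\<Sum>j<J. \<rho> j)) \<longlonglongrightarrow> (\<Sum>j. \<rho> j) - (\<Sum>j. \<rho> j)"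
      by (intro tendsto_intros summable_LIMSEQ \<rho>_sum)
    ultimately show ?thesis by simp
  qed
  have partial: "(\<Sum>j\<in>{J..<K}. \<rho> j) \<le> T J" for J K
  proof -
    have "(\<Sum>j\<in>{J..<K}. \<rho> j) = (\<Sum>j<K - J. \<rho> (j + J))"
      using sum.shift_bounds_nat_ivl[of \<rho> 0 J "K - J"]
      by (cases "J \<le> K") (auto simp: atLeast0LessThan)
    also have "\<dots> \<le> T J"
      unfolding T_def using \<rho>_sum \<rho>_nn by (intro sum_le_suminf) (auto simp: summable_iff_shift)
    finally show ?thesis .
  qed
  \<comment> \<open>\<open>p J\<close> consists of the revisions with J \<le> j < K and the rest
    \<open>p K\<close>. Each revision is an innovation, so its sum has norm exactly
    \<open>sqrt n * \<rho> j\<close>; for the rest there is only the crude factor n, which is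
    harmless because K is chosen after n.\<close>
  have tail: "L2norm M (\<lambda>x. \<Sum>i<n. p J (\<theta> (int i) x)) \<le> sqrt (real n) * T J" for n J
  proof (rule field_le_epsilon)
    fix e :: real assume "e > 0"
    have pS_sq: "square_integrable M (\<lambda>x. \<Sum>i<n. p K (\<theta> (int i) x))" for K
      using p_sq' by (intro square_integrable_sum square_integrable_flow)
    have "(\<lambda>K. real n * L2norm M (p K)) \<longlonglongrightarrow> real n * sqrt 0"
      unfolding L2norm_def using p_0 by (intro tendsto_intros)
    then have "eventually (\<lambda>K. real n * L2norm M (p K) < e) sequentially"
      using \<open>e > 0\<close> by (intro order_tendstoD(2)[where y="real n * sqrt 0"]) simp_all
    then obtain K where K: "K \<ge> J" "real n * L2norm M (p K) < e"
      using eventually_happens[OF eventually_conj[OF _ eventually_ge_at_top[of J]]] by (auto)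
    have tel: "p J y = (\<Sum>j\<in>{J..<K}. r j y) + p K y" for y
      using K(1) sum_Suc_diff'[of J K "\<lambda>j. p j y"] by (simp add: r_def sum_subtractf)
    have "L2norm M (\<lambda>x. \<Sum>i<n. p J (\<theta> (int i) x))
       = L2norm M (\<lambda>x. (\<Sum>j\<in>{J..<K}. \<Sum>i<n. r j (\<theta> (int i) x)) + (\<Sum>i<n. p K (\<theta> (int i) x)))"
      unfolding tel sum.distrib by (subst sum.swap) simp
    also have "\<dots> \<le> (\<Sum>j\<in>{J..<K}. L2norm M (\<lambda>x. \<Sum>i<n. r j (\<theta> (int i) x))) + (\<Sum>i<n. L2norm M (\<lambda>x. p K (\<theta> (int i) x)))"
      by (rule order_trans[OF L2norm_triangle add_mono[OF L2norm_sum_le L2norm_sum_le]])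
        (intro square_integrable_sum rS_sq0 pS_sq square_integrable_flow p_sq')+
    also have "\<dots> = sqrt (real n) * (\<Sum>j\<in>{J..<K}. \<rho> j) + real n * L2norm M (p K)"
      by (simp add: L2norm_sum_innovation[OF r_inn] L2norm_flow \<rho>_def sum_distrib_left)
    also have "\<dots> \<le> sqrt (real n) * T J + e"
      using K(2) partial[of J K] by (intro add_mono mult_left_mono) auto
    finally show "L2norm M (\<lambda>x. \<Sum>i<n. p J (\<theta> (int i) x)) \<le> sqrt (real n) * T J + e" .
  qed
  define D where "D J x = (\<Sum>j<J. r j (\<theta> (int j) x))" for J x
  have D_inn: "innovation 0 (D J)" for J
    unfolding D_def by (intro innovation_sum innovation_flow[OF r_inn]) simp
  have D_sq: "square_integrable M (D J)" for J using D_inn by (simp add: innovation_def)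
  define MS where "MS J n x = (\<Sum>i<n. D J (\<theta> (int i) x))" for J n x
  have MS_sq: "square_integrable M (MS J n)" for J n
    unfolding MS_def using D_sq by (intro square_integrable_sum square_integrable_flow)
  define C where "C J = (\<Sum>j<J. 2 * real j * \<rho> j)" for J
  \<comment> \<open>Since \<open>h\<close> is measurable at time 0, it equals \<open>p 0\<close> and
    splits into the revisions with j < J and \<open>p J\<close>. Moving the j-th revision to time 0
    costs only the boundary terms collected in \<open>C J\<close>, which does not depend on
    n.\<close>
  have approx: "L2norm M (\<lambda>x. S n x - MS J n x) \<le> sqrt (real n) * T J + C J" for n J
  proof -
    have "AE x in M. \<forall>i\<in>{..<n}. h (\<theta> (int i) x) = (\<Sum>j<J. r j (\<theta> (int i) x)) + p J (\<theta> (int i) x)"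
    proof (rule AE_finite_allI)
      fix i
      show "AE x in M. h (\<theta> (int i) x) = (\<Sum>j<J. r j (\<theta> (int i) x)) + p J (\<theta> (int i) x)"
        using AE_flow[OF p0_h, of "int i"]
      proof eventually_elim
        case (elim x)
        show ?case using sum_lessThan_telescope'[of "\<lambda>j. p j (\<theta> (int i) x)" J] elim by (simp add: r_def)
      qed
    qed simp
    then have "AE x in M. S n x - MS J n x = (\<Sum>i<n. p J (\<theta> (int i) x))
       + (\<Sum>j<J. (\<Sum>i<n. r j (\<theta> (int i) x)) - (\<Sum>i<n. r j (\<theta> (int i + int j) x)))"
    proof eventually_elim
      case (elim x)
      have "S n x = (\<Sum>i<n. \<Sum>j<J. r j (\<theta> (int i) x)) + (\<Sum>i<n. p J (\<theta> (int i) x))"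
        unfolding S_def sum.distrib[symmetric] using elim by (intro sum.cong) auto
      moreover have "MS J n x = (\<Sum>j<J. \<Sum>i<n. r j (\<theta> (int i + int j) x))"
        unfolding MS_def D_def flow_add by (subst sum.swap) (simp add: add.commute)
      moreover have "(\<Sum>i<n. \<Sum>j<J. r j (\<theta> (int i) x)) = (\<Sum>j<J. \<Sum>i<n. r j (\<theta> (int i) x))"
        by (rule sum.swap)
      ultimately show ?case by (simp add: sum_subtractf)
    qed
    then have "L2norm M (\<lambda>x. S n x - MS J n x) = L2norm M (\<lambda>x. (\<Sum>i<n. p J (\<theta> (int i) x))
       + (\<Sum>j<J. (\<Sum>i<n. r j (\<theta> (int i) x)) - (\<Sum>i<n. r j (\<theta> (int i + int j) x))))"
      by (rule L2norm_cong_AE[rotated 2])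
        (intro square_integrableD(1) square_integrable_add square_integrable_sum square_integrable_diff
          S_sq MS_sq rS_sq rS_sq0 square_integrable_flow p_sq')+
    also have "\<dots> \<le> sqrt (real n) * T J + (\<Sum>j<J. 2 * real j * \<rho> j)"
    proof (rule order_trans[OF L2norm_triangle], goal_cases)
      case 1
      show ?case using p_sq' by (intro square_integrable_sum square_integrable_flow)
    next
      case 2
      show ?case by (intro square_integrable_sum square_integrable_diff rS_sq rS_sq0)
    next
      case 3
      show ?case
      proof (rule add_mono[OF tail order_trans[OF L2norm_sum_le]])
        show "square_integrable M (\<lambda>x. (\<Sum>i<n. r j (\<theta> (int i) x)) - (\<Sum>i<n. r j (\<theta> (int i + int j) x)))" for j
          by (intro square_integrable_diff rS_sq rS_sq0)
        show "(\<Sum>j<J. L2norm M (\<lambda>x. (\<Sum>i<n. r j (\<theta> (int i) x)) - (\<Sum>i<n. r j (\<theta> (int i + int j) x))))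
          \<le> (\<Sum>j<J. 2 * real j * \<rho> j)"
          unfolding \<rho>_def by (intro sum_mono L2norm_sum_flow_shift_le r_sq)
      qed
    qed
    finally show ?thesis by (simp add: C_def)
  qed
  define \<sigma> where "\<sigma> J = L2norm M (D J)" for J
  have s0: "s \<ge> 0" by (rule LIMSEQ_le_const[OF var]) auto
  \<comment> \<open>The martingale sum has norm exactly \<open>sqrt n * \<sigma> J\<close>. Dividing
    the approximation by \<open>sqrt n\<close> and letting n grow removes \<open>C J\<close> and
    leaves \<open>T J\<close>.\<close>
  have \<sigma>_close: "\<bar>sqrt s - \<sigma> J\<bar> \<le> T J" for J
  proof (rule LIMSEQ_le[of "\<lambda>n. \<bar>L2norm M (S n) / sqrt (real n) - \<sigma> J\<bar>" _ "\<lambda>n. T J + C J / sqrt (real n)"])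
    have "(\<lambda>n. sqrt ((\<integral>x. (S n x)\<^sup>2 \<partial>M) / real n)) \<longlonglongrightarrow> sqrt s"
      unfolding S_def using var by (rule tendsto_real_sqrt)
    then have "(\<lambda>n. L2norm M (S n) / sqrt (real n)) \<longlonglongrightarrow> sqrt s"
      by (simp add: L2norm_def real_sqrt_divide)
    then show "(\<lambda>n. \<bar>L2norm M (S n) / sqrt (real n) - \<sigma> J\<bar>) \<longlonglongrightarrow> \<bar>sqrt s - \<sigma> J\<bar>"
      by (intro tendsto_intros)
    have "(\<lambda>n. C J / sqrt (real n)) \<longlonglongrightarrow> 0"
      by (rule real_tendsto_divide_at_top[OF tendsto_const])
        (rule filterlim_compose[OF sqrt_at_top filterlim_real_sequentially])
    from tendsto_add[OF tendsto_const[of "T J"] this]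
    show "(\<lambda>n. T J + C J / sqrt (real n)) \<longlonglongrightarrow> T J" by simp
    have "\<bar>L2norm M (S n) / sqrt (real n) - \<sigma> J\<bar> \<le> T J + C J / sqrt (real n)" if "n > 0" for n
    proof -
      have "L2norm M (MS J n) = sqrt (real n) * \<sigma> J"
        unfolding MS_def \<sigma>_def by (rule L2norm_sum_innovation[OF D_inn])
      moreover have "\<bar>L2norm M (S n) - L2norm M (MS J n)\<bar> \<le> sqrt (real n) * T J + C J"
        using L2norm_triangle_diff[OF S_sq MS_sq, of n J n] L2norm_triangle_diff[OF MS_sq S_sq, of J n n] approx[of n J]
          L2norm_minus_commute[of M "S n" "MS J n"] by linarith
      ultimately have "\<bar>L2norm M (S n) - sqrt (real n) * \<sigma> J\<bar> / sqrt (real n) \<le> (sqrt (real n) * T J + C J) / sqrt (real n)"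
        by (intro divide_right_mono) auto
      moreover have "\<bar>L2norm M (S n) - sqrt (real n) * \<sigma> J\<bar> / sqrt (real n) = \<bar>L2norm M (S n) / sqrt (real n) - \<sigma> J\<bar>"
      proof -
        have "L2norm M (S n) / sqrt (real n) - \<sigma> J = (L2norm M (S n) - sqrt (real n) * \<sigma> J) / sqrt (real n)"
          using that by (simp add: diff_divide_distrib)
        then show ?thesis by simp
      qed
      ultimately show ?thesis using that by (simp add: add_divide_distrib)
    qed
    then show "\<exists>N. \<forall>n\<ge>N. \<bar>L2norm M (S n) / sqrt (real n) - \<sigma> J\<bar> \<le> T J + C J / sqrt (real n)"
      by (intro exI[of _ 1]) auto
  qed
  define G where "G v = complex_of_real (exp (- (t\<^sup>2 * v / 2)))" for v
  define \<phi> where "\<phi> f n = (\<integral>x. iexp (t / sqrt (real n) * f n x) \<partial>M)" for f and n :: nat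
  have mart: "\<phi> (MS J) \<longlonglongrightarrow> G ((\<sigma> J)\<^sup>2)" for J
  proof -
    have "\<phi> (MS J) = (\<lambda>n. \<integral>x. iexp (t / sqrt (real n) * (\<Sum>i<n. D J (\<theta> (int i) x))) \<partial>M)"
      by (rule ext) (simp only: \<phi>_def MS_def)
    then show ?thesis
      using martingale_clt[OF D_inn[of J], of t]
      by (simp only: G_def \<sigma>_def L2norm_power2)
  qed
  have "(\<lambda>J. sqrt s - \<sigma> J) \<longlonglongrightarrow> 0"
    by (rule Lim_null_comparison[OF _ T0]) (simp add: \<sigma>_close)
  then have "(\<lambda>J. sqrt s - (sqrt s - \<sigma> J)) \<longlonglongrightarrow> sqrt s - 0" by (intro tendsto_intros)
  then have "\<sigma> \<longlonglongrightarrow> sqrt s" by simp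
  then have "(\<lambda>J. G ((\<sigma> J)\<^sup>2)) \<longlonglongrightarrow> G ((sqrt s)\<^sup>2)"
    unfolding G_def by (intro tendsto_intros) auto
  then have G_lim: "(\<lambda>J. G ((\<sigma> J)\<^sup>2)) \<longlonglongrightarrow> G s" using s0 by simp
  have "\<phi> S \<longlonglongrightarrow> G s"
  proof (rule LIMSEQ_I)
    fix e :: real assume e: "e > 0"
    have "(\<lambda>J. \<bar>t\<bar> * T J) \<longlonglongrightarrow> \<bar>t\<bar> * 0" by (intro tendsto_intros T0)
    then have "eventually (\<lambda>J. \<bar>t\<bar> * T J < e / 4) sequentially"
      using e by (intro order_tendstoD(2)[where y="\<bar>t\<bar> * 0"]) auto
    moreover have "eventually (\<lambda>J. dist (G ((\<sigma> J)\<^sup>2)) (G s) < e / 4) sequentially"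
      using G_lim e by (intro tendstoD) auto
    ultimately have "eventually (\<lambda>J. \<bar>t\<bar> * T J < e / 4 \<and> dist (G ((\<sigma> J)\<^sup>2)) (G s) < e / 4) sequentially"
      by (rule eventually_conj)
    then obtain J where J: "\<bar>t\<bar> * T J < e / 4" "dist (G ((\<sigma> J)\<^sup>2)) (G s) < e / 4"
      by (auto simp: eventually_sequentially)
    have "(\<lambda>n. \<bar>t\<bar> * C J / sqrt (real n)) \<longlonglongrightarrow> 0"
      by (rule real_tendsto_divide_at_top[OF tendsto_const])
        (rule filterlim_compose[OF sqrt_at_top filterlim_real_sequentially])
    then have "eventually (\<lambda>n. \<bar>t\<bar> * C J / sqrt (real n) < e / 4) sequentially"
      using e by (intro order_tendstoD) auto
    moreover have "eventually (\<lambda>n. dist (\<phi> (MS J) n) (G ((\<sigma> J)\<^sup>2)) < e / 4) sequentially"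
      using mart e by (intro tendstoD) auto
    ultimately have "eventually (\<lambda>n. norm (\<phi> S n - G s) < e) sequentially"
      using eventually_gt_at_top[of 0]
    proof eventually_elim
      case (elim n)
      have "norm (\<phi> S n - \<phi> (MS J) n) \<le> \<bar>t / sqrt (real n)\<bar> * L2norm M (\<lambda>x. S n x - MS J n x)"
        unfolding \<phi>_def by (rule norm_expectation_iexp_diff_le[OF S_sq MS_sq])
      also have "\<dots> \<le> \<bar>t / sqrt (real n)\<bar> * (sqrt (real n) * T J + C J)"
        by (intro mult_left_mono approx) auto
      also have "\<dots> = \<bar>t\<bar> * T J + \<bar>t\<bar> * C J / sqrt (real n)"
        using elim(3) by (simp add: field_simps)
      also have "\<dots> < e / 4 + e / 4" using J(1) elim(1) by (rule add_strict_mono)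
      finally have "dist (\<phi> S n) (\<phi> (MS J) n) < e / 2" by (simp add: dist_norm)
      then have "dist (\<phi> S n) (G s) < e"
        using elim(2) J(2) dist_triangle[of "\<phi> S n" "G s" "\<phi> (MS J) n"]
          dist_triangle[of "\<phi> (MS J) n" "G s" "G ((\<sigma> J)\<^sup>2)"] by linarith
      then show ?case by (simp add: dist_norm)
    qed
    then show "\<exists>no. \<forall>n\<ge>no. norm (\<phi> S n - G s) < e" by (simp add: eventually_sequentially)
  qed
  moreover have "\<phi> S = (\<lambda>n. \<integral>x. iexp (t / sqrt (real n) * (\<Sum>i<n. h (\<theta> (int i) x))) \<partial>M)"
    by (rule ext) (simp only: \<phi>_def S_def)
  ultimately show ?thesis by (simp only: G_def)
qed

end

section \<open>Convergence of characteristic functions in Euclidean space\<close>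

text \<open>Only sums and scalar multiples occur as rules, so convergence of integrals passes by
  induction from cosines and sines to all members. Closure under products, needed for
  Stone-Weierstrass, is derived from the addition formulas.\<close>

inductive_set trig_polynomials :: "('b::real_inner \<Rightarrow> real) set" where
  cos: "(\<lambda>x. cos (t \<bullet> x)) \<in> trig_polynomials"
| sin: "(\<lambda>x. sin (t \<bullet> x)) \<in> trig_polynomials"
| add: "f \<in> trig_polynomials \<Longrightarrow> g \<in> trig_polynomials \<Longrightarrow> (\<lambda>x. f x + g x) \<in> trig_polynomials"
| cmult: "f \<in> trig_polynomials \<Longrightarrow> (\<lambda>x. c * f x) \<in> trig_polynomials"

lemma trig_polynomials_const: "(\<lambda>x. c) \<in> trig_polynomials"
  using trig_polynomials.cmult[OF trig_polynomials.cos[of 0], of c] by simp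

lemma trig_polynomials_cos_mult:
  assumes "g \<in> trig_polynomials"
  shows "(\<lambda>x. cos (s \<bullet> x) * g x) \<in> trig_polynomials"
  using assms
proof induction
  case (cos t)
  have "(\<lambda>x. (1/2) * cos ((s - t) \<bullet> x) + (1/2) * cos ((s + t) \<bullet> x)) \<in> trig_polynomials"
    by (intro trig_polynomials.intros)
  then show ?case by (simp add: cos_times_cos inner_diff_left inner_add_left add_divide_distrib)
next
  case (sin t)
  have "(\<lambda>x. (1/2) * sin ((s + t) \<bullet> x) + (- 1/2) * sin ((s - t) \<bullet> x)) \<in> trig_polynomials"
    by (intro trig_polynomials.intros)
  then show ?case by (simp add: cos_times_sin inner_diff_left inner_add_left diff_divide_distrib)
next
  case (add f g)
  then show ?case by (simp add: distrib_left trig_polynomials.add)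
next
  case (cmult f c)
  then show ?case using trig_polynomials.cmult[of "\<lambda>x. cos (s \<bullet> x) * f x" c] by (simp add: ac_simps)
qed

lemma trig_polynomials_sin_mult:
  assumes "g \<in> trig_polynomials"
  shows "(\<lambda>x. sin (s \<bullet> x) * g x) \<in> trig_polynomials"
  using assms
proof induction
  case (cos t)
  have "(\<lambda>x. (1/2) * sin ((s + t) \<bullet> x) + (1/2) * sin ((s - t) \<bullet> x)) \<in> trig_polynomials"
    by (intro trig_polynomials.intros)
  then show ?case by (simp add: sin_times_cos inner_diff_left inner_add_left add_divide_distrib)
next
  case (sin t)
  have "(\<lambda>x. (1/2) * cos ((s - t) \<bullet> x) + (- 1/2) * cos ((s + t) \<bullet> x)) \<in> trig_polynomials"
    by (intro trig_polynomials.intros)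
  then show ?case by (simp add: sin_times_sin inner_diff_left inner_add_left diff_divide_distrib)
next
  case (add f g)
  then show ?case by (simp add: distrib_left trig_polynomials.add)
next
  case (cmult f c)
  then show ?case using trig_polynomials.cmult[of "\<lambda>x. sin (s \<bullet> x) * f x" c] by (simp add: ac_simps)
qed

lemma trig_polynomials_mult:
  assumes "f \<in> trig_polynomials" "g \<in> trig_polynomials"
  shows "(\<lambda>x. f x * g x) \<in> trig_polynomials"
  using assms
proof induction
  case (cmult f c)
  then show ?case using trig_polynomials.cmult[of "\<lambda>x. f x * g x" c] by (simp add: ac_simps)
qed (simp_all add: trig_polynomials_cos_mult trig_polynomials_sin_mult distrib_right trig_polynomials.add)

lemma trig_polynomials_compose_polynomial:
  fixes q :: "real \<Rightarrow> real"
  assumes "real_polynomial_function q" "f \<in> trig_polynomials"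
  shows "(\<lambda>x. q (f x)) \<in> trig_polynomials"
  using assms
proof induction
  case (linear q)
  then have "q y = q 1 * y" for y
    using linear_scale[OF bounded_linear.linear, of q y 1] by simp
  then have "(\<lambda>x. q (f x)) = (\<lambda>x. q 1 * f x)" by blast
  then show ?case using trig_polynomials.cmult[OF linear(2), of "q 1"] by (simp only:)
next
  case (const c)
  show ?case by (rule trig_polynomials_const)
next
  case (add p q)
  then show ?case by (intro trig_polynomials.add)
next
  case (mult p q)
  then show ?case by (intro trig_polynomials_mult)
qed

lemma trig_polynomials_bounded:
  assumes "f \<in> trig_polynomials"
  shows "\<exists>B. \<forall>x. \<bar>f x\<bar> \<le> B"
  using assms
proof induction
  case (add f g)
  then obtain A B where "\<forall>x. \<bar>f x\<bar> \<le> A" "\<forall>x. \<bar>g x\<bar> \<le> B" by blast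
  then have "\<bar>f x + g x\<bar> \<le> A + B" for x
    using abs_triangle_ineq[of "f x" "g x"] by (smt (verit))
  then show ?case by blast
next
  case (cmult f c)
  then obtain A where "\<forall>x. \<bar>f x\<bar> \<le> A" by blast
  then have "\<bar>c * f x\<bar> \<le> \<bar>c\<bar> * A" for x by (simp add: abs_mult mult_left_mono)
  then show ?case by blast
qed (auto intro!: exI[of _ 1])

lemma trig_polynomials_continuous:
  assumes "f \<in> trig_polynomials"
  shows "continuous_on S f"
  using assms by induction (intro continuous_intros; simp)+

lemma trig_polynomials_separate:
  fixes x y :: "'b::real_inner"
  assumes "x \<noteq> y"
  shows "\<exists>f\<in>trig_polynomials. f x \<noteq> f y"
proof -
  define d where "d = x - y"
  have d: "d \<bullet> d > 0" using assms by (simp add: d_def)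
  \<comment> \<open>Scaled so that \<open>t \<bullet> (x - y) = 1\<close>; equal cosines and equal
    sines would then force \<open>cos 1 = 1\<close>.\<close>
  define t where "t = (1 / (d \<bullet> d)) *\<^sub>R d"
  have "t \<bullet> d = 1" using d by (simp add: t_def)
  then have t: "t \<bullet> x = t \<bullet> y + 1" by (simp add: d_def inner_diff_right)
  show ?thesis
  proof (rule ccontr)
    assume "\<not> ?thesis"
    then have "f x = f y" if "f \<in> trig_polynomials" for f using that by blast
    from this[OF trig_polynomials.cos[of t]] this[OF trig_polynomials.sin[of t]]
    have "cos (t \<bullet> x) = cos (t \<bullet> y)" "sin (t \<bullet> x) = sin (t \<bullet> y)" .
    then have "cos (t \<bullet> x - t \<bullet> y) = 1"
      by (simp add: cos_diff power2_eq_square[symmetric])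
    then have "cos (1::real) = 1" using t by simp
    moreover have "cos (1::real) < cos 0" by (intro cos_monotone_0_pi) (use pi_gt3 in auto)
    ultimately show False by simp
  qed
qed

text \<open>Stone--Weierstrass alone does not control the approximating trigonometric polynomial off
  the compact ball; composing it with a polynomial close to the truncation at \<open>\<plusminus>K\<close> does.\<close>

lemma trig_polynomials_approx:
  fixes f :: "'b::euclidean_space \<Rightarrow> real"
  assumes f: "continuous_on UNIV f" and K: "\<And>x. \<bar>f x\<bar> \<le> K" and e: "e > 0"
  shows "\<exists>g\<in>trig_polynomials. (\<forall>x\<in>cball 0 L. \<bar>f x - g x\<bar> \<le> e) \<and> (\<forall>x. \<bar>g x\<bar> \<le> K + e)"
proof -
  have K0: "K \<ge> 0" using K[of 0] by linarith
  interpret function_ring_on trig_polynomials "cball (0::'b) L"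
    by unfold_locales
      (auto intro: trig_polynomials_continuous trig_polynomials.add trig_polynomials_mult
        trig_polynomials_const trig_polynomials_separate)
  obtain p where p: "p \<in> trig_polynomials" "\<forall>x\<in>cball 0 L. \<bar>f x - p x\<bar> < e / 2"
    using Stone_Weierstrass_basic[OF continuous_on_subset[OF f], of "e / 2"] e by auto
  \<comment> \<open>Boundedness on the whole space puts all values of \<open>p\<close> into a
    compact interval, so the polynomial approximating \<open>clip\<close> there is accurate at every
    \<open>x\<close>, inside the ball or not.\<close>
  obtain B where B: "\<forall>x. \<bar>p x\<bar> \<le> B" using trig_polynomials_bounded[OF p(1)] by blast
  define clip where "clip y = max (- K) (min K y)" for y :: real
  have "continuous_on {- B..B} clip" unfolding clip_def by (intro continuous_intros)
  then obtain q where q: "real_polynomial_function q" "\<And>y. y \<in> {- B..B} \<Longrightarrow> \<bar>clip y - q y\<bar> < e / 2"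
    using Stone_Weierstrass_real_polynomial_function[of "{- B..B}" clip "e / 2"] e by auto
  show ?thesis
  proof (intro bexI conjI ballI allI)
    show "(\<lambda>x. q (p x)) \<in> trig_polynomials"
      by (rule trig_polynomials_compose_polynomial[OF q(1) p(1)])
    have pq: "\<bar>clip (p x) - q (p x)\<bar> < e / 2" for x
      using B by (intro q(2)) (simp add: abs_le_iff minus_le_iff)
    show "\<bar>q (p x)\<bar> \<le> K + e" for x
    proof -
      have "\<bar>clip (p x)\<bar> \<le> K" using K0 by (auto simp: clip_def)
      then show ?thesis using pq[of x] e by linarith
    qed
    fix x :: 'b assume "x \<in> cball 0 L"
    then have "\<bar>f x - p x\<bar> < e / 2" using p(2) by blast
    moreover have "\<bar>f x - clip (p x)\<bar> \<le> \<bar>f x - p x\<bar>"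
      using K[of x] by (auto simp: clip_def max_def min_def abs_if split: if_splits)
    ultimately show "\<bar>f x - q (p x)\<bar> \<le> e" using pq[of x] by linarith
  qed
qed

lemma trig_polynomials_integrable:
  fixes f :: "'b::euclidean_space \<Rightarrow> real"
  assumes "prob_space M" "T \<in> borel_measurable M" "f \<in> trig_polynomials"
  shows "integrable M (\<lambda>x. f (T x))"
proof -
  interpret prob_space M by fact
  obtain B where "\<forall>x. \<bar>f x\<bar> \<le> B" using trig_polynomials_bounded[OF assms(3)] by blast
  moreover have "f \<in> borel_measurable borel"
    using trig_polynomials_continuous[OF assms(3)] by (rule borel_measurable_continuous_onI)
  ultimately show ?thesis using assms(2)
    by (intro integrable_const_bound[where B=B]) auto
qed

lemma integral_trig_polynomial_tendsto:
  fixes T :: "nat \<Rightarrow> 'w \<Rightarrow> 'b::euclidean_space"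
  assumes M: "prob_space M" and T: "\<And>n. T n \<in> borel_measurable M"
    and \<mu>: "prob_space \<mu>" "sets \<mu> = sets borel"
    and cos: "\<And>t. (\<lambda>n. \<integral>\<omega>. cos (t \<bullet> T n \<omega>) \<partial>M) \<longlonglongrightarrow> (\<integral>v. cos (t \<bullet> v) \<partial>\<mu>)"
    and sin: "\<And>t. (\<lambda>n. \<integral>\<omega>. sin (t \<bullet> T n \<omega>) \<partial>M) \<longlonglongrightarrow> (\<integral>v. sin (t \<bullet> v) \<partial>\<mu>)"
    and f: "f \<in> trig_polynomials"
  shows "(\<lambda>n. \<integral>\<omega>. f (T n \<omega>) \<partial>M) \<longlonglongrightarrow> (\<integral>v. f v \<partial>\<mu>)"
  using f
proof induction
  case (add f g)
  have \<mu>i: "integrable \<mu> h" if "h \<in> trig_polynomials" for h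
    using trig_polynomials_integrable[OF \<mu>(1) _ that, of "\<lambda>x. x"] \<mu>(2) measurable_ident_sets[OF \<mu>(2)] by simp
  show ?case
    using add tendsto_add[OF add.IH] trig_polynomials_integrable[OF M T] \<mu>i by simp
next
  case (cmult f c)
  then show ?case using tendsto_mult_left[OF cmult.IH, of c] by simp
qed (rule cos sin)+

theorem characteristic_convergence_imp_distribution:
  fixes T :: "nat \<Rightarrow> 'w \<Rightarrow> 'b::euclidean_space" and f :: "'b \<Rightarrow> real"
  assumes M: "prob_space M" and T: "\<And>n. T n \<in> borel_measurable M"
    and \<mu>: "prob_space \<mu>" "sets \<mu> = sets borel"
    and tight: "\<And>e. e > 0 \<Longrightarrow> \<exists>L. \<forall>\<^sub>F n in sequentially. measure M {\<omega> \<in> space M. norm (T n \<omega>) > L} < e"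
    and cos: "\<And>t. (\<lambda>n. \<integral>\<omega>. cos (t \<bullet> T n \<omega>) \<partial>M) \<longlonglongrightarrow> (\<integral>v. cos (t \<bullet> v) \<partial>\<mu>)"
    and sin: "\<And>t. (\<lambda>n. \<integral>\<omega>. sin (t \<bullet> T n \<omega>) \<partial>M) \<longlonglongrightarrow> (\<integral>v. sin (t \<bullet> v) \<partial>\<mu>)"
    and f: "continuous_on UNIV f" "bounded (range f)"
  shows "(\<lambda>n. \<integral>\<omega>. f (T n \<omega>) \<partial>M) \<longlonglongrightarrow> (\<integral>v. f v \<partial>\<mu>)"
proof (rule LIMSEQ_I)
  interpret M: prob_space M by fact
  interpret \<mu>: prob_space \<mu> by fact
  note [measurable] = T measurable_ident_sets[OF \<mu>(2)]
  have fm [measurable]: "f \<in> borel_measurable borel" using f(1) by (rule borel_measurable_continuous_onI)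
  obtain K where K: "\<And>x. \<bar>f x\<bar> \<le> K" using f(2) by (auto simp: bounded_iff)
  have K0: "K \<ge> 0" using K[of 0] by linarith
  fix r :: real assume r: "r > 0"
  \<comment> \<open>Off the ball \<open>f\<close> and \<open>g\<close> differ by at most K + (K + e)
    \<le> 2K + 1, an event of probability below \<open>d\<close>. Replacing \<open>f\<close> by
    \<open>g\<close> thus costs at most r/6 + r/6 under each of the two laws, which leaves r/3 for
    the convergence of the integrals of \<open>g\<close>.\<close>
  define e where "e = min 1 (r / 6)"
  define d where "d = r / (6 * (2 * K + 1))"
  have e: "e > 0" "e \<le> 1" "e \<le> r / 6" using r by (auto simp: e_def)
  have d: "d > 0" "(2 * K + 1) * d = r / 6" using r K0 by (auto simp: d_def field_simps)
  obtain L1 where L1: "\<forall>\<^sub>F n in sequentially. measure M {\<omega> \<in> space M. norm (T n \<omega>) > L1} < d"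
    using tight[OF d(1)] by blast
  have "\<exists>L2::nat. measure \<mu> {v \<in> space \<mu>. norm v > real L2} < d"
  proof -
    have "{v \<in> space \<mu>. norm v > c} \<in> sets \<mu>" for c by measurable
    then have "(\<lambda>n. measure \<mu> {v \<in> space \<mu>. norm v > real n}) \<longlonglongrightarrow> measure \<mu> (\<Inter>n. {v \<in> space \<mu>. norm v > real n})"
      by (intro \<mu>.finite_Lim_measure_decseq) (auto simp: decseq_def)
    moreover have "(\<Inter>n. {v \<in> space \<mu>. norm v > real n}) = {}"
      by (auto, metis not_less real_arch_simple)
    ultimately have "(\<lambda>n. measure \<mu> {v \<in> space \<mu>. norm v > real n}) \<longlonglongrightarrow> 0" by simp
    from order_tendstoD(2)[OF this d(1)] show ?thesis by (auto simp: eventually_sequentially)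
  qed
  then obtain L2 :: nat where L2: "measure \<mu> {v \<in> space \<mu>. norm v > real L2} < d" by blast
  define L where "L = max L1 (real L2)"
  obtain g where g: "g \<in> trig_polynomials" "\<forall>x\<in>cball 0 L. \<bar>f x - g x\<bar> \<le> e" "\<forall>x. \<bar>g x\<bar> \<le> K + e"
    using trig_polynomials_approx[OF f(1) K e(1), of L] by blast
  have gm [measurable]: "g \<in> borel_measurable borel"
    using trig_polynomials_continuous[OF g(1)] by (rule borel_measurable_continuous_onI)
  have diff: "\<bar>(\<integral>x. f (U x) \<partial>N) - (\<integral>x. g (U x) \<partial>N)\<bar> \<le> r / 3"
    if N: "prob_space N" and U [measurable]: "U \<in> borel_measurable N"
      and small: "measure N {x \<in> space N. norm (U x) > L} < d" for N :: "'c measure" and U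
  proof -
    interpret N: prob_space N by fact
    have fi: "integrable N (\<lambda>x. f (U x))" by (rule N.integrable_const_bound[where B=K]) (use K in auto)
    have gi: "integrable N (\<lambda>x. g (U x))" by (rule trig_polynomials_integrable[OF N U g(1)])
    have bi: "integrable N (\<lambda>x. e + (2 * K + 1) * indicator {x \<in> space N. norm (U x) > L} x)"
      by (intro Bochner_Integration.integrable_add integrable_mult_right integrable_real_indicator) (auto simp: less_top[symmetric])
    have "\<bar>(\<integral>x. f (U x) \<partial>N) - (\<integral>x. g (U x) \<partial>N)\<bar> = \<bar>\<integral>x. f (U x) - g (U x) \<partial>N\<bar>"
      using fi gi by simp
    also have "\<dots> \<le> (\<integral>x. \<bar>f (U x) - g (U x)\<bar> \<partial>N)" by (rule integral_abs_bound)
    also have "\<dots> \<le> (\<integral>x. e + (2 * K + 1) * indicator {x \<in> space N. norm (U x) > L} x \<partial>N)"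
    proof (rule integral_mono[OF integrable_abs[OF Bochner_Integration.integrable_diff[OF fi gi]] bi])
      fix x assume x: "x \<in> space N"
      show "\<bar>f (U x) - g (U x)\<bar> \<le> e + (2 * K + 1) * indicator {x \<in> space N. norm (U x) > L} x"
      proof (cases "norm (U x) > L")
        case True
        then show ?thesis using x K[of "U x"] g(3)[rule_format, of "U x"] e by simp
      next
        case False
        then show ?thesis using g(2) by simp
      qed
    qed
    also have "\<dots> = e + (2 * K + 1) * measure N {x \<in> space N. norm (U x) > L}"
      by (simp add: N.prob_space less_top[symmetric])
    also have "\<dots> \<le> e + (2 * K + 1) * d" using small K0 by (intro add_left_mono mult_left_mono) auto
    finally show ?thesis using d(2) e(3) by linarith
  qed
  have \<mu>_diff: "\<bar>(\<integral>x. f x \<partial>\<mu>) - (\<integral>x. g x \<partial>\<mu>)\<bar> \<le> r / 3"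
  proof (rule diff[OF \<mu>(1) measurable_ident_sets[OF \<mu>(2)]])
    have "measure \<mu> {x \<in> space \<mu>. norm x > L} \<le> measure \<mu> {v \<in> space \<mu>. norm v > real L2}"
      by (intro \<mu>.finite_measure_mono) (auto simp: L_def)
    with L2 show "measure \<mu> {x \<in> space \<mu>. norm x > L} < d" by simp
  qed
  have "(\<lambda>n. \<integral>\<omega>. g (T n \<omega>) \<partial>M) \<longlonglongrightarrow> (\<integral>v. g v \<partial>\<mu>)"
    by (rule integral_trig_polynomial_tendsto[OF M T \<mu> cos sin g(1)])
  then have "\<forall>\<^sub>F n in sequentially. dist (\<integral>\<omega>. g (T n \<omega>) \<partial>M) (\<integral>v. g v \<partial>\<mu>) < r / 3"
    using r by (intro tendstoD) auto
  with L1 have "\<forall>\<^sub>F n in sequentially. norm ((\<integral>\<omega>. f (T n \<omega>) \<partial>M) - (\<integral>v. f v \<partial>\<mu>)) < r"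
  proof eventually_elim
    case (elim n)
    have "measure M {x \<in> space M. norm (T n x) > L} \<le> measure M {x \<in> space M. norm (T n x) > L1}"
      by (intro M.finite_measure_mono) (auto simp: L_def)
    then have "\<bar>(\<integral>\<omega>. f (T n \<omega>) \<partial>M) - (\<integral>\<omega>. g (T n \<omega>) \<partial>M)\<bar> \<le> r / 3"
      using elim(1) by (intro diff[OF M T]) simp
    then show ?case using \<mu>_diff elim(2) unfolding dist_real_def real_norm_def by linarith
  qed
  then show "\<exists>no. \<forall>n\<ge>no. norm ((\<integral>\<omega>. f (T n \<omega>) \<partial>M) - (\<integral>v. f v \<partial>\<mu>)) < r"
    by (simp add: eventually_sequentially)
qed

section \<open>Linear changes of variables\<close>

lemma prod_Basis_cart:
  fixes f :: "real^'n \<Rightarrow> 'b::comm_monoid_mult"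
  shows "(\<Prod>b\<in>Basis. f b) = (\<Prod>i\<in>UNIV. f (axis i 1))"
proof -
  have "(Basis :: (real^'n) set) = range (\<lambda>i. axis i 1)" by (auto simp: Basis_vec_def)
  then have "prod f Basis = prod f (range (\<lambda>i. axis i 1))" by (rule arg_cong)
  moreover have "inj (\<lambda>i::'n. axis i (1::real))" by (auto simp: inj_def axis_eq_axis)
  ultimately show ?thesis by (simp only: prod.reindex comp_def)
qed

lemma sum_Basis_cart:
  fixes f :: "real^'n \<Rightarrow> 'b::comm_monoid_add"
  shows "(\<Sum>b\<in>Basis. f b) = (\<Sum>i\<in>UNIV. f (axis i 1))"
proof -
  have "(Basis :: (real^'n) set) = range (\<lambda>i. axis i 1)" by (auto simp: Basis_vec_def)
  then have "sum f Basis = sum f (range (\<lambda>i. axis i 1))" by (rule arg_cong)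
  moreover have "inj (\<lambda>i::'n. axis i (1::real))" by (auto simp: inj_def axis_eq_axis)
  ultimately show ?thesis by (simp only: sum.reindex comp_def)
qed

lemma borel_measurable_matrix_vector_mult [measurable]:
  "(\<lambda>v::real^'n. A *v v) \<in> borel_measurable borel"
  by (intro borel_measurable_continuous_onI linear_continuous_on matrix_vector_mul_bounded_linear)

lemma nn_integral_lborel_diagonal:
  fixes A :: "real^'n^'n"
  assumes A: "\<And>i j. i \<noteq> j \<Longrightarrow> A $ i $ j = 0" and f [measurable]: "f \<in> borel_measurable borel" and det: "det A \<noteq> 0"
  shows "ennreal \<bar>det A\<bar> * (\<integral>\<^sup>+v. f (A *v v) \<partial>lborel) = (\<integral>\<^sup>+v. f v \<partial>lborel)"
proof -
  define c where "c b = b \<bullet> (A *v b)" for b :: "real^'n"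
  have c_axis: "c (axis i 1) = A $ i $ i" for i
    by (simp add: c_def inner_axis' matrix_vector_mul_component inner_axis)
  have detA: "det A = (\<Prod>i\<in>UNIV. A $ i $ i)" by (rule det_diagonal[OF A])
  have c0: "c b \<noteq> 0" if "b \<in> Basis" for b
    using that det unfolding Basis_vec_def by (auto simp: c_axis detA)
  have T: "0 + (\<Sum>j\<in>Basis. (c j * (v \<bullet> j)) *\<^sub>R j) = A *v v" for v
  proof -
    have "(\<Sum>j\<in>UNIV. A $ i $ j * v $ j) = A $ i $ i * v $ i" for i
      using A by (subst sum.remove[of _ i]) auto
    moreover have "(\<Sum>j\<in>UNIV. (A $ j $ j * v $ j) *\<^sub>R axis j 1) $ i = A $ i $ i * v $ i" for i
    proof -
      have "(\<Sum>j\<in>UNIV. A $ j $ j * v $ j * axis j 1 $ i) = (\<Sum>j\<in>UNIV. if j = i then A $ j $ j * v $ j else 0)"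
        by (intro sum.cong) (auto simp: axis_def)
      then show ?thesis by simp
    qed
    ultimately show ?thesis
      by (simp add: sum_Basis_cart c_axis vec_eq_iff matrix_vector_mult_def inner_axis)
  qed
  have "(\<Prod>j\<in>Basis. \<bar>c j\<bar>) = \<bar>det A\<bar>"
    by (simp add: prod_Basis_cart c_axis detA abs_prod)
  then have "lborel = density (distr lborel borel (\<lambda>v. A *v v)) (\<lambda>_. ennreal \<bar>det A\<bar>)"
    using lborel_affine_euclidean[of c 0, OF c0] unfolding T by simp
  then have "(\<integral>\<^sup>+v. f v \<partial>lborel) = (\<integral>\<^sup>+v. f v \<partial>density (distr lborel borel (\<lambda>v. A *v v)) (\<lambda>_. ennreal \<bar>det A\<bar>))"
    by (rule arg_cong)
  also have "\<dots> = ennreal \<bar>det A\<bar> * (\<integral>\<^sup>+v. f (A *v v) \<partial>lborel)"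
    by (simp add: nn_integral_density nn_integral_distr nn_integral_cmult)
  finally show ?thesis ..
qed

text \<open>Preimages of boxes are boxes with permuted sides, and their volume, a product over the
  coordinates, ignores the order. Lebesgue measure is determined by its values on boxes.\<close>

lemma nn_integral_lborel_permute:
  fixes p :: "'n::finite \<Rightarrow> 'n"
  assumes p: "p permutes UNIV" and f [measurable]: "f \<in> borel_measurable borel"
  shows "(\<integral>\<^sup>+v. f (\<chi> i. v $ p i) \<partial>lborel) = (\<integral>\<^sup>+v. f v \<partial>(lborel :: (real^'n) measure))"
proof -
  define T where "T v = (\<chi> i. v $ p i)" for v :: "real^'n"
  have T_meas [measurable]: "T \<in> borel_measurable borel"
    unfolding T_def by (intro borel_measurable_continuous_onI continuous_intros)
  have "lborel = distr lborel borel T"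
  proof (rule lborel_eqI)
    fix l u :: "real^'n" assume le: "\<And>b. b \<in> Basis \<Longrightarrow> l \<bullet> b \<le> u \<bullet> b"
    define q where "q = inv p"
    have q: "p (q i) = i" "q (p i) = i" for i using permutes_inverses[OF p] by (simp_all add: q_def)
    define l' u' where "l' = (\<chi> i. l $ q i)" and "u' = (\<chi> i. u $ q i)"
    have "T -` box l u = box l' u'"
    proof -
      have "(\<forall>i. l $ i < v $ p i \<and> v $ p i < u $ i) \<longleftrightarrow> (\<forall>i. l $ q i < v $ i \<and> v $ i < u $ q i)" for v :: "real^'n"
        using q by metis
      then show ?thesis by (auto simp: T_def l'_def u'_def mem_box_cart)
    qed
    then have "emeasure (distr lborel borel T) (box l u) = emeasure lborel (box l' u')"
      by (subst emeasure_distr) auto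
    also have "\<dots> = ennreal (\<Prod>b\<in>Basis. (u' - l') \<bullet> b)"
    proof (rule emeasure_lborel_box)
      fix b :: "real^'n" assume "b \<in> Basis"
      then obtain i where b: "b = axis i 1" by (auto simp: Basis_vec_def)
      have "l \<bullet> axis (q i) 1 \<le> u \<bullet> axis (q i) 1" by (rule le) simp
      then show "l' \<bullet> b \<le> u' \<bullet> b" by (simp add: b l'_def u'_def inner_axis)
    qed
    also have "(\<Prod>b\<in>Basis. (u' - l') \<bullet> b) = (\<Prod>i\<in>UNIV. u $ q i - l $ q i)"
      by (simp add: prod_Basis_cart inner_axis l'_def u'_def)
    also have "\<dots> = (\<Prod>i\<in>UNIV. u $ i - l $ i)"
      by (rule prod.permute[OF permutes_inv[OF p], of "\<lambda>i. u $ i - l $ i", symmetric, unfolded comp_def q_def[symmetric]])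
    also have "\<dots> = (\<Prod>b\<in>Basis. (u - l) \<bullet> b)"
      by (simp add: prod_Basis_cart inner_axis)
    finally show "emeasure (distr lborel borel T) (box l u) = ennreal (\<Prod>b\<in>Basis. (u - l) \<bullet> b)" .
  qed simp
  then have "(\<integral>\<^sup>+v. f v \<partial>lborel) = (\<integral>\<^sup>+v. f v \<partial>distr lborel borel T)" by (rule arg_cong)
  also have "\<dots> = (\<integral>\<^sup>+v. f (T v) \<partial>lborel)" by (subst nn_integral_distr) auto
  finally show ?thesis by (simp add: T_def)
qed

text \<open>Fubini with coordinate \<open>m\<close> innermost: because \<open>n\<close> is another
  index, \<open>v $ n\<close> is constant in the inner integral and the shear becomes a translation
  there.\<close>

lemma nn_integral_lborel_shear:
  fixes m n :: "'n::finite" and f :: "real^'n \<Rightarrow> ennreal"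
  assumes mn: "m \<noteq> n" and f [measurable]: "f \<in> borel_measurable borel"
  shows "(\<integral>\<^sup>+v. f (v + (c * v $ n) *\<^sub>R axis m 1) \<partial>lborel) = (\<integral>\<^sup>+v. f v \<partial>lborel)"
proof -
  interpret product_sigma_finite "\<lambda>_ :: real^'n. lborel :: real measure" ..
  let ?e = "axis m 1 :: real^'n"
  let ?B = "Basis :: (real^'n) set"
  have eB: "?e \<in> ?B" by simp
  have B: "?B = insert ?e (?B - {?e})" using eB by blast
  have coord: "(\<integral>\<^sup>+v. g v \<partial>lborel) = (\<integral>\<^sup>+x. \<integral>\<^sup>+y. g (y *\<^sub>R ?e + (\<Sum>b\<in>?B - {?e}. x b *\<^sub>R b)) \<partial>lborel \<partial>(\<Pi>\<^sub>M b\<in>?B - {?e}. lborel))"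
    if g [measurable]: "g \<in> borel_measurable borel" for g :: "real^'n \<Rightarrow> ennreal"
  proof -
    have "(\<integral>\<^sup>+v. g v \<partial>lborel) = (\<integral>\<^sup>+x. g (\<Sum>b\<in>?B. x b *\<^sub>R b) \<partial>(\<Pi>\<^sub>M b\<in>?B. lborel))"
      by (subst lborel_eq, subst nn_integral_distr) simp_all
    also have "\<dots> = (\<integral>\<^sup>+x. g (\<Sum>b\<in>?B. x b *\<^sub>R b) \<partial>(\<Pi>\<^sub>M b\<in>insert ?e (?B - {?e}). lborel))"
      using B by simp
    also have "\<dots> = (\<integral>\<^sup>+x. \<integral>\<^sup>+y. g (\<Sum>b\<in>?B. (x(?e := y)) b *\<^sub>R b) \<partial>lborel \<partial>(\<Pi>\<^sub>M b\<in>?B - {?e}. lborel))"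
    proof (rule product_nn_integral_insert)
      show "(\<lambda>x. g (\<Sum>b\<in>?B. x b *\<^sub>R b)) \<in> borel_measurable (\<Pi>\<^sub>M b\<in>insert ?e (?B - {?e}). lborel)"
        unfolding B[symmetric] by measurable
    qed auto
    also have "(\<lambda>x y. g (\<Sum>b\<in>?B. (x(?e := y)) b *\<^sub>R b)) = (\<lambda>x y. g (y *\<^sub>R ?e + (\<Sum>b\<in>?B - {?e}. x b *\<^sub>R b)))"
      by (intro ext arg_cong[where f=g]) (subst sum.remove[OF finite_Basis eB], auto)
    finally show ?thesis .
  qed
  have "(\<integral>\<^sup>+v. f (v + (c * v $ n) *\<^sub>R ?e) \<partial>lborel)
     = (\<integral>\<^sup>+x. \<integral>\<^sup>+y. f (y *\<^sub>R ?e + (\<Sum>b\<in>?B - {?e}. x b *\<^sub>R b)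
          + (c * (y *\<^sub>R ?e + (\<Sum>b\<in>?B - {?e}. x b *\<^sub>R b)) $ n) *\<^sub>R ?e) \<partial>lborel \<partial>(\<Pi>\<^sub>M b\<in>?B - {?e}. lborel))"
    by (rule coord) measurable
  also have "\<dots> = (\<integral>\<^sup>+x. \<integral>\<^sup>+y. f (y *\<^sub>R ?e + (\<Sum>b\<in>?B - {?e}. x b *\<^sub>R b)) \<partial>lborel \<partial>(\<Pi>\<^sub>M b\<in>?B - {?e}. lborel))"
  proof (rule nn_integral_cong)
    fix x :: "real^'n \<Rightarrow> real"
    define R where "R = (\<Sum>b\<in>?B - {?e}. x b *\<^sub>R b)"
    have "y *\<^sub>R ?e + R + (c * (y *\<^sub>R ?e + R) $ n) *\<^sub>R ?e = (c * R $ n + 1 * y) *\<^sub>R ?e + R" for y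
      using mn by (simp add: axis_def scaleR_add_left algebra_simps)
    then have "(\<integral>\<^sup>+y. f (y *\<^sub>R ?e + R + (c * (y *\<^sub>R ?e + R) $ n) *\<^sub>R ?e) \<partial>lborel)
      = (\<integral>\<^sup>+y. f ((c * R $ n + 1 * y) *\<^sub>R ?e + R) \<partial>lborel)" by (simp only:)
    also have "\<dots> = (\<integral>\<^sup>+y. f (y *\<^sub>R ?e + R) \<partial>lborel)"
      by (subst nn_integral_real_affine[of "\<lambda>y. f (y *\<^sub>R ?e + R)" 1 "c * R $ n"]) simp_all
    finally show "(\<integral>\<^sup>+y. f (y *\<^sub>R ?e + R + (c * (y *\<^sub>R ?e + R) $ n) *\<^sub>R ?e) \<partial>lborel)
      = (\<integral>\<^sup>+y. f (y *\<^sub>R ?e + R) \<partial>lborel)" .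
  qed
  also have "\<dots> = (\<integral>\<^sup>+v. f v \<partial>lborel)" by (rule coord[symmetric]) measurable
  finally show ?thesis .
qed

text \<open>The library has linear changes of variables for well-ordered index types only.\<close>

theorem nn_integral_lborel_linear:
  fixes A :: "real^'n^'n" and f :: "real^'n \<Rightarrow> ennreal"
  assumes "det A \<noteq> 0" "f \<in> borel_measurable borel"
  shows "ennreal \<bar>det A\<bar> * (\<integral>\<^sup>+v. f (A *v v) \<partial>lborel) = (\<integral>\<^sup>+v. f v \<partial>lborel)"
  using assms
\<comment> \<open>The identity passes to products because the determinant is multiplicative.
  Elementary matrices remain, and those with a zero row are excluded by the determinant
  condition.\<close>
proof (induction A arbitrary: f rule: induct_matrix_elementary)
  case (1 A B)
  then have A: "det A \<noteq> 0" and B: "det B \<noteq> 0" by (auto simp: det_mul)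
  note [measurable] = 1(4)
  have "ennreal \<bar>det (A ** B)\<bar> * (\<integral>\<^sup>+v. f ((A ** B) *v v) \<partial>lborel)
      = ennreal \<bar>det A\<bar> * (ennreal \<bar>det B\<bar> * (\<integral>\<^sup>+v. f (A *v (B *v v)) \<partial>lborel))"
    by (simp add: det_mul abs_mult ennreal_mult matrix_vector_mul_assoc mult.assoc)
  also have "\<dots> = ennreal \<bar>det A\<bar> * (\<integral>\<^sup>+v. f (A *v v) \<partial>lborel)"
    by (subst 1(2)[OF B]) simp_all
  also have "\<dots> = (\<integral>\<^sup>+v. f v \<partial>lborel)" by (rule 1(1)[OF A 1(4)])
  finally show ?case .
next
  case (2 A i)
  then show ?case by (simp add: det_zero_row)
next
  case (3 A)
  then show ?case by (intro nn_integral_lborel_diagonal)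
next
  case (4 m n)
  let ?p = "Transposition.transpose m n"
  have p: "?p permutes UNIV" by (rule permutes_swap_id) auto
  have "((\<chi> i j. mat 1 $ i $ ?p j) :: real^'n^'n) *v v = (\<chi> i. v $ ?p i)" for v
  proof -
    have "(\<Sum>j\<in>UNIV. (if i = ?p j then 1 else 0) * v $ j) = v $ ?p i" for i
    proof -
      have "(\<Sum>j\<in>UNIV. (if i = ?p j then 1 else 0) * v $ j) = (\<Sum>j\<in>UNIV. if j = ?p i then v $ j else 0)"
        by (intro sum.cong) (auto simp: Transposition.transpose_def)
      then show ?thesis by simp
    qed
    then show ?thesis by (simp add: matrix_vector_mult_def mat_def vec_eq_iff)
  qed
  moreover have "\<bar>det ((\<chi> i j. mat 1 $ i $ ?p j) :: real^'n^'n)\<bar> = 1"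
    using det_permute_columns[OF p, of "mat 1 :: real^'n^'n"] by (simp add: abs_mult sign_def)
  ultimately show ?case using nn_integral_lborel_permute[OF p 4(3)] by simp
next
  case (5 m n c)
  let ?S = "(\<chi> i j. if i = m \<and> j = n then c else of_bool (i = j)) :: real^'n^'n"
  have "?S *v v = v + (c * v $ n) *\<^sub>R axis m 1" for v
  proof -
    have "(\<Sum>j\<in>UNIV. (if i = m \<and> j = n then c else of_bool (i = j)) * v $ j) = v $ i + (if i = m then c * v $ n else 0)" for i
    proof -
      have "(\<Sum>j\<in>UNIV. (if i = m \<and> j = n then c else of_bool (i = j)) * v $ j)
        = (\<Sum>j\<in>UNIV. (if j = i then v $ j else 0) + (if j = n then (if i = m then c * v $ j else 0) else 0))"
        using 5(1) by (intro sum.cong) auto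
      then show ?thesis by (simp add: sum.distrib)
    qed
    then show ?thesis by (simp add: matrix_vector_mult_def vec_eq_iff axis_def)
  qed
  moreover have "det ?S = 1"
  proof -
    have "?S = (\<chi> k. if k = m then row m (mat 1) + c *s row n (mat 1) else row k (mat 1))"
      using 5(1) by (auto simp: vec_eq_iff row_def mat_def)
    then show ?thesis using det_row_operation[OF 5(1), of "mat 1" c] by simp
  qed
  ultimately show ?case using nn_integral_lborel_shear[OF 5(1) 5(3), of c] by simp
qed

section \<open>The multivariate normal law\<close>

lemma
  fixes A :: "real^'k^'k"
  assumes "invertible A"
  shows matrix_inv_left: "matrix_inv A ** A = mat 1"
    and matrix_inv_right: "A ** matrix_inv A = mat 1"
  using someI_ex[OF assms[unfolded invertible_def]] by (auto simp: matrix_inv_def)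

lemma inner_transpose_matrix_vector:
  fixes B :: "real^'n^'m"
  shows "x \<bullet> (transpose B *v y) = (B *v x) \<bullet> y"
  by (simp only: dot_lmul_matrix[symmetric] vector_transpose_matrix)

text \<open>Gram-Schmidt for the inner product given by \<open>\<Omega>\<close>. As long as m is
  below the dimension, the m vectors \<open>\<Omega> *v b i\<close> do not span the space, and a
  nonzero vector orthogonal to them can be normalised and added.\<close>

lemma pos_def_orthonormal_family:
  fixes \<Omega> :: "real^'k^'k"
  assumes \<Omega>: "pos_def \<Omega>" and m: "m \<le> CARD('k)"
  shows "\<exists>b::nat \<Rightarrow> real^'k. \<forall>i<m. \<forall>j<m. b i \<bullet> (\<Omega> *v b j) = (if i = j then 1 else 0)"
  using m
proof (induction m)
  case (Suc m)
  have sym: "u \<bullet> (\<Omega> *v v) = v \<bullet> (\<Omega> *v u)" for u v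
    using \<Omega> by (metis dot_lmul_matrix inner_commute pos_def_def vector_transpose_matrix)
  obtain b where b: "\<forall>i<m. \<forall>j<m. b i \<bullet> (\<Omega> *v b j) = (if i = j then 1 else 0)"
    using Suc by auto
  define S where "S = (\<lambda>i. \<Omega> *v b i) ` {..<m}"
  have "dim S \<le> card S" by (rule dim_le_card') (simp add: S_def)
  also have "\<dots> \<le> m" unfolding S_def using card_image_le[of "{..<m}" "\<lambda>i. \<Omega> *v b i"] by simp
  also have "m < DIM(real^'k)" using Suc.prems by simp
  finally obtain v where v: "v \<noteq> 0" "\<And>y. y \<in> span S \<Longrightarrow> orthogonal v y"
    using orthogonal_to_subspace_exists by blast
  have vb: "v \<bullet> (\<Omega> *v b i) = 0" if "i < m" for i
    using v(2)[OF span_base, of "\<Omega> *v b i"] that by (auto simp: S_def orthogonal_def)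
  have q: "0 < v \<bullet> (\<Omega> *v v)" using \<Omega> v(1) by (simp add: pos_def_def)
  define w where "w = (1 / sqrt (v \<bullet> (\<Omega> *v v))) *\<^sub>R v"
  have ww: "w \<bullet> (\<Omega> *v w) = 1"
    using q by (simp add: w_def matrix_vector_mult_scaleR)
  have wb: "w \<bullet> (\<Omega> *v b i) = 0" "b i \<bullet> (\<Omega> *v w) = 0" if "i < m" for i
    using vb[OF that] sym[of "b i" w] by (simp_all add: w_def)
  have "\<forall>i<Suc m. \<forall>j<Suc m. (b(m := w)) i \<bullet> (\<Omega> *v (b(m := w)) j) = (if i = j then 1 else 0)"
    using b ww wb by (auto simp: less_Suc_eq)
  then show ?case by blast
qed simp

text \<open>With the \<open>\<Omega>\<close>-orthonormal family as rows of \<open>B\<close>, the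
  product of \<open>B\<close>, \<open>\<Omega>\<close> and the transpose of \<open>B\<close> is the
  identity, so the inverse of \<open>B\<close> is the required factor. It presents the normal law as
  a linear image of the standard one.\<close>

lemma pos_def_factorization:
  fixes \<Omega> :: "real^'k^'k"
  assumes \<Omega>: "pos_def \<Omega>"
  obtains A :: "real^'k^'k" where "invertible A" "A ** transpose A = \<Omega>"
proof -
  obtain b :: "nat \<Rightarrow> real^'k" where
    b: "\<forall>i<CARD('k). \<forall>j<CARD('k). b i \<bullet> (\<Omega> *v b j) = (if i = j then 1 else 0)"
    using pos_def_orthonormal_family[OF \<Omega> order_refl] by blast
  obtain h where h: "bij_betw h (UNIV :: 'k set) {0..<CARD('k)}"
    using ex_bij_betw_finite_nat[of "UNIV :: 'k set"] by auto
  define B :: "real^'k^'k" where "B = (\<chi> i. b (h i))"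
  have hl: "h i < CARD('k)" for i using h by (auto simp: bij_betw_def)
  have hi: "h i = h j \<longleftrightarrow> i = j" for i j using h by (auto simp: bij_betw_def inj_on_def)
  have BB: "B ** (\<Omega> ** transpose B) = mat 1"
  proof -
    have "(B ** (\<Omega> ** transpose B)) $ i $ j = B $ i \<bullet> (\<Omega> *v B $ j)" for i j
      by (simp add: matrix_matrix_mult_def matrix_vector_mult_def transpose_def inner_vec_def)
    then show ?thesis using b hl by (simp add: vec_eq_iff B_def mat_def hi)
  qed
  have invB: "invertible B" and B': "(\<Omega> ** transpose B) ** B = mat 1"
    using BB matrix_left_right_inverse invertible_def by blast+
  define A where "A = matrix_inv B"
  have AB: "A ** B = mat 1" and BA: "B ** A = mat 1"
    using invB by (simp_all add: A_def matrix_inv_left matrix_inv_right)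
  have "\<Omega> ** transpose B = A"
    by (metis BB AB matrix_mul_assoc matrix_mul_lid matrix_mul_rid)
  moreover have "transpose B ** transpose A = mat 1"
    using AB by (metis matrix_transpose_mul transpose_mat)
  ultimately have "A ** transpose A = \<Omega>"
    by (metis matrix_mul_assoc matrix_mul_rid)
  moreover have "invertible A" using AB BA invertible_def by blast
  ultimately show ?thesis by (rule that[rotated])
qed

definition std_gaussian :: "(real^'k) measure" where
  "std_gaussian = density lborel (\<lambda>u. ennreal (\<Prod>b\<in>Basis. std_normal_density (u \<bullet> b)))"

lemma std_gaussian_density_measurable [measurable]:
  "(\<lambda>u::real^'k. \<Prod>b\<in>Basis. std_normal_density (u \<bullet> b)) \<in> borel_measurable borel"
  by measurable

lemma sets_std_gaussian [simp, measurable_cong]: "sets std_gaussian = sets borel"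
  and space_std_gaussian [simp]: "space std_gaussian = UNIV"
  by (simp_all add: std_gaussian_def)

lemma prob_space_std_gaussian: "prob_space (std_gaussian :: (real^'k) measure)"
proof
  have "emeasure std_gaussian (space (std_gaussian :: (real^'k) measure))
     = (\<integral>\<^sup>+u. (\<Prod>b\<in>Basis. ennreal (std_normal_density ((u::real^'k) \<bullet> b))) \<partial>lborel)"
    by (simp add: std_gaussian_def emeasure_density prod_ennreal normal_density_nonneg)
  also have "\<dots> = (\<Prod>b\<in>(Basis :: (real^'k) set). \<integral>\<^sup>+x. ennreal (std_normal_density x) \<partial>lborel)"
    by (rule nn_integral_lborel_prod) auto
  also have "(\<integral>\<^sup>+x. ennreal (std_normal_density x) \<partial>lborel) = 1"
    using prob_space.emeasure_space_1[OF prob_space_normal_density[of 1 0]]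
    by (simp add: emeasure_density)
  finally show "emeasure std_gaussian (space (std_gaussian :: (real^'k) measure)) = 1" by simp
qed

lemma integral_lborel_prod:
  fixes f :: "real^'k \<Rightarrow> real \<Rightarrow> complex"
  assumes "\<And>b. b \<in> Basis \<Longrightarrow> integrable lborel (f b)"
  shows "(\<integral>x. (\<Prod>b\<in>Basis. f b (x \<bullet> b)) \<partial>lborel) = (\<Prod>b\<in>Basis. (\<integral>x. f b x \<partial>lborel))"
proof -
  interpret product_sigma_finite "\<lambda>_ :: real^'k. lborel :: real measure" ..
  have [measurable]: "f b \<in> borel_measurable borel" if "b \<in> Basis" for b
    using assms[OF that] by simp
  have "(\<integral>x. (\<Prod>b\<in>Basis. f b (x \<bullet> b)) \<partial>lborel)
     = (\<integral>x. (\<Prod>b\<in>Basis. f b ((\<Sum>c\<in>Basis. x c *\<^sub>R c) \<bullet> b)) \<partial>(\<Pi>\<^sub>M b\<in>Basis. lborel))"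
    by (subst lborel_eq, subst integral_distr) simp_all
  also have "\<dots> = (\<integral>x. (\<Prod>b\<in>Basis. f b (x b)) \<partial>(\<Pi>\<^sub>M b\<in>Basis. lborel))"
    by (intro Bochner_Integration.integral_cong prod.cong) simp_all
  also have "\<dots> = (\<Prod>b\<in>Basis. (\<integral>x. f b x \<partial>lborel))"
    by (rule product_integral_prod) (use assms in auto)
  finally show ?thesis .
qed

lemma char_std_gaussian:
  "(\<integral>u. iexp (s \<bullet> u) \<partial>std_gaussian) = of_real (exp (- (s \<bullet> s) / 2))" for s :: "real^'k"
proof -
  have one: "(\<integral>x. of_real (std_normal_density x) * iexp (a * x) \<partial>lborel) = of_real (exp (- a\<^sup>2 / 2))" for a
  proof -
    have "(\<integral>x. of_real (std_normal_density x) * iexp (a * x) \<partial>lborel) = char std_normal_distribution a"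
      unfolding char_def by (subst integral_density) (auto simp: scaleR_conv_of_real)
    then show ?thesis by (simp add: char_std_normal_distribution)
  qed
  have int1: "integrable lborel (\<lambda>x. of_real (std_normal_density x) * iexp (a * x))" for a
  proof (rule Bochner_Integration.integrable_bound)
    show "integrable lborel std_normal_density" by simp
  qed (auto simp: norm_mult)
  have "(\<integral>u. iexp (s \<bullet> u) \<partial>std_gaussian)
    = (\<integral>u. of_real (\<Prod>b\<in>Basis. std_normal_density (u \<bullet> b)) * iexp (s \<bullet> u) \<partial>lborel)"
    unfolding std_gaussian_def
    by (subst integral_density) (auto simp: scaleR_conv_of_real intro!: prod_nonneg)
  also have "\<dots> = (\<integral>u. (\<Prod>b\<in>Basis. of_real (std_normal_density (u \<bullet> b)) * iexp ((s \<bullet> b) * (u \<bullet> b))) \<partial>lborel)"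
  proof (rule Bochner_Integration.integral_cong[OF refl])
    fix u :: "real^'k"
    have "iexp (s \<bullet> u) = (\<Prod>b\<in>Basis. iexp ((s \<bullet> b) * (u \<bullet> b)))"
      by (subst euclidean_inner) (simp add: sum_distrib_left exp_sum)
    then show "of_real (\<Prod>b\<in>Basis. std_normal_density (u \<bullet> b)) * iexp (s \<bullet> u)
      = (\<Prod>b\<in>Basis. of_real (std_normal_density (u \<bullet> b)) * iexp ((s \<bullet> b) * (u \<bullet> b)))"
      by (simp only: of_real_prod prod.distrib)
  qed
  also have "\<dots> = (\<Prod>b\<in>Basis. of_real (exp (- (s \<bullet> b)\<^sup>2 / 2)))"
    by (subst integral_lborel_prod[OF int1]) (simp only: one)
  also have "\<dots> = of_real (exp (\<Sum>b\<in>Basis. - (s \<bullet> b)\<^sup>2 / 2))"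
    by (simp add: exp_sum)
  also have "(\<Sum>b\<in>Basis. - (s \<bullet> b)\<^sup>2 / 2) = - (s \<bullet> s) / 2"
    by (subst (2) euclidean_inner) (simp add: sum_negf sum_divide_distrib power2_eq_square)
  finally show ?thesis .
qed

text \<open>The substitution \<open>v = A *v u\<close> turns the quadratic form into
  \<open>u \<bullet> u\<close>, since the inverse of \<open>\<Omega>\<close> is the product of the
  inverse transpose and the inverse of \<open>A\<close>. The Jacobian cancels the square root of
  \<open>det \<Omega>\<close>, which equals \<open>(det A)\<^sup>2\<close>.\<close>

lemma multi_normal_eq_distr:
  fixes A \<Omega> :: "real^'k^'k"
  assumes A: "invertible A" and \<Omega>: "A ** transpose A = \<Omega>"
  shows "multi_normal 0 \<Omega> = distr std_gaussian borel (\<lambda>u. A *v u)"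
proof (rule measure_eqI)
  show "sets (multi_normal 0 \<Omega>) = sets (distr std_gaussian borel ((*v) A))"
    by (simp add: multi_normal_def)
  fix S assume "S \<in> sets (multi_normal 0 \<Omega>)"
  then have S [measurable]: "S \<in> sets borel" by (simp add: multi_normal_def)
  define g where "g v = exp (- (v \<bullet> (matrix_inv \<Omega> *v v)) / 2) / sqrt ((2 * pi) ^ CARD('k) * det \<Omega>)" for v
  have g_meas [measurable]: "g \<in> borel_measurable borel"
    unfolding g_def by measurable
  have detA: "det A \<noteq> 0" using A by (simp add: invertible_det_nz)
  have det\<Omega>: "det \<Omega> = (det A)\<^sup>2" unfolding \<Omega>[symmetric] by (simp add: det_mul det_transpose power2_eq_square)
  have inv\<Omega>: "invertible \<Omega>" using detA by (simp add: invertible_det_nz det\<Omega>)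
  have quad: "(A *v u) \<bullet> (matrix_inv \<Omega> *v (A *v u)) = u \<bullet> u" for u
  proof -
    obtain A' where A': "A' ** A = mat 1" "A ** A' = mat 1" using A invertible_def by blast
    have tA: "transpose A ** transpose A' = mat 1" "transpose A' ** transpose A = mat 1"
      using A' by (metis matrix_transpose_mul transpose_mat)+
    have "\<Omega> ** (transpose A' ** A') = mat 1"
      unfolding \<Omega>[symmetric] using A' tA by (metis matrix_mul_assoc matrix_mul_rid)
    then have "matrix_inv \<Omega> = transpose A' ** A'"
      by (metis inv\<Omega> matrix_inv_left matrix_mul_assoc matrix_mul_lid matrix_mul_rid)
    then have "matrix_inv \<Omega> *v (A *v u) = transpose A' *v u"
      using A'(1) by (simp add: matrix_vector_mul_assoc[symmetric]) (simp add: matrix_vector_mul_assoc)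
    then have "(A *v u) \<bullet> (matrix_inv \<Omega> *v (A *v u)) = (A' *v (A *v u)) \<bullet> u"
      by (simp only: inner_transpose_matrix_vector)
    then show ?thesis using A'(1) by (simp add: matrix_vector_mul_assoc)
  qed
  have dens: "\<bar>det A\<bar> * g (A *v u) = (\<Prod>b\<in>Basis. std_normal_density (u \<bullet> b))" for u
  proof -
    have "(\<Prod>b\<in>Basis. std_normal_density (u \<bullet> b)) = (1 / sqrt (2 * pi)) ^ CARD('k) * exp (\<Sum>b\<in>Basis. - (u \<bullet> b)\<^sup>2 / 2)"
      unfolding std_normal_density_def prod.distrib prod_constant by (simp add: exp_sum)
    also have "(\<Sum>b\<in>Basis. - (u \<bullet> b)\<^sup>2 / 2) = - (u \<bullet> u) / 2"
      by (subst (2) euclidean_inner) (simp add: sum_negf sum_divide_distrib power2_eq_square)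
    also have "(1 / sqrt (2 * pi)) ^ CARD('k) = 1 / sqrt ((2 * pi) ^ CARD('k))"
      by (simp only: power_divide real_sqrt_power power_one)
    finally show ?thesis
      using detA by (simp add: g_def quad det\<Omega> real_sqrt_mult)
  qed
  have "emeasure (multi_normal 0 \<Omega>) S = (\<integral>\<^sup>+v. ennreal (g v) * indicator S v \<partial>lborel)"
    by (simp add: multi_normal_def emeasure_density g_def)
  also have "\<dots> = ennreal \<bar>det A\<bar> * (\<integral>\<^sup>+u. ennreal (g (A *v u)) * indicator S (A *v u) \<partial>lborel)"
    by (rule nn_integral_lborel_linear[OF detA, symmetric]) measurable
  also have "\<dots> = (\<integral>\<^sup>+u. ennreal (\<Prod>b\<in>Basis. std_normal_density (u \<bullet> b)) * indicator S (A *v u) \<partial>lborel)"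
    by (subst nn_integral_cmult[symmetric]) (simp_all add: mult.assoc[symmetric] ennreal_mult'[symmetric] dens)
  also have "\<dots> = emeasure (distr std_gaussian borel ((*v) A)) S"
  proof -
    have [measurable]: "(*v) A -` S \<in> sets borel"
      using measurable_sets[OF borel_measurable_matrix_vector_mult S, of A] by simp
    have "emeasure (distr std_gaussian borel ((*v) A)) S = emeasure std_gaussian ((*v) A -` S)"
      by (subst emeasure_distr) simp_all
    also have "\<dots> = (\<integral>\<^sup>+u. ennreal (\<Prod>b\<in>Basis. std_normal_density (u \<bullet> b)) * indicator ((*v) A -` S) u \<partial>lborel)"
      unfolding std_gaussian_def by (rule emeasure_density) simp_all
    finally show ?thesis by (simp only: indicator_vimage comp_def)
  qed
  finally show "emeasure (multi_normal 0 \<Omega>) S = emeasure (distr std_gaussian borel ((*v) A)) S" .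
qed

theorem multi_normal_char:
  fixes \<Omega> :: "real^'k^'k"
  assumes \<Omega>: "pos_def \<Omega>"
  shows "prob_space (multi_normal 0 \<Omega>)"
    and "(\<integral>v. iexp (t \<bullet> v) \<partial>multi_normal 0 \<Omega>) = of_real (exp (- (t \<bullet> (\<Omega> *v t)) / 2))"
proof -
  obtain A :: "real^'k^'k" where A: "invertible A" "A ** transpose A = \<Omega>"
    using pos_def_factorization[OF \<Omega>] .
  note eq = multi_normal_eq_distr[OF A]
  have [measurable]: "(\<lambda>u. A *v u) \<in> std_gaussian \<rightarrow>\<^sub>M borel" by measurable
  show "prob_space (multi_normal 0 \<Omega>)"
    unfolding eq by (rule prob_space.prob_space_distr[OF prob_space_std_gaussian]) measurable
  have adj: "t \<bullet> (A *v u) = (transpose A *v t) \<bullet> u" for u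
    using inner_transpose_matrix_vector[of t "transpose A" u] by (simp add: transpose_transpose)
  have "(\<integral>v. iexp (t \<bullet> v) \<partial>multi_normal 0 \<Omega>) = (\<integral>u. iexp (t \<bullet> (A *v u)) \<partial>std_gaussian)"
    unfolding eq by (subst integral_distr) auto
  also have "\<dots> = of_real (exp (- ((transpose A *v t) \<bullet> (transpose A *v t)) / 2))"
    unfolding adj by (rule char_std_gaussian)
  also have "(transpose A *v t) \<bullet> (transpose A *v t) = t \<bullet> (\<Omega> *v t)"
    unfolding adj[symmetric] A(2)[symmetric] by (simp only: matrix_vector_mul_assoc)
  finally show "(\<integral>v. iexp (t \<bullet> v) \<partial>multi_normal 0 \<Omega>) = of_real (exp (- (t \<bullet> (\<Omega> *v t)) / 2))" .
qed

section \<open>Path spaces of stationary processes\<close>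

text \<open>Stolz-Cesaro with denominators n: the increments are off by less than r/2 from some
  index on, and the earlier ones contribute the bounded amount \<open>C\<close>.\<close>

lemma cesaro_differences:
  fixes a :: "nat \<Rightarrow> real"
  assumes d: "(\<lambda>n. a (Suc n) - a n) \<longlonglongrightarrow> s" and a0: "a 0 = 0"
  shows "(\<lambda>n. a n / real n) \<longlonglongrightarrow> s"
proof (rule LIMSEQ_I)
  fix r :: real assume r: "r > 0"
  define e where "e n = a (Suc n) - a n - s" for n
  have "e \<longlonglongrightarrow> 0" unfolding e_def using d by (rule LIM_zero)
  then obtain m where m: "\<And>n. n \<ge> m \<Longrightarrow> \<bar>e n\<bar> < r / 2"
    using r LIMSEQ_D[of e 0 "r / 2"] by auto
  have a_eq: "a n = real n * s + (\<Sum>k<n. e k)" for n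
    by (induction n) (simp_all add: a0 e_def algebra_simps)
  define C where "C = (\<Sum>k<m. \<bar>e k\<bar>)"
  have C0: "C \<ge> 0" unfolding C_def by (rule sum_nonneg) simp
  have e_sum: "\<bar>\<Sum>k<n. e k\<bar> \<le> C + real n * (r / 2)" for n
  proof -
    have "\<bar>\<Sum>k<n. e k\<bar> \<le> (\<Sum>k<n. \<bar>e k\<bar>)" by (rule sum_abs)
    also have "\<dots> \<le> (\<Sum>k<n. (if k < m then \<bar>e k\<bar> else 0) + r / 2)"
      using m r by (intro sum_mono) (auto simp: not_less less_imp_le)
    also have "\<dots> = (\<Sum>k\<in>{..<n} \<inter> {..<m}. \<bar>e k\<bar>) + real n * (r / 2)"
    proof -
      have "(\<Sum>k<n. if k < m then \<bar>e k\<bar> else 0) = (\<Sum>k\<in>{..<n} \<inter> {..<m}. \<bar>e k\<bar>)"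
        by (simp add: sum.inter_restrict)
      then show ?thesis by (simp add: sum.distrib)
    qed
    also have "(\<Sum>k\<in>{..<n} \<inter> {..<m}. \<bar>e k\<bar>) \<le> C"
      unfolding C_def by (rule sum_mono2) auto
    finally show ?thesis by simp
  qed
  obtain N where N: "real N > 2 * C / r" using reals_Archimedean2 by blast
  have "norm (a n / real n - s) < r" if n: "n \<ge> Suc N" for n
  proof -
    have n0: "real n > 0" using n by simp
    have "2 * C / r < real n" using N n by linarith
    then have C: "C < real n * (r / 2)" using r by (simp add: field_simps)
    have "a n / real n - s = (\<Sum>k<n. e k) / real n" using n0 by (simp add: a_eq field_simps)
    then have "norm (a n / real n - s) = \<bar>\<Sum>k<n. e k\<bar> / real n" by simp
    also have "\<dots> < r" using e_sum[of n] C n0 by (simp add: divide_less_eq) (simp add: mult.commute)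
    finally show ?thesis .
  qed
  then show "\<exists>no. \<forall>n\<ge>no. norm (a n / real n - s) < r" by blast
qed

text \<open>Enlarging the square of index pairs by one row and one column adds each of the lags -n,
  ..., n exactly once. The increments of the double sum are therefore the symmetric partial sums of
  the series.\<close>

lemma cesaro_autocovariances:
  fixes \<gamma> :: "int \<Rightarrow> real"
  assumes s: "(\<gamma> has_sum s) UNIV"
  shows "(\<lambda>n. (\<Sum>i<n. \<Sum>j<n. \<gamma> (int i - int j)) / real n) \<longlonglongrightarrow> s"
proof (rule cesaro_differences)
  have "filterlim (\<lambda>n. {- int n..int n}) (finite_subsets_at_top UNIV) sequentially"
    unfolding filterlim_finite_subsets_at_top
  proof (intro allI impI)
    fix A :: "int set" assume A: "finite A \<and> A \<subseteq> UNIV"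
    define m where "m = nat (Max (insert 0 (abs ` A)))"
    have "A \<subseteq> {- int n..int n}" if "n \<ge> m" for n
    proof
      fix x assume "x \<in> A"
      then have "\<bar>x\<bar> \<le> Max (insert 0 (abs ` A))" using A by (intro Max_ge) auto
      then have "\<bar>x\<bar> \<le> int n" using that by (simp add: m_def)
      then show "x \<in> {- int n..int n}" by auto
    qed
    then show "\<forall>\<^sub>F n in sequentially. finite {- int n..int n} \<and> A \<subseteq> {- int n..int n} \<and> {- int n..int n} \<subseteq> UNIV"
      by (auto simp: eventually_sequentially)
  qed
  from filterlim_compose[OF s[unfolded has_sum_def] this]
  have lim: "(\<lambda>n. sum \<gamma> {- int n..int n}) \<longlonglongrightarrow> s" .
  have "(\<Sum>i<Suc n. \<Sum>j<Suc n. \<gamma> (int i - int j)) - (\<Sum>i<n. \<Sum>j<n. \<gamma> (int i - int j)) = sum \<gamma> {- int n..int n}" for n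
  proof -
    have 1: "(\<Sum>i<n. \<gamma> (int i - int n)) = sum \<gamma> {- int n..<0}"
      by (rule sum.reindex_bij_witness[of _ "\<lambda>k. nat (k + int n)" "\<lambda>i. int i - int n"]) auto
    have 2: "(\<Sum>j<n. \<gamma> (int n - int j)) = sum \<gamma> {0<..int n}"
      by (rule sum.reindex_bij_witness[of _ "\<lambda>k. nat (int n - k)" "\<lambda>j. int n - int j"]) auto
    have "sum \<gamma> ({- int n..<0} \<union> {0<..int n}) = sum \<gamma> {- int n..<0} + sum \<gamma> {0<..int n}"
      by (rule sum.union_disjoint) auto
    moreover have "{- int n..int n} = insert 0 ({- int n..<0} \<union> {0<..int n})" by auto
    ultimately have "sum \<gamma> {- int n..int n} = sum \<gamma> {- int n..<0} + sum \<gamma> {0<..int n} + \<gamma> 0"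
      by simp
    then show ?thesis using 1 2 by (simp add: sum.distrib)
  qed
  with lim show "(\<lambda>n. (\<Sum>i<Suc n. \<Sum>j<Suc n. \<gamma> (int i - int j)) - (\<Sum>i<n. \<Sum>j<n. \<gamma> (int i - int j))) \<longlonglongrightarrow> s"
    by (simp only:)
qed simp

lemma (in prob_space) AE_tendsto_imp_tendsto_in_prob:
  fixes f :: "nat \<Rightarrow> 'a \<Rightarrow> real"
  assumes f [measurable]: "\<And>n. f n \<in> borel_measurable M"
    and lim: "AE x in M. (\<lambda>n. f n x) \<longlonglongrightarrow> 0" and e: "e > 0"
  shows "(\<lambda>n. prob {x \<in> space M. f n x > e}) \<longlonglongrightarrow> 0"
proof -
  have "(\<lambda>n. \<integral>x. indicator {x \<in> space M. f n x > e} x \<partial>M) \<longlonglongrightarrow> (\<integral>x. (0::real) \<partial>M)"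
  proof (rule integral_dominated_convergence[where w="\<lambda>_. 1"])
    show "AE x in M. (\<lambda>n. indicator {x \<in> space M. f n x > e} x :: real) \<longlonglongrightarrow> 0"
      using lim
    proof eventually_elim
      case (elim x)
      from order_tendstoD(2)[OF elim e]
      have "\<forall>\<^sub>F n in sequentially. indicator {x \<in> space M. f n x > e} x = (0::real)"
        by eventually_elim auto
      then show ?case by (rule tendsto_eventually)
    qed
  qed (auto simp: indicator_def)
  then show ?thesis by simp
qed

section \<open>The shift on path space and the past of a coordinate function\<close>

definition path_shift :: "int \<Rightarrow> (int \<Rightarrow> 'b) \<Rightarrow> int \<Rightarrow> 'b" where
  "path_shift k p = (\<lambda>\<tau>. p (\<tau> + k))"

lemma path_shift_measurable: "path_shift k \<in> (\<Pi>\<^sub>M \<tau>\<in>UNIV. borel) \<rightarrow>\<^sub>M (\<Pi>\<^sub>M \<tau>\<in>UNIV. borel)"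
  unfolding path_shift_def by (intro measurable_abs_UNIV measurable_component_singleton) simp

lemma path_measurable:
  assumes "\<And>\<tau>. Z \<tau> \<in> borel_measurable N"
  shows "(\<lambda>\<omega> \<tau>. Z \<tau> \<omega>) \<in> N \<rightarrow>\<^sub>M (\<Pi>\<^sub>M \<tau>\<in>UNIV. borel)"
  using assms by (rule measurable_abs_UNIV)

lemma sets_path_law [simp, measurable_cong]: "sets (path_law N Z) = sets (\<Pi>\<^sub>M \<tau>\<in>UNIV. borel)"
  and space_path_law [simp]: "space (path_law N Z) = UNIV"
  by (simp_all add: path_law_def space_PiM)

lemma ergodic_flow_path_law:
  assumes "ergodic_stationary N Z"
  shows "ergodic_flow (path_law N Z) path_shift"
proof -
  let ?P = "path_law N Z"
  have N: "prob_space N" and Z: "\<And>\<tau>. Z \<tau> \<in> borel_measurable N"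
    and st: "path_law N (\<lambda>\<tau>. Z (\<tau> + 1)) = ?P"
    and erg: "\<And>A. A \<in> sets (\<Pi>\<^sub>M \<tau>\<in>UNIV. borel) \<Longrightarrow> (\<lambda>p (\<tau>::int). p (\<tau> + 1)) -` A = A \<Longrightarrow> measure ?P A \<in> {0, 1}"
    using assms unfolding ergodic_stationary_def by auto
  have sm [measurable]: "path_shift k \<in> ?P \<rightarrow>\<^sub>M ?P" for k
    using path_shift_measurable by (simp add: measurable_cong_sets[OF sets_path_law sets_path_law])
  have one: "distr ?P ?P (path_shift 1) = ?P"
  proof -
    have "distr ?P ?P (path_shift 1) = distr ?P (\<Pi>\<^sub>M \<tau>\<in>UNIV. borel) (path_shift 1)"
      by (rule distr_cong) simp_all
    also have "\<dots> = distr N (\<Pi>\<^sub>M \<tau>\<in>UNIV. borel) (path_shift 1 \<circ> (\<lambda>\<omega> \<tau>. Z \<tau> \<omega>))"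
      unfolding path_law_def by (rule distr_distr[OF path_shift_measurable path_measurable[OF Z]])
    also have "\<dots> = ?P" unfolding st[symmetric] by (simp add: path_law_def path_shift_def comp_def)
    finally show ?thesis .
  qed
  have add: "path_shift i \<circ> path_shift j = path_shift (i + j)" for i j :: int
    by (simp add: path_shift_def fun_eq_iff algebra_simps)
  have nat: "distr ?P ?P (path_shift (int n)) = ?P" for n
  proof (induction n)
    case 0
    have "distr ?P ?P (path_shift 0) = distr ?P ?P (\<lambda>p. p)"
      by (rule arg_cong[where f="distr ?P ?P"]) (simp add: path_shift_def fun_eq_iff)
    then show ?case by simp
  next
    case (Suc n)
    have "distr ?P ?P (path_shift (int (Suc n))) = distr ?P ?P (path_shift 1 \<circ> path_shift (int n))" by (simp add: add)
    also have "\<dots> = distr (distr ?P ?P (path_shift (int n))) ?P (path_shift 1)" by (rule distr_distr[symmetric]) measurable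
    finally show ?case using Suc one by simp
  qed
  show ?thesis
  proof (rule ergodic_flow.intro, goal_cases)
    case 1
    show ?case unfolding path_law_def by (rule prob_space.prob_space_distr[OF N path_measurable[OF Z]])
  next
    case 2
    show ?case
    proof (rule ergodic_flow_axioms.intro)
      show "path_shift k \<in> ?P \<rightarrow>\<^sub>M ?P" for k by (rule sm)
      show "path_shift 0 p = p" for p :: "int \<Rightarrow> 'b" by (simp add: path_shift_def)
      show "path_shift i (path_shift j p) = path_shift (i + j) p" for i j and p :: "int \<Rightarrow> 'b"
        by (simp add: path_shift_def fun_eq_iff algebra_simps)
      show "distr ?P ?P (path_shift k) = ?P" for k
      proof (cases "k \<ge> 0")
        case True
        then show ?thesis using nat[of "nat k"] by simp
      next
        case False
        \<comment> \<open>For negative k the shift by -k is already known to preserve the law.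
          Composing it with the shift by k gives the identity, so the latter preserves the law
          too.\<close>
        have "?P = distr (distr ?P ?P (path_shift (- k))) ?P (path_shift k)"
        proof -
          have "distr (distr ?P ?P (path_shift (- k))) ?P (path_shift k) = distr ?P ?P (path_shift k \<circ> path_shift (- k))"
            by (rule distr_distr) measurable
          also have "path_shift k \<circ> path_shift (- k) = (\<lambda>p. p)" by (simp add: path_shift_def fun_eq_iff)
          finally show ?thesis by simp
        qed
        then show ?thesis using nat[of "nat (- k)"] False by simp
      qed
      show "measure ?P A = 0 \<or> measure ?P A = 1"
        if "A \<in> sets ?P" "path_shift 1 -` A \<inter> space ?P = A" for A
        using erg[of A] that unfolding path_shift_def[abs_def] by auto
    qed
  qed
qed

lemma subalgebra_vimage_algebra:
  assumes f: "f \<in> M \<rightarrow>\<^sub>M K"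
  shows "subalgebra M (vimage_algebra (space M) f K)"
  unfolding subalgebra_def using f measurable_space[OF f]
  by (auto simp: sets_vimage_algebra2 measurable_sets)

text \<open>Generated by \<open>G\<close> at the times i, i-1, ..., and not by the full
  observations: the conditional expectations in (A4b) and (A4c) are given past scores. The
  enumeration by naturals matches the one in \<open>past_mean\<close>.\<close>

definition past_algebra :: "('b::topological_space \<Rightarrow> 'c::topological_space) \<Rightarrow> int \<Rightarrow> (int \<Rightarrow> 'b) measure" where
  "past_algebra G i = vimage_algebra UNIV (\<lambda>p (m::nat). G (p (i - int m))) (\<Pi>\<^sub>M m\<in>UNIV. borel)"

lemma past_map_measurable:
  "(\<lambda>p (m::nat). G (p (i - int m))) \<in> past_algebra G i \<rightarrow>\<^sub>M (\<Pi>\<^sub>M m\<in>UNIV. borel)"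
  unfolding past_algebra_def by (rule measurable_vimage_algebra1) (simp add: space_PiM)

lemma past_algebra_component:
  assumes "k \<le> i"
  shows "(\<lambda>p. G (p k)) \<in> borel_measurable (past_algebra G i)"
proof -
  have "(\<lambda>p. (\<lambda>(m::nat). G (p (i - int m))) (nat (i - k))) \<in> borel_measurable (past_algebra G i)"
    by (rule measurable_compose[OF past_map_measurable measurable_component_singleton]) simp
  then show ?thesis using assms by simp
qed

lemma filtered_flow_path_law:
  assumes Z: "ergodic_stationary N Z" and G [measurable]: "G \<in> borel_measurable borel"
  shows "filtered_flow (path_law N Z) path_shift (past_algebra G)"
proof -
  interpret ergodic_flow "path_law N Z" path_shift by (rule ergodic_flow_path_law[OF Z])
  show ?thesis
  proof
    show "subalgebra (path_law N Z) (past_algebra G i)" for i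
    proof -
      have "(\<lambda>p (m::nat). G (p (i - int m))) \<in> path_law N Z \<rightarrow>\<^sub>M (\<Pi>\<^sub>M m\<in>UNIV. borel)"
        by (intro measurable_abs_UNIV) measurable
      from subalgebra_vimage_algebra[OF this] show ?thesis by (simp add: past_algebra_def)
    qed
    show "subalgebra (past_algebra G j) (past_algebra G i)" if "i \<le> j" for i j
    proof -
      have "(\<lambda>p (m::nat). G (p (i - int m))) \<in> past_algebra G j \<rightarrow>\<^sub>M (\<Pi>\<^sub>M m\<in>UNIV. borel)"
        using that by (intro measurable_abs_UNIV past_algebra_component) simp
      from subalgebra_vimage_algebra[OF this] show ?thesis by (simp add: past_algebra_def)
    qed
    show "path_shift k \<in> past_algebra G (i + k) \<rightarrow>\<^sub>M past_algebra G i" for i k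
      unfolding past_algebra_def[of G i]
    proof (rule measurable_vimage_algebra2)
      have "(\<lambda>p (m::nat). G (path_shift k p (i - int m))) = (\<lambda>p m. G (p (i + k - int m)))"
        by (simp add: path_shift_def fun_eq_iff algebra_simps)
      then show "(\<lambda>p (m::nat). G (path_shift k p (i - int m))) \<in> past_algebra G (i + k) \<rightarrow>\<^sub>M (\<Pi>\<^sub>M m\<in>UNIV. borel)"
        using past_map_measurable by (simp only:)
    qed simp
  qed
qed

text \<open>Each set of the generated \<sigma>-algebra on \<open>N\<close> is the preimage under
  \<open>\<Theta>\<close> of one downstairs, and integrals over the two agree by the image measure.
  So the conditional expectation composed with \<open>\<Theta>\<close> has the characterising
  property on \<open>N\<close>.\<close>

lemma real_cond_exp_distr:
  assumes N: "prob_space N" and \<Theta>: "\<Theta> \<in> N \<rightarrow>\<^sub>M S" and \<phi>: "\<phi> \<in> S \<rightarrow>\<^sub>M K"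
    and h: "integrable (distr N S \<Theta>) h"
  shows "AE \<omega> in N. real_cond_exp N (vimage_algebra (space N) (\<lambda>\<omega>. \<phi> (\<Theta> \<omega>)) K) (\<lambda>\<omega>. h (\<Theta> \<omega>)) \<omega>
    = real_cond_exp (distr N S \<Theta>) (vimage_algebra (space S) \<phi> K) h (\<Theta> \<omega>)"
proof -
  let ?P = "distr N S \<Theta>"
  let ?F = "vimage_algebra (space S) \<phi> K"
  let ?FN = "vimage_algebra (space N) (\<lambda>\<omega>. \<phi> (\<Theta> \<omega>)) K"
  interpret N: prob_space N by fact
  interpret P: prob_space ?P by (rule N.prob_space_distr[OF \<Theta>])
  have \<phi>\<Theta>: "(\<lambda>\<omega>. \<phi> (\<Theta> \<omega>)) \<in> N \<rightarrow>\<^sub>M K" using measurable_compose[OF \<Theta> \<phi>] .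
  interpret FN: finite_measure_subalgebra N ?FN
    by unfold_locales (rule subalgebra_vimage_algebra[OF \<phi>\<Theta>])
  have "subalgebra ?P ?F"
    using subalgebra_vimage_algebra[OF \<phi>] by (simp add: subalgebra_def)
  then interpret F: finite_measure_subalgebra ?P ?F by unfold_locales
  have gi: "integrable ?P (real_cond_exp ?P ?F h)" using h by (rule F.real_cond_exp_int(1))
  have hm [measurable]: "h \<in> borel_measurable S" using borel_measurable_integrable[OF h] by simp
  have gm [measurable]: "real_cond_exp ?P ?F h \<in> borel_measurable S" using borel_measurable_integrable[OF gi] by simp
  show ?thesis
  proof (rule FN.real_cond_exp_charact)
    show "integrable N (\<lambda>\<omega>. h (\<Theta> \<omega>))" using h \<Theta> hm by (simp add: integrable_distr_eq)
    show "integrable N (\<lambda>\<omega>. real_cond_exp ?P ?F h (\<Theta> \<omega>))" using gi \<Theta> gm by (simp add: integrable_distr_eq)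
    have "\<Theta> \<in> ?FN \<rightarrow>\<^sub>M ?F"
    proof (rule measurable_vimage_algebra2)
      show "\<Theta> \<in> space ?FN \<rightarrow> space S" using measurable_space[OF \<Theta>] by simp
      show "(\<lambda>x. \<phi> (\<Theta> x)) \<in> ?FN \<rightarrow>\<^sub>M K"
        by (rule measurable_vimage_algebra1) (use measurable_space[OF \<phi>\<Theta>] in auto)
    qed
    from measurable_compose[OF this borel_measurable_cond_exp]
    show "(\<lambda>\<omega>. real_cond_exp ?P ?F h (\<Theta> \<omega>)) \<in> borel_measurable ?FN" .
    fix A assume "A \<in> sets ?FN"
    then obtain B where B: "B \<in> sets K" "A = (\<lambda>\<omega>. \<phi> (\<Theta> \<omega>)) -` B \<inter> space N"
      using measurable_space[OF \<phi>\<Theta>] by (subst (asm) sets_vimage_algebra2) auto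
    define C where "C = \<phi> -` B \<inter> space S"
    have C: "C \<in> sets ?F" unfolding C_def by (rule in_vimage_algebra[OF B(1)])
    have CS [measurable]: "C \<in> sets S" unfolding C_def by (rule measurable_sets[OF \<phi> B(1)])
    have ind: "indicator A \<omega> = (indicator C (\<Theta> \<omega>) :: real)" if "\<omega> \<in> space N" for \<omega>
      using that measurable_space[OF \<Theta>] by (auto simp: B(2) C_def indicator_def)
    have tr: "(\<integral>\<omega>\<in>A. f (\<Theta> \<omega>) \<partial>N) = (\<integral>p\<in>C. f p \<partial>?P)" if [measurable]: "f \<in> borel_measurable S" for f :: "_ \<Rightarrow> real"
    proof -
      have "(\<integral>\<omega>\<in>A. f (\<Theta> \<omega>) \<partial>N) = (\<integral>\<omega>. indicator C (\<Theta> \<omega>) *\<^sub>R f (\<Theta> \<omega>) \<partial>N)"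
        unfolding set_lebesgue_integral_def by (intro Bochner_Integration.integral_cong) (simp_all add: ind)
      also have "\<dots> = (\<integral>p\<in>C. f p \<partial>?P)"
        unfolding set_lebesgue_integral_def by (rule integral_distr[OF \<Theta>, symmetric]) measurable
      finally show ?thesis .
    qed
    show "(\<integral>\<omega>\<in>A. h (\<Theta> \<omega>) \<partial>N) = (\<integral>\<omega>\<in>A. real_cond_exp ?P ?F h (\<Theta> \<omega>) \<partial>N)"
      unfolding tr[OF hm] tr[OF gm] by (rule F.real_cond_exp_intA[OF h C])
  qed
qed

section \<open>The score process\<close>

lemma bounded_linear_quadratic_form: "bounded_linear (\<lambda>A::real^'k^'k. c \<bullet> (A *v c))"
proof -
  have "linear (\<lambda>A::real^'k^'k. c \<bullet> (A *v c))"
    by (rule linearI) (simp_all add: matrix_vector_mult_add_rdistrib inner_add_right scaleR_matrix_vector_assoc[symmetric])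
  then show ?thesis by (simp add: linear_conv_bounded_linear)
qed

lemma bounded_linear_matrix_component: "bounded_linear (\<lambda>A::real^'k^'k. A $ a $ b)"
proof -
  have "linear (\<lambda>A::real^'k^'k. A $ a $ b)" by (rule linearI) simp_all
  then show ?thesis by (simp add: linear_conv_bounded_linear)
qed

lemma borel_measurable_vec_nth [measurable (raw)]:
  fixes f :: "'a \<Rightarrow> real^'k"
  assumes "f \<in> borel_measurable M"
  shows "(\<lambda>x. f x $ i) \<in> borel_measurable M"
  using borel_measurable_inner[OF assms borel_measurable_const[of "axis i 1"]] by (simp add: inner_axis)

lemma quadratic_form_outer: "c \<bullet> (outer u v *v c) = (c \<bullet> u) * (c \<bullet> v)"
proof -
  have "outer u v *v c = (v \<bullet> c) *\<^sub>R u"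
    by (simp add: vec_eq_iff outer_def matrix_vector_mult_def inner_vec_def sum_distrib_left sum_distrib_right ac_simps)
  then show ?thesis by (simp add: inner_commute)
qed

locale score_process =
  fixes \<beta> :: "real^'k" and N :: "'v measure" and Y :: "int \<Rightarrow> 'v \<Rightarrow> real" and X :: "int \<Rightarrow> 'v \<Rightarrow> real^'k"
  assumes ergodic: "ergodic_stationary N (\<lambda>\<tau> \<omega>. (Y \<tau> \<omega>, X \<tau> \<omega>))"
begin

abbreviation "Z \<equiv> \<lambda>\<tau> \<omega>. (Y \<tau> \<omega>, X \<tau> \<omega>)"
abbreviation "g \<equiv> score \<beta> Y X"

definition score_fun :: "real \<times> (real^'k) \<Rightarrow> real^'k" where
  "score_fun z = (loglog (fst z) 1 - snd z \<bullet> \<beta>) *\<^sub>R snd z"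

lemma score_fun_measurable [measurable]: "score_fun \<in> borel_measurable borel"
  unfolding score_fun_def loglog_def borel_prod[symmetric] by measurable

lemma score_eq: "g \<tau> \<omega> = score_fun (Z \<tau> \<omega>)"
  by (simp add: score_def resid_def score_fun_def)

sublocale N: prob_space N
  using ergodic by (simp add: ergodic_stationary_def)

lemma Z_measurable [measurable]: "Z \<tau> \<in> borel_measurable N"
  using ergodic by (simp add: ergodic_stationary_def)

lemma X_measurable [measurable]: "X \<tau> \<in> borel_measurable N"
  using measurable_compose[OF Z_measurable[of \<tau>, folded borel_prod] measurable_snd] by simp

lemma g_measurable [measurable]: "g \<tau> \<in> borel_measurable N"
  using measurable_compose[OF Z_measurable score_fun_measurable] by (simp add: score_eq cong: measurable_cong)

abbreviation "P \<equiv> path_law N Z"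

definition sample_path :: "'v \<Rightarrow> int \<Rightarrow> real \<times> (real^'k)" where
  "sample_path \<omega> = (\<lambda>\<tau>. Z \<tau> \<omega>)"

lemma path_meas [measurable]: "sample_path \<in> N \<rightarrow>\<^sub>M (\<Pi>\<^sub>M \<tau>\<in>UNIV. borel)"
  unfolding sample_path_def by (rule path_measurable) measurable

lemma P_eq: "P = distr N (\<Pi>\<^sub>M \<tau>\<in>UNIV. borel) sample_path"
  unfolding path_law_def sample_path_def[abs_def] ..

sublocale P: filtered_flow P path_shift "past_algebra score_fun"
  by (rule filtered_flow_path_law[OF ergodic score_fun_measurable])

lemma integral_P:
  fixes f :: "_ \<Rightarrow> 'b::{banach, second_countable_topology}"
  assumes "f \<in> borel_measurable (\<Pi>\<^sub>M \<tau>\<in>UNIV. borel)"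
  shows "(\<integral>p. f p \<partial>P) = (\<integral>\<omega>. f (sample_path \<omega>) \<partial>N)"
  unfolding P_eq by (rule integral_distr[OF path_meas assms])

lemma integrable_P_iff:
  fixes f :: "_ \<Rightarrow> 'b::{banach, second_countable_topology}"
  assumes "f \<in> borel_measurable (\<Pi>\<^sub>M \<tau>\<in>UNIV. borel)"
  shows "integrable P f \<longleftrightarrow> integrable N (\<lambda>\<omega>. f (sample_path \<omega>))"
  unfolding P_eq by (rule integrable_distr_eq[OF path_meas assms])

lemma AE_P_path: "AE p in P. Q p \<Longrightarrow> AE \<omega> in N. Q (sample_path \<omega>)"
  unfolding P_eq by (rule AE_distrD[OF path_meas])

lemma component_measurable [measurable]: "(\<lambda>p. p \<tau>) \<in> (\<Pi>\<^sub>M \<tau>\<in>UNIV. borel) \<rightarrow>\<^sub>M (borel :: (real \<times> (real^'k)) measure)"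
  by (rule measurable_component_singleton) simp

lemma sum_from_one: "(\<Sum>i<n. f (int i + 1)) = (\<Sum>\<tau>=1..n. f (int \<tau>))" for f :: "int \<Rightarrow> 'b::comm_monoid_add"
proof -
  have "(\<Sum>\<tau>=1..n. f (int \<tau>)) = (\<Sum>i<n. f (int (Suc i)))"
    by (simp add: sum.atLeast1_atMost_eq)
  then show ?thesis by (simp add: add.commute)
qed

lemma ergodic_average:
  assumes f [measurable]: "f \<in> borel_measurable borel" and i: "integrable N (\<lambda>\<omega>. f (Z 1 \<omega>) :: real)"
  shows "AE \<omega> in N. (\<lambda>n. (\<Sum>\<tau>=1..n. f (Z (int \<tau>) \<omega>)) / real n) \<longlonglongrightarrow> (\<integral>\<omega>. f (Z 1 \<omega>) \<partial>N)"
proof -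
  \<comment> \<open>Evaluation at coordinate 1 makes the orbit sum begin with the first
    observation.\<close>
  have m: "(\<lambda>p. f (p 1)) \<in> borel_measurable (\<Pi>\<^sub>M \<tau>\<in>UNIV. borel)" by measurable
  have "integrable P (\<lambda>p. f (p 1))" using i integrable_P_iff[OF m] by (simp add: sample_path_def)
  have "(\<Sum>i<n. f (Z (int i + 1) \<omega>)) = (\<Sum>\<tau>=1..n. f (Z (int \<tau>) \<omega>))" for n \<omega>
    by (rule sum_from_one[of "\<lambda>\<tau>. f (Z \<tau> \<omega>)"])
  then show ?thesis
    using AE_P_path[OF P.birkhoff_AE[OF \<open>integrable P (\<lambda>p. f (p 1))\<close>]]
    unfolding integral_P[OF m] by (simp add: sample_path_def path_shift_def add.commute[of 1])
qed

lemma second_moment_tendsto: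
  assumes A3: "A3 N X \<Sigma>xx" and d: "d > 0"
  shows "(\<lambda>n. measure N {\<omega> \<in> space N. norm ((1 / real n) *\<^sub>R (\<Sum>\<tau>=1..n. outer (X (int \<tau>) \<omega>) (X (int \<tau>) \<omega>)) - \<Sigma>xx) > d}) \<longlonglongrightarrow> 0"
proof (rule N.AE_tendsto_imp_tendsto_in_prob[OF _ _ d])
  have om: "outer (X \<tau> \<omega>) (X \<tau> \<omega>) = (\<chi> a b. X \<tau> \<omega> $ a * X \<tau> \<omega> $ b)" for \<tau> \<omega> by (simp add: outer_def)
  have outer_meas [measurable]: "(\<lambda>\<omega>. outer (X \<tau> \<omega>) (X \<tau> \<omega>)) \<in> borel_measurable N" for \<tau>
    using A3 unfolding A3_def has_bochner_integral_iff by (blast intro: borel_measurable_integrable)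
  show "(\<lambda>\<omega>. norm ((1 / real n) *\<^sub>R (\<Sum>\<tau>=1..n. outer (X (int \<tau>) \<omega>) (X (int \<tau>) \<omega>)) - \<Sigma>xx)) \<in> borel_measurable N" for n
    by measurable
  have "AE \<omega> in N. (\<lambda>n. (\<Sum>\<tau>=1..n. X (int \<tau>) \<omega> $ a * X (int \<tau>) \<omega> $ b) / real n) \<longlonglongrightarrow> \<Sigma>xx $ a $ b" for a b
  proof -
    have "has_bochner_integral N (\<lambda>\<omega>. outer (X 1 \<omega>) (X 1 \<omega>) $ a $ b) (\<Sigma>xx $ a $ b)"
      by (rule has_bochner_integral_bounded_linear[OF bounded_linear_matrix_component]) (use A3 in \<open>auto simp: A3_def\<close>)
    then have i: "integrable N (\<lambda>\<omega>. X 1 \<omega> $ a * X 1 \<omega> $ b)" "(\<integral>\<omega>. X 1 \<omega> $ a * X 1 \<omega> $ b \<partial>N) = \<Sigma>xx $ a $ b"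
      by (simp_all add: om has_bochner_integral_iff)
    have "(\<lambda>z::real \<times> (real^'k). snd z $ a * snd z $ b) \<in> borel_measurable borel"
      unfolding borel_prod[symmetric] by measurable
    from ergodic_average[OF this] i show ?thesis by simp
  qed
  then have "AE \<omega> in N. \<forall>a b. (\<lambda>n. (\<Sum>\<tau>=1..n. X (int \<tau>) \<omega> $ a * X (int \<tau>) \<omega> $ b) / real n) \<longlonglongrightarrow> \<Sigma>xx $ a $ b"
    by (simp add: AE_all_countable)
  then show "AE \<omega> in N. (\<lambda>n. norm ((1 / real n) *\<^sub>R (\<Sum>\<tau>=1..n. outer (X (int \<tau>) \<omega>) (X (int \<tau>) \<omega>)) - \<Sigma>xx)) \<longlonglongrightarrow> 0"
  proof eventually_elim
    case (elim \<omega>)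
    have "(\<lambda>n. (1 / real n) *\<^sub>R (\<Sum>\<tau>=1..n. outer (X (int \<tau>) \<omega>) (X (int \<tau>) \<omega>))) \<longlonglongrightarrow> \<Sigma>xx"
      using elim by (intro vec_tendstoI) (simp add: om)
    then show ?case by (intro tendsto_norm_zero LIM_zero)
  qed
qed

text \<open>The quadratic form of \<open>c\<close> is a bounded linear functional of the matrix and
  commutes with the integral; on an outer product it factors. All vector statements are reduced in
  this way to scalar projections.\<close>

lemma score_covariance:
  assumes A4a: "A4a \<beta> N Y X \<Gamma> V"
  shows "has_bochner_integral N (\<lambda>\<omega>. (c \<bullet> g \<tau> \<omega>) * (c \<bullet> g \<tau>' \<omega>)) (c \<bullet> (\<Gamma> (\<tau> - \<tau>') *v c))"
proof -
  have "has_bochner_integral N (\<lambda>\<omega>. outer (g \<tau> \<omega>) (g (\<tau> - (\<tau> - \<tau>')) \<omega>)) (\<Gamma> (\<tau> - \<tau>'))"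
    using A4a unfolding A4a_def by blast
  from has_bochner_integral_bounded_linear[OF bounded_linear_quadratic_form this]
  show ?thesis by (simp add: quadratic_form_outer)
qed

lemma score_square_integrable:
  assumes A4a: "A4a \<beta> N Y X \<Gamma> V"
  shows "square_integrable N (\<lambda>\<omega>. c \<bullet> g \<tau> \<omega>)"
  using score_covariance[OF A4a, of c \<tau> \<tau>]
  by (auto simp: square_integrable_def has_bochner_integral_iff power2_eq_square)

lemma score_sum_variance:
  assumes A4a: "A4a \<beta> N Y X \<Gamma> V"
  shows "(\<integral>\<omega>. (\<Sum>i<n. c \<bullet> g (int i + k) \<omega>)\<^sup>2 \<partial>N) = (\<Sum>i<n. \<Sum>j<n. c \<bullet> (\<Gamma> (int i - int j) *v c))"
proof -
  have "has_bochner_integral N (\<lambda>\<omega>. \<Sum>i<n. \<Sum>j<n. (c \<bullet> g (int i + k) \<omega>) * (c \<bullet> g (int j + k) \<omega>))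
     (\<Sum>i<n. \<Sum>j<n. c \<bullet> (\<Gamma> (int i + k - (int j + k)) *v c))"
    by (intro has_bochner_integral_sum score_covariance[OF A4a])
  moreover have "(\<Sum>i<n. c \<bullet> g (int i + k) \<omega>)\<^sup>2 = (\<Sum>i<n. \<Sum>j<n. (c \<bullet> g (int i + k) \<omega>) * (c \<bullet> g (int j + k) \<omega>))" for \<omega>
    by (simp add: power2_eq_square sum_product)
  ultimately show ?thesis by (simp add: has_bochner_integral_iff)
qed

lemma score_variance_tendsto:
  assumes A4a: "A4a \<beta> N Y X \<Gamma> V"
  shows "(\<lambda>n. (\<integral>\<omega>. (\<Sum>i<n. c \<bullet> g (int i + k) \<omega>)\<^sup>2 \<partial>N) / real n) \<longlonglongrightarrow> c \<bullet> (V *v c)"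
proof -
  have "(\<Gamma> has_sum V) UNIV" using A4a by (simp add: A4a_def)
  then have "((\<lambda>j. c \<bullet> (\<Gamma> j *v c)) has_sum (c \<bullet> (V *v c))) UNIV"
    using has_sum_bounded_linear[OF bounded_linear_quadratic_form] by (auto simp: o_def)
  from cesaro_autocovariances[OF this] show ?thesis
    unfolding score_sum_variance[OF A4a] .
qed


text \<open>The counterpart on path space of \<open>past_mean\<close> at time 0;
  \<open>past_mean_eq\<close> matches the two almost surely along sample paths.\<close>

definition cond_score :: "nat \<Rightarrow> (int \<Rightarrow> real \<times> (real^'k)) \<Rightarrow> real^'k" where
  "cond_score j p = (\<chi> l. real_cond_exp P (past_algebra score_fun (- int j)) (\<lambda>p. score_fun (p 0) $ l) p)"

lemma cond_score_measurable [measurable]: "cond_score j \<in> borel_measurable (\<Pi>\<^sub>M \<tau>\<in>UNIV. borel)"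
proof -
  have "real_cond_exp P (past_algebra score_fun (- int j)) (\<lambda>p. score_fun (p 0) $ l) \<in> borel_measurable (\<Pi>\<^sub>M \<tau>\<in>UNIV. borel)" for l
    using borel_measurable_cond_exp2[of P "past_algebra score_fun (- int j)" "\<lambda>p. score_fun (p 0) $ l"]
    by (simp add: measurable_cong_sets[OF sets_path_law refl])
  then show ?thesis
    unfolding cond_score_def borel_measurable_euclidean_space[of "\<lambda>p. \<chi> l. _ l p"]
    by (subst borel_measurable_euclidean_space) (auto simp: Basis_vec_def inner_axis)
qed

lemma score_fun_component_measurable [measurable]:
  "(\<lambda>p. score_fun (p \<tau>) $ l) \<in> borel_measurable (\<Pi>\<^sub>M \<tau>\<in>UNIV. borel)"
  by measurable

lemma score_component_square_integrable:
  assumes A4a: "A4a \<beta> N Y X \<Gamma> V"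
  shows "square_integrable P (\<lambda>p. score_fun (p 0) $ l)"
proof -
  have "integrable N (\<lambda>\<omega>. (g 0 \<omega> $ l)\<^sup>2)"
    using square_integrableD(2)[OF score_square_integrable[OF A4a, of "axis l 1" 0]] by (simp add: inner_axis')
  moreover have "(\<lambda>p. (score_fun (p 0) $ l)\<^sup>2) \<in> borel_measurable (\<Pi>\<^sub>M \<tau>\<in>UNIV. borel)" by measurable
  ultimately have "integrable P (\<lambda>p. (score_fun (p 0) $ l)\<^sup>2)"
    by (subst integrable_P_iff) (simp_all add: sample_path_def score_eq)
  then show ?thesis by (simp add: square_integrable_def measurable_cong_sets[OF sets_path_law refl])
qed

lemma past_mean_eq:
  assumes A4a: "A4a \<beta> N Y X \<Gamma> V"
  shows "AE \<omega> in N. past_mean N g 0 j \<omega> = cond_score j (sample_path \<omega>)"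
proof -
  let ?S = "\<Pi>\<^sub>M \<tau>\<in>(UNIV::int set). (borel :: (real \<times> (real^'k)) measure)"
  let ?\<phi> = "\<lambda>(p :: int \<Rightarrow> real \<times> (real^'k)) (m::nat). score_fun (p (- int j - int m))"
  have \<phi>: "?\<phi> \<in> ?S \<rightarrow>\<^sub>M (\<Pi>\<^sub>M m\<in>UNIV. borel)"
    by (intro measurable_abs_UNIV) measurable
  have sp: "space ?S = UNIV" by (simp add: space_PiM)
  have "AE \<omega> in N. real_cond_exp N (vimage_algebra (space N) (\<lambda>\<omega> (i::nat). g (0 - int j - int i) \<omega>) (\<Pi>\<^sub>M i\<in>UNIV. borel)) (\<lambda>\<omega>. g 0 \<omega> $ l) \<omega>
     = real_cond_exp P (past_algebra score_fun (- int j)) (\<lambda>p. score_fun (p 0) $ l) (sample_path \<omega>)" for l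
  proof -
    have "integrable P (\<lambda>p. score_fun (p 0) $ l)"
      by (rule P.square_integrable_integrable[OF score_component_square_integrable[OF A4a]])
    then have "integrable (distr N ?S sample_path) (\<lambda>p. score_fun (p 0) $ l)"
      by (simp only: P_eq)
    from real_cond_exp_distr[OF N.prob_space_axioms path_meas \<phi> this]
    show ?thesis
      unfolding past_algebra_def P_eq[symmetric] sp by (simp add: sample_path_def score_eq)
  qed
  then have "AE \<omega> in N. \<forall>l. real_cond_exp N (vimage_algebra (space N) (\<lambda>\<omega> (i::nat). g (0 - int j - int i) \<omega>) (\<Pi>\<^sub>M i\<in>UNIV. borel)) (\<lambda>\<omega>. g 0 \<omega> $ l) \<omega>
     = real_cond_exp P (past_algebra score_fun (- int j)) (\<lambda>p. score_fun (p 0) $ l) (sample_path \<omega>)"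
    unfolding AE_all_countable by blast
  then show ?thesis
    by eventually_elim (simp add: past_mean_def cond_score_def vec_eq_iff)
qed

lemma cond_exp_projection:
  assumes A4a: "A4a \<beta> N Y X \<Gamma> V"
  shows "AE p in P. real_cond_exp P (past_algebra score_fun (- int j)) (\<lambda>p. c \<bullet> score_fun (p 0)) p = c \<bullet> cond_score j p"
proof -
  let ?F = "past_algebra score_fun (- int j)"
  have i: "integrable P (\<lambda>p. score_fun (p 0) $ l)" for l
    by (rule P.square_integrable_integrable[OF score_component_square_integrable[OF A4a]])
  have 1: "AE p in P. real_cond_exp P ?F (\<lambda>p. \<Sum>l\<in>UNIV. c $ l * score_fun (p 0) $ l) p
     = (\<Sum>l\<in>UNIV. real_cond_exp P ?F (\<lambda>p. c $ l * score_fun (p 0) $ l) p)"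
    using i by (intro P.cond.real_cond_exp_sum) simp
  have 2: "AE p in P. \<forall>l. real_cond_exp P ?F (\<lambda>p. c $ l * score_fun (p 0) $ l) p = c $ l * real_cond_exp P ?F (\<lambda>p. score_fun (p 0) $ l) p"
    unfolding AE_all_countable using i by (intro allI P.cond.real_cond_exp_cmult)
  from 1 2 show ?thesis
    by eventually_elim (simp add: inner_vec_def cond_score_def)
qed

text \<open>Cauchy-Schwarz in Euclidean space: it turns the bounds of (A4b) and (A4c), which concern
  norms of vectors on \<open>N\<close>, into bounds for the projections on \<open>c\<close> on path
  space.\<close>

lemma integral_bounded_by_norm:
  fixes f :: "_ \<Rightarrow> real" and v :: "_ \<Rightarrow> real^'k"
  assumes f [measurable]: "f \<in> borel_measurable P" and v: "v \<in> borel_measurable (\<Pi>\<^sub>M \<tau>\<in>UNIV. borel)"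
    and eq: "AE p in P. f p = c \<bullet> v p"
    and v': "AE \<omega> in N. v' \<omega> = v (sample_path \<omega>)" and v'_meas: "v' \<in> borel_measurable N"
    and i: "integrable N (\<lambda>\<omega>. (norm (v' \<omega>))\<^sup>2)"
  shows "integrable P (\<lambda>p. (f p)\<^sup>2)" "(\<integral>p. (f p)\<^sup>2 \<partial>P) \<le> (norm c)\<^sup>2 * (\<integral>\<omega>. (norm (v' \<omega>))\<^sup>2 \<partial>N)"
proof -
  note v [measurable]
  have vm: "(\<lambda>p. (norm (v p))\<^sup>2) \<in> borel_measurable (\<Pi>\<^sub>M \<tau>\<in>UNIV. borel)" by measurable
  have vs: "(\<lambda>\<omega>. (norm (v (sample_path \<omega>)))\<^sup>2) \<in> borel_measurable N" by measurable
  have "integrable N (\<lambda>\<omega>. (norm (v (sample_path \<omega>)))\<^sup>2)"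
    by (rule integrable_cong_AE_imp[OF i vs]) (use v' in \<open>eventually_elim, simp\<close>)
  then have vi: "integrable P (\<lambda>p. (norm (v p))\<^sup>2)" by (simp add: integrable_P_iff[OF vm])
  have veq: "(\<integral>p. (norm (v p))\<^sup>2 \<partial>P) = (\<integral>\<omega>. (norm (v' \<omega>))\<^sup>2 \<partial>N)"
    unfolding integral_P[OF vm]
  proof (rule integral_cong_AE)
    show "AE \<omega> in N. (norm (v (sample_path \<omega>)))\<^sup>2 = (norm (v' \<omega>))\<^sup>2"
      using v' by eventually_elim simp
  qed (use v'_meas in measurable)
  have le: "AE p in P. (f p)\<^sup>2 \<le> (norm c)\<^sup>2 * (norm (v p))\<^sup>2"
    using eq
  proof eventually_elim
    case (elim p)
    have "\<bar>c \<bullet> v p\<bar>\<^sup>2 \<le> (norm c * norm (v p))\<^sup>2" by (intro power_mono Cauchy_Schwarz_ineq2) simp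
    then show ?case by (simp add: elim power_mult_distrib)
  qed
  show fi: "integrable P (\<lambda>p. (f p)\<^sup>2)"
    by (rule Bochner_Integration.integrable_bound[OF integrable_mult_right[OF vi, of "(norm c)\<^sup>2"]])
      (use le in auto)
  have "(\<integral>p. (f p)\<^sup>2 \<partial>P) \<le> (\<integral>p. (norm c)\<^sup>2 * (norm (v p))\<^sup>2 \<partial>P)"
    by (rule integral_mono_AE[OF fi integrable_mult_right[OF vi] le])
  then show "(\<integral>p. (f p)\<^sup>2 \<partial>P) \<le> (norm c)\<^sup>2 * (\<integral>\<omega>. (norm (v' \<omega>))\<^sup>2 \<partial>N)"
    by (simp add: veq)
qed


lemma past_mean_measurable: "past_mean N g 0 j \<in> borel_measurable N"
  unfolding past_mean_def
  by (subst borel_measurable_euclidean_space) (auto simp: Basis_vec_def inner_axis)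

text \<open>Each projection of the score meets the conditions of \<open>gordin_clt\<close>: its
  conditional means and revisions are at most \<open>norm c\<close> times the vector ones in norm,
  and its limiting variance comes from the autocovariances.\<close>

theorem score_clt:
  assumes A4a: "A4a \<beta> N Y X \<Gamma> V" and A4b: "A4b \<beta> N Y X" and A4c: "A4c \<beta> N Y X"
  shows "(\<lambda>n. \<integral>\<omega>. iexp (t / sqrt (real n) * (\<Sum>\<tau>=1..n. c \<bullet> g (int \<tau>) \<omega>)) \<partial>N)
           \<longlonglongrightarrow> of_real (exp (- (t\<^sup>2 * (c \<bullet> (V *v c)) / 2)))"
proof -
  let ?F = "\<lambda>j::nat. past_algebra score_fun (- int j)"
  define h where "h p = c \<bullet> score_fun (p 0)" for p :: "int \<Rightarrow> real \<times> (real^'k)"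
  have hm [measurable]: "h \<in> borel_measurable (\<Pi>\<^sub>M \<tau>\<in>UNIV. borel)"
    unfolding h_def by measurable
  have h_shift: "h (path_shift k (sample_path \<omega>)) = c \<bullet> g k \<omega>" for k \<omega>
    by (simp add: h_def path_shift_def sample_path_def score_eq)
  have h_F: "h \<in> borel_measurable (past_algebra score_fun 0)"
    unfolding h_def by (intro borel_measurable_inner borel_measurable_const past_algebra_component) simp
  have h_sq: "square_integrable P h"
  proof -
    have "(\<lambda>p. (h p)\<^sup>2) \<in> borel_measurable (\<Pi>\<^sub>M \<tau>\<in>UNIV. borel)" by measurable
    from integrable_P_iff[OF this]
    have "integrable P (\<lambda>p. (h p)\<^sup>2)"
      using square_integrableD(2)[OF score_square_integrable[OF A4a, of c 0]]
      by (simp add: h_def sample_path_def score_eq)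
    then show ?thesis by (simp add: square_integrable_def measurable_cong_sets[OF sets_path_law refl])
  qed
  define p where "p j = real_cond_exp P (?F j) h" for j
  have p_meas [measurable]: "p j \<in> borel_measurable P" for j unfolding p_def by simp
  have p_eq: "AE q in P. p j q = c \<bullet> cond_score j q" for j
    unfolding p_def h_def by (rule cond_exp_projection[OF A4a])
  have mean: "integrable N (\<lambda>\<omega>. (norm (past_mean N g 0 j \<omega>))\<^sup>2)" for j
    using A4b unfolding A4b_def by blast
  have p_bd: "integrable P (\<lambda>q. (p j q)\<^sup>2)"
    "(\<integral>q. (p j q)\<^sup>2 \<partial>P) \<le> (norm c)\<^sup>2 * (\<integral>\<omega>. (norm (past_mean N g 0 j \<omega>))\<^sup>2 \<partial>N)" for j
    using integral_bounded_by_norm[OF p_meas cond_score_measurable p_eq past_mean_eq[OF A4a] past_mean_measurable mean]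
    by blast+
  have p_0: "(\<lambda>j. \<integral>q. (p j q)\<^sup>2 \<partial>P) \<longlonglongrightarrow> 0"
  proof (rule tendsto_sandwich[OF _ _ tendsto_const])
    have "(\<lambda>j. \<integral>\<omega>. (norm (past_mean N g 0 j \<omega>))\<^sup>2 \<partial>N) \<longlonglongrightarrow> 0"
      using A4b unfolding A4b_def by blast
    from tendsto_mult_left[OF this, of "(norm c)\<^sup>2"]
    show "(\<lambda>j. (norm c)\<^sup>2 * (\<integral>\<omega>. (norm (past_mean N g 0 j \<omega>))\<^sup>2 \<partial>N)) \<longlonglongrightarrow> 0" by simp
  qed (use p_bd(2) in auto)
  define R where "R j \<omega> = past_revision N g 0 j \<omega>" for j \<omega>
  have R_int: "integrable N (\<lambda>\<omega>. (norm (R j \<omega>))\<^sup>2)" for j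
    using A4c unfolding A4c_def Let_def R_def by (simp add: power2_norm_eq_inner)
  have R_sum: "summable (\<lambda>j. sqrt (\<integral>\<omega>. (norm (R j \<omega>))\<^sup>2 \<partial>N))"
    using A4c unfolding A4c_def Let_def R_def by (simp add: power2_norm_eq_inner)
  have R_meas: "R j \<in> borel_measurable N" for j
    unfolding R_def past_revision_def using past_mean_measurable by measurable
  have r_le: "L2norm P (\<lambda>q. p j q - p (Suc j) q) \<le> norm c * sqrt (\<integral>\<omega>. (norm (R j \<omega>))\<^sup>2 \<partial>N)" for j
  proof -
    have eq: "AE q in P. p j q - p (Suc j) q = c \<bullet> (cond_score j q - cond_score (Suc j) q)"
      using p_eq[of j] p_eq[of "Suc j"] by eventually_elim (simp add: inner_diff_right)
    have R_eq: "AE \<omega> in N. R j \<omega> = cond_score j (sample_path \<omega>) - cond_score (Suc j) (sample_path \<omega>)"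
      using past_mean_eq[OF A4a, of j] past_mean_eq[OF A4a, of "Suc j"]
      by eventually_elim (simp add: R_def past_revision_def)
    have "(\<integral>q. (p j q - p (Suc j) q)\<^sup>2 \<partial>P) \<le> (norm c)\<^sup>2 * (\<integral>\<omega>. (norm (R j \<omega>))\<^sup>2 \<partial>N)"
      by (rule integral_bounded_by_norm(2)[OF _ _ eq R_eq R_meas R_int]) measurable
    from real_sqrt_le_mono[OF this] show ?thesis by (simp add: L2norm_def real_sqrt_mult)
  qed
  have r_sum: "summable (\<lambda>j. L2norm P (\<lambda>q. p j q - p (Suc j) q))"
    by (rule summable_comparison_test'[OF summable_mult[OF R_sum, of "norm c"], of 0]) (simp add: r_le)
  have var: "(\<lambda>n. (\<integral>q. (\<Sum>i<n. h (path_shift (int i) q))\<^sup>2 \<partial>P) / real n) \<longlonglongrightarrow> c \<bullet> (V *v c)"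
  proof -
    have "(\<lambda>q. (\<Sum>i<n. h (path_shift (int i) q))\<^sup>2) \<in> borel_measurable (\<Pi>\<^sub>M \<tau>\<in>UNIV. borel)" for n
      using measurable_compose[OF path_shift_measurable hm] by measurable
    then have "(\<integral>q. (\<Sum>i<n. h (path_shift (int i) q))\<^sup>2 \<partial>P) = (\<integral>\<omega>. (\<Sum>i<n. c \<bullet> g (int i + 0) \<omega>)\<^sup>2 \<partial>N)" for n
      by (simp add: integral_P h_shift)
    then show ?thesis using score_variance_tendsto[OF A4a, of c 0] by (simp only:)
  qed
  have clt: "(\<lambda>n. \<integral>q. iexp (t / sqrt (real n) * (\<Sum>i<n. h (path_shift (int i) q))) \<partial>P)
      \<longlonglongrightarrow> of_real (exp (- (t\<^sup>2 * (c \<bullet> (V *v c)) / 2)))"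
    by (rule P.gordin_clt[OF h_F h_sq p_bd(1)[unfolded p_def] p_0[unfolded p_def] r_sum[unfolded p_def] var])
  have "(\<integral>q. iexp (t / sqrt (real n) * (\<Sum>i<n. h (path_shift (int i) q))) \<partial>P)
      = (\<integral>\<omega>. iexp (t / sqrt (real n) * (\<Sum>\<tau>=1..n. c \<bullet> g (int \<tau>) \<omega>)) \<partial>N)" for n
  proof -
    let ?f = "\<lambda>q. iexp (t / sqrt (real n) * (\<Sum>i<n. h (path_shift (int i) q)))"
    have fm: "?f \<in> borel_measurable (\<Pi>\<^sub>M \<tau>\<in>UNIV. borel)"
      using measurable_compose[OF path_shift_measurable hm] by measurable
    have fm1: "(\<lambda>q. ?f (path_shift 1 q)) \<in> borel_measurable (\<Pi>\<^sub>M \<tau>\<in>UNIV. borel)"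
      by (rule measurable_compose[OF path_shift_measurable fm])
    \<comment> \<open>The path space theorem sums from time 0, the sample starts at time 1; one
      shift, which preserves the law, bridges the difference.\<close>
    have "(\<integral>q. ?f q \<partial>P) = (\<integral>q. ?f (path_shift 1 q) \<partial>P)"
      using fm by (intro P.integral_flow[symmetric]) (simp only: measurable_cong_sets[OF sets_path_law refl])
    also have "\<dots> = (\<integral>\<omega>. ?f (path_shift 1 (sample_path \<omega>)) \<partial>N)"
      by (rule integral_P[OF fm1])
    also have "\<dots> = (\<integral>\<omega>. iexp (t / sqrt (real n) * (\<Sum>i<n. c \<bullet> g (int i + 1) \<omega>)) \<partial>N)"
      by (simp only: P.flow_add h_shift)
    also have "\<dots> = (\<integral>\<omega>. iexp (t / sqrt (real n) * (\<Sum>\<tau>=1..n. c \<bullet> g (int \<tau>) \<omega>)) \<partial>N)"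
      by (simp only: sum_from_one[of "\<lambda>\<tau>. c \<bullet> g \<tau> _"])
    finally show ?thesis .
  qed
  with clt show ?thesis by (simp only:)
qed

end

section \<open>Solutions of perturbed linear equations\<close>

lemma bounded_bilinear_matrix_vector_mult:
  "bounded_bilinear (\<lambda>(A::real^'n^'m) v. A *v v)"
proof -
  have "bilinear (\<lambda>(A::real^'n^'m) v. A *v v)"
    unfolding bilinear_def
    by (auto intro!: linearI simp: matrix_vector_mult_add_rdistrib matrix_vector_right_distrib
        scaleR_matrix_vector_assoc[symmetric] matrix_vector_mult_scaleR)
  then show ?thesis by (simp add: bilinear_conv_bounded_bilinear)
qed

text \<open>For \<open>norm (S - \<Sigma>) \<le> \<delta>\<close> the perturbation contributes at
  most half of \<open>norm v\<close>, which is absorbed on the left at the price of the factor 2.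
  The bound then holds for \<open>S\<close> without forming its inverse.\<close>

lemma invertible_stable_lower_bound:
  fixes \<Sigma> :: "real^'k^'k"
  assumes "invertible \<Sigma>"
  obtains K \<delta> where "K > 0" "\<delta> > 0" "\<And>v. norm v \<le> K * norm (\<Sigma> *v v)"
    "\<And>S v. norm (S - \<Sigma>) \<le> \<delta> \<Longrightarrow> norm v \<le> 2 * K * norm (S *v v)"
    "\<And>S v. norm ((\<Sigma> - S) *v v) \<le> K * norm (S - \<Sigma>) * norm v"
proof -
  obtain C where C: "C > 0" "\<And>(A::real^'k^'k) v. norm (A *v v) \<le> norm A * norm v * C"
    using bounded_bilinear.pos_bounded[OF bounded_bilinear_matrix_vector_mult] by blast
  \<comment> \<open>The summand \<open>C\<close> makes \<open>K\<close> positive and at least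
    \<open>C\<close>, so one constant serves the lower bound and the estimate of
    \<open>\<Sigma> - S\<close>.\<close>
  define K where "K = C * norm (matrix_inv \<Sigma>) + C"
  define \<delta> where "\<delta> = 1 / (2 * K * C)"
  have KC: "K \<ge> C" "K > 0" using C(1) by (simp_all add: K_def add_nonneg_pos)
  have K: "norm v \<le> K * norm (\<Sigma> *v v)" for v
  proof -
    have "v = matrix_inv \<Sigma> *v (\<Sigma> *v v)"
      by (simp add: matrix_vector_mul_assoc matrix_inv_left[OF assms])
    then have "norm v \<le> norm (matrix_inv \<Sigma>) * norm (\<Sigma> *v v) * C"
      using C(2)[of "matrix_inv \<Sigma>" "\<Sigma> *v v"] by simp
    also have "\<dots> \<le> K * norm (\<Sigma> *v v)"
      using C(1) by (simp add: K_def algebra_simps)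
    finally show ?thesis .
  qed
  have D: "norm ((\<Sigma> - S) *v v) \<le> C * norm (S - \<Sigma>) * norm v" for S v
    using C(2)[of "\<Sigma> - S" v] by (simp add: norm_minus_commute algebra_simps)
  show ?thesis
  proof (rule that[OF KC(2) _ K])
    show "\<delta> > 0" using KC C(1) by (simp add: \<delta>_def)
    fix S :: "real^'k^'k" and v :: "real^'k"
    have "C * norm (S - \<Sigma>) * norm v \<le> K * norm (S - \<Sigma>) * norm v"
      using KC(1) by (intro mult_right_mono) auto
    with D[of S v] show "norm ((\<Sigma> - S) *v v) \<le> K * norm (S - \<Sigma>) * norm v" by linarith
    assume le: "norm (S - \<Sigma>) \<le> \<delta>"
    have "norm v \<le> K * norm (S *v v + (\<Sigma> - S) *v v)"
      using K[of v] by (simp add: matrix_vector_mult_diff_rdistrib)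
    also have "\<dots> \<le> K * (norm (S *v v) + C * norm (S - \<Sigma>) * norm v)"
      using KC(2) D[of S v] by (intro mult_left_mono order_trans[OF norm_triangle_ineq]) auto
    also have "\<dots> \<le> K * (norm (S *v v) + C * \<delta> * norm v)"
      using KC(2) C(1) le by (intro mult_left_mono add_left_mono mult_right_mono) auto
    also have "\<dots> = K * norm (S *v v) + norm v / 2"
      using KC(2) C(1) by (simp add: \<delta>_def field_simps)
    finally show "norm v \<le> 2 * K * norm (S *v v)" by simp
  qed
qed

text \<open>What the regression has to supply: a diverging sample size, the normal equation, a
  moment matrix converging in probability to an invertible limit, and a Chebyshev bound for the
  score sums. The estimator merely solves the equation, which leaves room for singular
  \<open>S n\<close>.\<close>

locale linear_estimator = prob_space M for M :: "'w measure" +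
  fixes m :: "nat \<Rightarrow> nat" and S :: "nat \<Rightarrow> 'w \<Rightarrow> real^'k^'k" and G b :: "nat \<Rightarrow> 'w \<Rightarrow> real^'k"
    and \<beta> :: "real^'k" and \<Sigma> :: "real^'k^'k" and B :: real
  assumes S_meas [measurable]: "\<And>n. S n \<in> borel_measurable M"
    and G_meas [measurable]: "\<And>n. G n \<in> borel_measurable M"
    and b_meas [measurable]: "\<And>n. b n \<in> borel_measurable M"
    and m_top: "filterlim m at_top sequentially"
    and normal_eq: "\<And>n. AE \<omega> in M. S n \<omega> *v (b n \<omega> - \<beta>) = (1 / real (m n)) *\<^sub>R G n \<omega>"
    and S_prob: "\<And>d. d > 0 \<Longrightarrow> (\<lambda>n. prob {\<omega> \<in> space M. norm (S n \<omega> - \<Sigma>) > d}) \<longlonglongrightarrow> 0"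
    and G_bound: "\<And>n a. a > 0 \<Longrightarrow> prob {\<omega> \<in> space M. norm (G n \<omega>) > a} \<le> B * real (m n) / a\<^sup>2"
    and \<Sigma>_inv: "invertible \<Sigma>"
begin

lemma eventually_m_pos: "\<forall>\<^sub>F n in sequentially. m n > 0"
  using filterlim_at_top[THEN iffD1, OF m_top, rule_format, of 1] by eventually_elim simp

lemma B_nonneg: "B \<ge> 0"
proof -
  obtain n where "m n > 0"
    using eventually_m_pos by (auto simp: eventually_sequentially)
  moreover have "0 \<le> B * real (m n)" using order_trans[OF measure_nonneg G_bound[of 1 n]] by simp
  ultimately show ?thesis by (simp add: zero_le_mult_iff)
qed

lemma prob_le_union:
  fixes f g h :: "'w \<Rightarrow> real"
  assumes AE: "AE \<omega> in M. g \<omega> \<le> d \<longrightarrow> h \<omega> \<le> a \<longrightarrow> f \<omega> \<le> e"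
    and [measurable]: "f \<in> borel_measurable M" "g \<in> borel_measurable M" "h \<in> borel_measurable M"
  shows "prob {\<omega> \<in> space M. f \<omega> > e} \<le> prob {\<omega> \<in> space M. g \<omega> > d} + prob {\<omega> \<in> space M. h \<omega> > a}"
proof -
  have "prob {\<omega> \<in> space M. f \<omega> > e} \<le> prob ({\<omega> \<in> space M. g \<omega> > d} \<union> {\<omega> \<in> space M. h \<omega> > a})"
  proof (rule finite_measure_mono_AE)
    show "AE x in M. x \<in> {\<omega> \<in> space M. f \<omega> > e} \<longrightarrow> x \<in> {\<omega> \<in> space M. g \<omega> > d} \<union> {\<omega> \<in> space M. h \<omega> > a}"
      using AE by eventually_elim auto
  qed measurable
  also have "\<dots> \<le> prob {\<omega> \<in> space M. g \<omega> > d} + prob {\<omega> \<in> space M. h \<omega> > a}"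
    by (rule measure_Un_le) measurable
  finally show ?thesis .
qed

text \<open>\<open>T\<close> is the normalised estimation error and \<open>U\<close> its
  linearisation, with the moment matrix replaced by its limit. \<open>U\<close> is a fixed linear
  image of the normalised score sum, so the central limit theorem can be applied to it
  directly.\<close>

definition "T n \<omega> = sqrt (real (m n)) *\<^sub>R (b n \<omega> - \<beta>)"
definition "U n \<omega> = matrix_inv \<Sigma> *v ((1 / sqrt (real (m n))) *\<^sub>R G n \<omega>)"

lemma T_meas [measurable]: "T n \<in> borel_measurable M"
  unfolding T_def by measurable

lemma U_meas [measurable]: "U n \<in> borel_measurable M"
  unfolding U_def using borel_measurable_matrix_vector_mult by measurable

lemma T_normal_eq: "AE \<omega> in M. S n \<omega> *v T n \<omega> = (1 / sqrt (real (m n))) *\<^sub>R G n \<omega>"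
  using normal_eq[of n]
proof eventually_elim
  case (elim \<omega>)
  have "S n \<omega> *v T n \<omega> = sqrt (real (m n)) *\<^sub>R ((1 / real (m n)) *\<^sub>R G n \<omega>)"
    unfolding T_def matrix_vector_mult_scaleR elim ..
  \<comment> \<open>For \<open>m n = 0\<close> both sides are zero, as division by zero yields
    zero.\<close>
  then show ?case by (cases "m n = 0") (simp_all add: real_div_sqrt field_simps)
qed

lemma T_tight:
  assumes e: "e > 0"
  shows "\<exists>L. \<forall>\<^sub>F n in sequentially. prob {\<omega> \<in> space M. norm (T n \<omega>) > L} < e"
proof -
  obtain K \<delta> where K: "K > 0" "\<delta> > 0" "\<And>A v. norm (A - \<Sigma>) \<le> \<delta> \<Longrightarrow> norm v \<le> 2 * K * norm (A *v v)"
    using invertible_stable_lower_bound[OF \<Sigma>_inv] by metis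
  \<comment> \<open>Chosen so that the Chebyshev bound \<open>B / c\<^sup>2\<close> is below e/2;
    adding 1 to \<open>B\<close> keeps \<open>c\<close> positive.\<close>
  define c where "c = sqrt (2 * (B + 1) / e)"
  have c: "c > 0" "B / c\<^sup>2 < e / 2"
    using e B_nonneg by (auto simp: c_def field_simps)
  have le: "prob {\<omega> \<in> space M. norm (T n \<omega>) > 2 * K * c} \<le> prob {\<omega> \<in> space M. norm (S n \<omega> - \<Sigma>) > \<delta>} + B / c\<^sup>2"
    if m: "m n > 0" for n
  proof -
    have "AE \<omega> in M. norm (S n \<omega> - \<Sigma>) \<le> \<delta> \<longrightarrow> norm (G n \<omega>) \<le> c * sqrt (real (m n)) \<longrightarrow> norm (T n \<omega>) \<le> 2 * K * c"
      using T_normal_eq[of n]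
    proof eventually_elim
      case (elim \<omega>)
      show ?case
      proof (intro impI)
        assume s: "norm (S n \<omega> - \<Sigma>) \<le> \<delta>" and g: "norm (G n \<omega>) \<le> c * sqrt (real (m n))"
        have "norm (T n \<omega>) \<le> 2 * K * norm (S n \<omega> *v T n \<omega>)" by (rule K(3)[OF s])
        also have "\<dots> = 2 * K * (norm (G n \<omega>) / sqrt (real (m n)))" unfolding elim by simp
        also have "\<dots> \<le> 2 * K * c"
          using g K(1) m by (intro mult_left_mono) (auto simp: divide_le_eq)
        finally show "norm (T n \<omega>) \<le> 2 * K * c" .
      qed
    qed
    then have "prob {\<omega> \<in> space M. norm (T n \<omega>) > 2 * K * c}
        \<le> prob {\<omega> \<in> space M. norm (S n \<omega> - \<Sigma>) > \<delta>} + prob {\<omega> \<in> space M. norm (G n \<omega>) > c * sqrt (real (m n))}"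
      by (intro prob_le_union) measurable
    also have "prob {\<omega> \<in> space M. norm (G n \<omega>) > c * sqrt (real (m n))} \<le> B / c\<^sup>2"
      using G_bound[of "c * sqrt (real (m n))" n] m c(1) by (simp add: power_mult_distrib)
    finally show ?thesis by simp
  qed
  have "\<forall>\<^sub>F n in sequentially. prob {\<omega> \<in> space M. norm (S n \<omega> - \<Sigma>) > \<delta>} < e / 2"
    using S_prob[OF K(2)] e by (intro order_tendstoD) auto
  with eventually_m_pos have "\<forall>\<^sub>F n in sequentially. prob {\<omega> \<in> space M. norm (T n \<omega>) > 2 * K * c} < e"
  proof eventually_elim
    case (elim n)
    show ?case using le[OF elim(1)] elim(2) c(2) by linarith
  qed
  then show ?thesis by blast
qed

text \<open>The normalised error is tight while its scale \<open>sqrt (m n)\<close> diverges: an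
  error above \<open>e\<close> forces \<open>norm (T n \<omega>)\<close> above any given
  \<open>L\<close> once \<open>sqrt (m n)\<close> is at least L/e.\<close>

theorem consistency: "tendsto_in_prob M b \<beta>"
  unfolding tendsto_in_prob_def
proof (intro allI impI LIMSEQ_I)
  fix e r :: real assume e: "e > 0" and r: "r > 0"
  obtain L where L: "\<forall>\<^sub>F n in sequentially. prob {\<omega> \<in> space M. norm (T n \<omega>) > L} < r"
    using T_tight[OF r] by blast
  have "filterlim (\<lambda>n. sqrt (real (m n))) at_top sequentially"
    by (rule filterlim_compose[OF sqrt_at_top filterlim_compose[OF filterlim_real_sequentially m_top]])
  then have "\<forall>\<^sub>F n in sequentially. L / e \<le> sqrt (real (m n))"
    unfolding filterlim_at_top by blast
  with L eventually_m_pos have "\<forall>\<^sub>F n in sequentially. prob {\<omega> \<in> space M. dist (b n \<omega>) \<beta> > e} < r"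
  proof eventually_elim
    case (elim n)
    have "L < norm (T n \<omega>)" if "e < dist (b n \<omega>) \<beta>" for \<omega>
    proof -
      have "L \<le> sqrt (real (m n)) * e" using elim(3) e by (simp add: divide_le_eq)
      also have "\<dots> < sqrt (real (m n)) * dist (b n \<omega>) \<beta>" using elim(2) that by simp
      also have "\<dots> = norm (T n \<omega>)" by (simp add: T_def dist_norm)
      finally show ?thesis .
    qed
    then have "prob {\<omega> \<in> space M. dist (b n \<omega>) \<beta> > e} \<le> prob {\<omega> \<in> space M. norm (T n \<omega>) > L}"
      by (intro finite_measure_mono) auto
    with elim(1) show ?case by linarith
  qed
  then show "\<exists>no. \<forall>n\<ge>no. norm (prob {\<omega> \<in> space M. dist (b n \<omega>) \<beta> > e} - 0) < r"
    by (simp add: eventually_sequentially)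
qed

text \<open>By the normal equation \<open>\<Sigma> *v (T n \<omega> - U n \<omega>) = (\<Sigma> - S
  n \<omega>) *v T n \<omega>\<close>, a vanishing matrix applied to a tight vector.\<close>

lemma T_U_close:
  assumes e: "e > 0" and r: "r > 0"
  shows "\<forall>\<^sub>F n in sequentially. prob {\<omega> \<in> space M. norm (T n \<omega> - U n \<omega>) > e} < r"
proof -
  obtain K where K: "K > 0" "\<And>v. norm v \<le> K * norm (\<Sigma> *v v)"
    "\<And>A v. norm ((\<Sigma> - A) *v v) \<le> K * norm (A - \<Sigma>) * norm v"
    using invertible_stable_lower_bound[OF \<Sigma>_inv] by metis
  have r2: "r / 2 > 0" using r by simp
  obtain L0 where L0: "\<forall>\<^sub>F n in sequentially. prob {\<omega> \<in> space M. norm (T n \<omega>) > L0} < r / 2"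
    using T_tight[OF r2] by blast
  define L where "L = max L0 1"
  define \<delta> where "\<delta> = e / (K * K * L)"
  have L: "L > 0" and \<delta>: "\<delta> > 0" "K * (K * \<delta> * L) = e"
    using K(1) e by (simp_all add: L_def \<delta>_def)
  have le: "prob {\<omega> \<in> space M. norm (T n \<omega> - U n \<omega>) > e}
    \<le> prob {\<omega> \<in> space M. norm (S n \<omega> - \<Sigma>) > \<delta>} + prob {\<omega> \<in> space M. norm (T n \<omega>) > L0}" for n
  proof -
    have "AE \<omega> in M. norm (S n \<omega> - \<Sigma>) \<le> \<delta> \<longrightarrow> norm (T n \<omega>) \<le> L0 \<longrightarrow> norm (T n \<omega> - U n \<omega>) \<le> e"
      using T_normal_eq[of n]
    proof eventually_elim
      case (elim \<omega>)
      show ?case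
      proof (intro impI)
        assume s: "norm (S n \<omega> - \<Sigma>) \<le> \<delta>" and T: "norm (T n \<omega>) \<le> L0"
        have "\<Sigma> *v U n \<omega> = S n \<omega> *v T n \<omega>"
          unfolding elim U_def by (simp add: matrix_vector_mul_assoc matrix_inv_right[OF \<Sigma>_inv])
        then have "\<Sigma> *v (T n \<omega> - U n \<omega>) = (\<Sigma> - S n \<omega>) *v T n \<omega>"
          by (simp add: matrix_vector_mult_diff_distrib matrix_vector_mult_diff_rdistrib)
        then have "norm (T n \<omega> - U n \<omega>) \<le> K * norm ((\<Sigma> - S n \<omega>) *v T n \<omega>)" using K(2)[of "T n \<omega> - U n \<omega>"] by simp
        also have "\<dots> \<le> K * (K * norm (S n \<omega> - \<Sigma>) * norm (T n \<omega>))"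
          using K(1) by (intro mult_left_mono K(3)) simp
        also have "\<dots> \<le> K * (K * \<delta> * L)"
          using s T K(1) \<delta>(1) by (intro mult_left_mono mult_mono) (auto simp: L_def)
        finally show "norm (T n \<omega> - U n \<omega>) \<le> e" by (simp only: \<delta>(2))
      qed
    qed
    then show ?thesis by (intro prob_le_union) measurable
  qed
  have "\<forall>\<^sub>F n in sequentially. prob {\<omega> \<in> space M. norm (S n \<omega> - \<Sigma>) > \<delta>} < r / 2"
    using S_prob[OF \<delta>(1)] r by (intro order_tendstoD) auto
  with L0 show ?thesis
  proof eventually_elim
    case (elim n)
    show ?case using le[of n] elim by linarith
  qed
qed

lemma iexp_T_U: "(\<lambda>n. (\<integral>\<omega>. iexp (t \<bullet> T n \<omega>) \<partial>M) - (\<integral>\<omega>. iexp (t \<bullet> U n \<omega>) \<partial>M)) \<longlonglongrightarrow> 0"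
proof (rule LIMSEQ_I)
  fix r :: real assume r: "r > 0"
  \<comment> \<open>On the event of closeness the exponentials differ by at most
    \<open>norm t * e\<close>, hence r/2; elsewhere by at most 2 with probability below r/4. The
    added 1 covers t = 0.\<close>
  define e where "e = r / (2 * (norm t + 1))"
  have e: "e > 0" and r4: "r / 4 > 0" using r by (simp_all add: e_def add_nonneg_pos)
  have te: "norm t * e \<le> r / 2"
  proof -
    have "norm t * e \<le> (norm t + 1) * e" using e by (simp add: algebra_simps)
    also have "\<dots> = r / 2"
    proof -
      have "x * (r / (2 * x)) = r / 2" if "x > 0" for x using that by simp
      from this[of "norm t + 1"] show ?thesis unfolding e_def by (simp only: add_nonneg_pos norm_ge_zero zero_less_one simp_thms)
    qed
    finally show ?thesis .
  qed
  have "\<forall>\<^sub>F n in sequentially. norm ((\<integral>\<omega>. iexp (t \<bullet> T n \<omega>) \<partial>M) - (\<integral>\<omega>. iexp (t \<bullet> U n \<omega>) \<partial>M)) < r"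
    using T_U_close[OF e r4]
  proof eventually_elim
    case (elim n)
    let ?A = "{\<omega> \<in> space M. norm (T n \<omega> - U n \<omega>) > e}"
    have i: "integrable M (\<lambda>\<omega>. iexp (t \<bullet> T n \<omega>))" "integrable M (\<lambda>\<omega>. iexp (t \<bullet> U n \<omega>))"
      by (rule integrable_const_bound[where B=1]; simp)+
    have "(\<integral>\<omega>. iexp (t \<bullet> T n \<omega>) \<partial>M) - (\<integral>\<omega>. iexp (t \<bullet> U n \<omega>) \<partial>M) = (\<integral>\<omega>. iexp (t \<bullet> T n \<omega>) - iexp (t \<bullet> U n \<omega>) \<partial>M)"
      by (rule Bochner_Integration.integral_diff[symmetric]) (rule i)+
    also have "norm \<dots> \<le> (\<integral>\<omega>. norm t * e + 2 * indicator ?A \<omega> \<partial>M)"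
    proof (rule norm_integral_le_integral)
      show "integrable M (\<lambda>\<omega>. iexp (t \<bullet> T n \<omega>) - iexp (t \<bullet> U n \<omega>))"
        using i by (rule Bochner_Integration.integrable_diff)
      show "integrable M (\<lambda>\<omega>. norm t * e + 2 * indicator ?A \<omega>)"
        by (intro Bochner_Integration.integrable_add integrable_mult_right integrable_real_indicator) (auto simp: less_top[symmetric])
      fix \<omega> assume \<omega>: "\<omega> \<in> space M"
      show "norm (iexp (t \<bullet> T n \<omega>) - iexp (t \<bullet> U n \<omega>)) \<le> norm t * e + 2 * indicator ?A \<omega>"
      proof (cases "\<omega> \<in> ?A")
        case True
        have "norm (iexp (t \<bullet> T n \<omega>) - iexp (t \<bullet> U n \<omega>)) \<le> 1 + 1"
          by (rule order_trans[OF norm_triangle_ineq4]) simp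
        moreover have "0 \<le> norm t * e" using e by simp
        ultimately show ?thesis using True by simp
      next
        case False
        then have "norm (T n \<omega> - U n \<omega>) \<le> e" using \<omega> by auto
        then have "\<bar>t \<bullet> T n \<omega> - t \<bullet> U n \<omega>\<bar> \<le> norm t * e"
          using order_trans[OF Cauchy_Schwarz_ineq2[of t "T n \<omega> - U n \<omega>"] mult_left_mono]
          by (simp add: inner_diff_right)
        then show ?thesis using norm_iexp_diff_le[of "t \<bullet> T n \<omega>" "t \<bullet> U n \<omega>"] False by simp
      qed
    qed
    also have "\<dots> = norm t * e + 2 * prob ?A"
      by (simp add: prob_space less_top[symmetric])
    also have "\<dots> < r" using te elim by linarith
    finally show ?case .
  qed
  then show "\<exists>no. \<forall>n\<ge>no. norm ((\<integral>\<omega>. iexp (t \<bullet> T n \<omega>) \<partial>M) - (\<integral>\<omega>. iexp (t \<bullet> U n \<omega>) \<partial>M) - 0) < r"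
    by (simp add: eventually_sequentially)
qed

text \<open>The inverse \<open>J\<close> of \<open>\<Sigma>\<close> is symmetric, so testing
  \<open>U\<close> with \<open>t\<close> is testing the score sum with \<open>J *v t\<close>, and
  the exponent becomes the quadratic form of \<open>\<Omega>\<close>. Positive definiteness of
  \<open>\<Omega>\<close> has to be verified because the normal law is given by its density.\<close>

theorem asymptotic_normality:
  assumes sym: "transpose \<Sigma> = \<Sigma>" and V: "pos_def V"
    and clt: "\<And>c. (\<lambda>n. \<integral>\<omega>. iexp (1 / sqrt (real (m n)) * (c \<bullet> G n \<omega>)) \<partial>M) \<longlonglongrightarrow> of_real (exp (- (c \<bullet> (V *v c)) / 2))"
  shows "tendsto_in_distribution M (\<lambda>n \<omega>. sqrt (real (m n)) *\<^sub>R (b n \<omega> - \<beta>))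
     (multi_normal 0 (matrix_inv \<Sigma> ** V ** matrix_inv \<Sigma>))"
proof -
  define J where "J = matrix_inv \<Sigma>"
  define \<Omega> where "\<Omega> = J ** V ** J"
  have J\<Sigma>: "J ** \<Sigma> = mat 1" "\<Sigma> ** J = mat 1"
    unfolding J_def by (rule matrix_inv_left[OF \<Sigma>_inv], rule matrix_inv_right[OF \<Sigma>_inv])
  have J_sym: "transpose J = J"
  proof -
    have "transpose J ** \<Sigma> = mat 1"
      using J\<Sigma>(2) sym by (metis matrix_transpose_mul transpose_mat)
    then show ?thesis using J\<Sigma> by (metis matrix_mul_assoc matrix_mul_lid matrix_mul_rid)
  qed
  have adj: "t \<bullet> (J *v v) = (J *v t) \<bullet> v" for t v
    using inner_transpose_matrix_vector[of t J v] J_sym by simp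
  have quad: "t \<bullet> (\<Omega> *v t) = (J *v t) \<bullet> (V *v (J *v t))" for t
  proof -
    have "\<Omega> *v t = J *v (V *v (J *v t))" by (simp only: \<Omega>_def matrix_vector_mul_assoc matrix_mul_assoc)
    then show ?thesis by (simp only: adj)
  qed
  have \<Omega>: "pos_def \<Omega>"
    unfolding pos_def_def
  proof (intro conjI allI impI)
    have "transpose V = V" using V by (simp add: pos_def_def)
    then show "transpose \<Omega> = \<Omega>"
      by (simp add: \<Omega>_def matrix_transpose_mul J_sym matrix_mul_assoc)
    fix t :: "real^'k" assume "t \<noteq> 0"
    then have "J *v t \<noteq> 0"
      using J\<Sigma>(2) by (metis matrix_vector_mul_assoc matrix_vector_mul_lid matrix_vector_mult_0_right)
    then show "0 < t \<bullet> (\<Omega> *v t)" using V unfolding quad pos_def_def by blast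
  qed
  let ?\<mu> = "multi_normal 0 \<Omega>"
  have \<mu>: "prob_space ?\<mu>" "sets ?\<mu> = sets borel"
    using multi_normal_char(1)[OF \<Omega>] by (simp_all add: multi_normal_def)
  interpret \<mu>: prob_space ?\<mu> by fact
  have ch: "(\<lambda>n. \<integral>\<omega>. iexp (t \<bullet> T n \<omega>) \<partial>M) \<longlonglongrightarrow> of_real (exp (- (t \<bullet> (\<Omega> *v t)) / 2))" for t
  proof -
    have "(\<integral>\<omega>. iexp (t \<bullet> U n \<omega>) \<partial>M) = (\<integral>\<omega>. iexp (1 / sqrt (real (m n)) * ((J *v t) \<bullet> G n \<omega>)) \<partial>M)" for n
      unfolding U_def J_def[symmetric] adj by (simp only: inner_scaleR_right)
    then have "(\<lambda>n. \<integral>\<omega>. iexp (t \<bullet> U n \<omega>) \<partial>M) \<longlonglongrightarrow> of_real (exp (- (t \<bullet> (\<Omega> *v t)) / 2))"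
      using clt[of "J *v t"] by (simp only: quad)
    from tendsto_add[OF iexp_T_U[of t] this] show ?thesis by simp
  qed
  have iT: "integrable M (\<lambda>\<omega>. iexp (t \<bullet> T n \<omega>))" for n t
    by (rule integrable_const_bound[where B=1]) auto
  have i\<mu>: "integrable ?\<mu> (\<lambda>v. iexp (t \<bullet> v))" for t
  proof (rule \<mu>.integrable_const_bound[where B=1])
    have "(\<lambda>v. iexp (t \<bullet> v)) \<in> borel_measurable borel" by measurable
    then show "(\<lambda>v. iexp (t \<bullet> v)) \<in> borel_measurable ?\<mu>" by (simp add: measurable_cong_sets[OF \<mu>(2) refl])
  qed simp
  have cosT: "(\<integral>\<omega>. cos (t \<bullet> T n \<omega>) \<partial>M) = Re (\<integral>\<omega>. iexp (t \<bullet> T n \<omega>) \<partial>M)" for n t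
    by (subst integral_Re[OF iT, symmetric]) (simp add: Re_exp)
  have sinT: "(\<integral>\<omega>. sin (t \<bullet> T n \<omega>) \<partial>M) = Im (\<integral>\<omega>. iexp (t \<bullet> T n \<omega>) \<partial>M)" for n t
    by (subst integral_Im[OF iT, symmetric]) (simp add: Im_exp)
  have cos\<mu>: "(\<integral>v. cos (t \<bullet> v) \<partial>?\<mu>) = Re (of_real (exp (- (t \<bullet> (\<Omega> *v t)) / 2)))" for t
    unfolding multi_normal_char(2)[OF \<Omega>, symmetric] by (subst integral_Re[OF i\<mu>, symmetric]) (simp add: Re_exp)
  have sin\<mu>: "(\<integral>v. sin (t \<bullet> v) \<partial>?\<mu>) = Im (of_real (exp (- (t \<bullet> (\<Omega> *v t)) / 2)))" for t
    unfolding multi_normal_char(2)[OF \<Omega>, symmetric] by (subst integral_Im[OF i\<mu>, symmetric]) (simp add: Im_exp)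
  have "tendsto_in_distribution M T ?\<mu>"
    unfolding tendsto_in_distribution_def
  proof (intro allI impI, elim conjE)
    fix f :: "real^'k \<Rightarrow> real" assume f: "continuous_on UNIV f" "bounded (range f)"
    show "(\<lambda>n. \<integral>\<omega>. f (T n \<omega>) \<partial>M) \<longlonglongrightarrow> (\<integral>v. f v \<partial>?\<mu>)"
    proof (rule characteristic_convergence_imp_distribution[OF prob_space_axioms T_meas \<mu> T_tight _ _ f])
      show "(\<lambda>n. \<integral>\<omega>. cos (t \<bullet> T n \<omega>) \<partial>M) \<longlonglongrightarrow> (\<integral>v. cos (t \<bullet> v) \<partial>?\<mu>)" for t
        unfolding cosT cos\<mu> by (rule tendsto_Re[OF ch])
      show "(\<lambda>n. \<integral>\<omega>. sin (t \<bullet> T n \<omega>) \<partial>M) \<longlonglongrightarrow> (\<integral>v. sin (t \<bullet> v) \<partial>?\<mu>)" for t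
        unfolding sinT sin\<mu> by (rule tendsto_Im[OF ch])
    qed
  qed
  moreover have "T = (\<lambda>n \<omega>. sqrt (real (m n)) *\<^sub>R (b n \<omega> - \<beta>))"
    by (simp add: T_def fun_eq_iff)
  ultimately show ?thesis by (simp only: \<Omega>_def J_def)
qed

end

section \<open>Least squares on the tail subsample\<close>

text \<open>Otherwise a step along the nonzero vector \<open>v\<close> of the normal equations, half
  the negative gradient, would lower the sum of squares. The change is
  \<open>- 2 * s * (v \<bullet> v) + s\<^sup>2 * Q\<close>, and the step \<open>s\<close> has
  denominator \<open>Q + 1\<close> because \<open>Q\<close> may be 0.\<close>

lemma least_squares_normal_equations:
  fixes z :: "'i \<Rightarrow> real" and x :: "'i \<Rightarrow> 'b::real_inner"
  assumes min: "is_arg_min (\<lambda>b. \<Sum>\<tau>\<in>I. (z \<tau> - x \<tau> \<bullet> b)\<^sup>2) (\<lambda>_. True) b"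
  shows "(\<Sum>\<tau>\<in>I. (z \<tau> - x \<tau> \<bullet> b) *\<^sub>R x \<tau>) = 0"
proof (rule ccontr)
  define v where "v = (\<Sum>\<tau>\<in>I. (z \<tau> - x \<tau> \<bullet> b) *\<^sub>R x \<tau>)"
  define Q where "Q = (\<Sum>\<tau>\<in>I. (x \<tau> \<bullet> v)\<^sup>2)"
  define s where "s = (v \<bullet> v) / (Q + 1)"
  assume "(\<Sum>\<tau>\<in>I. (z \<tau> - x \<tau> \<bullet> b) *\<^sub>R x \<tau>) \<noteq> 0"
  then have v: "v \<bullet> v > 0" by (simp add: v_def)
  have Q: "Q \<ge> 0" unfolding Q_def by (rule sum_nonneg) simp
  have "(z \<tau> - x \<tau> \<bullet> (b + s *\<^sub>R v))\<^sup>2 = (z \<tau> - x \<tau> \<bullet> b)\<^sup>2 - 2 * s * (((z \<tau> - x \<tau> \<bullet> b) *\<^sub>R x \<tau>) \<bullet> v) + s\<^sup>2 * (x \<tau> \<bullet> v)\<^sup>2" for \<tau>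
    by (simp add: inner_add_right power2_eq_square algebra_simps)
  then have "(\<Sum>\<tau>\<in>I. (z \<tau> - x \<tau> \<bullet> (b + s *\<^sub>R v))\<^sup>2)
     = (\<Sum>\<tau>\<in>I. (z \<tau> - x \<tau> \<bullet> b)\<^sup>2) - 2 * s * (v \<bullet> v) + s\<^sup>2 * Q"
    by (simp only: sum.distrib sum_subtractf sum_distrib_left[symmetric] inner_sum_left[symmetric] v_def[symmetric] Q_def[symmetric])
  moreover have "\<not> (\<Sum>\<tau>\<in>I. (z \<tau> - x \<tau> \<bullet> (b + s *\<^sub>R v))\<^sup>2) < (\<Sum>\<tau>\<in>I. (z \<tau> - x \<tau> \<bullet> b)\<^sup>2)"
    using min unfolding is_arg_min_def by blast
  ultimately have "2 * s * (v \<bullet> v) \<le> s\<^sup>2 * Q" by linarith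
  moreover have "s > 0" using v Q by (simp add: s_def)
  ultimately have "2 * (v \<bullet> v) \<le> s * Q" by (simp add: power2_eq_square)
  also have "\<dots> \<le> v \<bullet> v" using v Q by (simp add: s_def divide_le_eq)
  finally show False using v by simp
qed

lemma borel_measurable_outer [measurable (raw)]:
  fixes f g :: "'a \<Rightarrow> real^'k"
  assumes "f \<in> borel_measurable M" "g \<in> borel_measurable M"
  shows "(\<lambda>x. outer (f x) (g x)) \<in> borel_measurable M"
  using assms
proof (rule borel_measurable_continuous_Pair)
  show "continuous_on UNIV (\<lambda>x::(real^'k) \<times> (real^'k). outer (fst x) (snd x))"
    unfolding outer_def by (intro continuous_intros)
qed

lemma outer_vector_mult: "outer u u *v v = (u \<bullet> v) *\<^sub>R u"
  by (simp add: vec_eq_iff outer_def matrix_vector_mult_def inner_vec_def sum_distrib_left sum_distrib_right ac_simps)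

lemma sum_matrix_vector_mult: "(\<Sum>i\<in>I. A i) *v v = (\<Sum>i\<in>I. A i *v v)" for A :: "'i \<Rightarrow> real^'n^'m"
  by (induction I rule: infinite_finite_induct) (simp_all add: matrix_vector_mult_add_rdistrib)

lemma tail_set_measurable:
  assumes [measurable]: "\<And>t. y t \<in> borel_measurable M" "w n \<in> borel_measurable M"
  shows "tail_set y w n \<in> M \<rightarrow>\<^sub>M count_space (Pow {1..n})"
proof (subst measurable_count_space_eq2, simp, intro conjI ballI)
  show "tail_set y w n \<in> space M \<rightarrow> Pow {1..n}" by (auto simp: tail_set_def)
  fix A assume A: "A \<in> Pow {1..n}"
  then have "A \<subseteq> {1..n}" by simp
  then have "tail_set y w n \<omega> = A \<longleftrightarrow> (\<forall>t\<in>{1..n}. (y t \<omega> > w n \<omega>) = (t \<in> A))" for \<omega>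
    unfolding tail_set_def by blast
  then have "tail_set y w n -` {A} \<inter> space M = {\<omega> \<in> space M. \<forall>t\<in>{1..n}. (y t \<omega> > w n \<omega>) = (t \<in> A)}"
    by blast
  also have "\<dots> \<in> sets M" by measurable
  finally show "tail_set y w n -` {A} \<inter> space M \<in> sets M" .
qed

text \<open>The index of the chosen observation is random, but the tail set has only finitely many
  values, and on each of them the entry is one fixed member of the series \<open>s\<close>.\<close>

lemma subsample_measurable:
  assumes y: "\<And>t. y t \<in> borel_measurable M" and w: "w n \<in> borel_measurable M"
    and s: "\<And>t. s t \<in> M \<rightarrow>\<^sub>M K"
  shows "subsample y w s n \<tau> \<in> M \<rightarrow>\<^sub>M K"
  unfolding subsample_def
  by (rule measurable_compose_countable'[where f="\<lambda>A. s (sorted_list_of_set A ! (\<tau> - 1))",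
        OF s tail_set_measurable[of y M w n, OF y w]]) (simp add: countable_finite)

lemma tail_size_at_top:
  assumes "\<kappa> > 0"
  shows "filterlim (tail_size \<kappa>) at_top sequentially"
  unfolding filterlim_at_top
proof
  fix Z :: nat
  obtain N where N: "real N > (real Z + 1) / \<kappa>" using reals_Archimedean2 by blast
  have "tail_size \<kappa> n \<ge> Z" if "n \<ge> N" for n
  proof -
    have "(real Z + 1) / \<kappa> < real n" using N that by linarith
    then have "real Z \<le> \<kappa> * real n" using assms by (simp add: field_simps)
    then have "int Z \<le> \<lfloor>\<kappa> * real n\<rfloor>" by (simp add: le_floor_iff)
    then show ?thesis by (simp add: tail_size_def)
  qed
  then show "\<forall>\<^sub>F n in sequentially. Z \<le> tail_size \<kappa> n" by (auto simp: eventually_sequentially)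
qed

text \<open>The squared norm is the sum of the squared projections on the axes, whose variances
  divided by m converge. Convergent sequences are bounded, which gives one constant for all
  m.\<close>

lemma (in score_process) score_sum_second_moment_bound:
  assumes A4a: "A4a \<beta> N Y X \<Gamma> V"
  obtains B where "\<And>m. integrable N (\<lambda>\<omega>. (norm (\<Sum>\<tau>=1..m. g (int \<tau>) \<omega>))\<^sup>2)"
    "\<And>m. (\<integral>\<omega>. (norm (\<Sum>\<tau>=1..m. g (int \<tau>) \<omega>))\<^sup>2 \<partial>N) \<le> B * real m"
proof -
  define c where "c l = axis l (1::real)" for l :: 'k
  define E where "E m = (\<integral>\<omega>. (norm (\<Sum>\<tau>=1..m. g (int \<tau>) \<omega>))\<^sup>2 \<partial>N)" for m
  have sq: "square_integrable N (\<lambda>\<omega>. \<Sum>i<m. c l \<bullet> g (int i + 1) \<omega>)" for m l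
    by (intro square_integrable_sum score_square_integrable[OF A4a])
  have norm_eq: "(norm (\<Sum>\<tau>=1..m. g (int \<tau>) \<omega>))\<^sup>2 = (\<Sum>l\<in>UNIV. (\<Sum>i<m. c l \<bullet> g (int i + 1) \<omega>)\<^sup>2)" for m \<omega>
  proof -
    have "(\<Sum>\<tau>=1..m. g (int \<tau>) \<omega>) $ l = (\<Sum>i<m. c l \<bullet> g (int i + 1) \<omega>)" for l
      unfolding sum_from_one[of "\<lambda>\<tau>. g \<tau> \<omega>", symmetric] by (simp add: c_def inner_axis')
    moreover have "(norm v)\<^sup>2 = (\<Sum>l\<in>UNIV. (v $ l)\<^sup>2)" for v :: "real^'k"
      by (simp only: power2_norm_eq_inner inner_vec_def) (simp add: power2_eq_square)
    ultimately show ?thesis by (simp only:)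
  qed
  have int: "integrable N (\<lambda>\<omega>. (norm (\<Sum>\<tau>=1..m. g (int \<tau>) \<omega>))\<^sup>2)" for m
    unfolding norm_eq by (intro Bochner_Integration.integrable_sum square_integrableD(2)[OF sq])
  have E_eq: "E m = (\<Sum>l\<in>UNIV. \<integral>\<omega>. (\<Sum>i<m. c l \<bullet> g (int i + 1) \<omega>)\<^sup>2 \<partial>N)" for m
    unfolding E_def norm_eq by (intro Bochner_Integration.integral_sum square_integrableD(2)[OF sq])
  have "(\<lambda>m. E m / real m) \<longlonglongrightarrow> (\<Sum>l\<in>UNIV. c l \<bullet> (V *v c l))"
    unfolding E_eq sum_divide_distrib by (intro tendsto_sum score_variance_tendsto[OF A4a])
  then have "Bseq (\<lambda>m. E m / real m)" by (intro convergent_imp_Bseq convergentI)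
  then obtain B where B: "\<And>m. \<bar>E m / real m\<bar> \<le> B" by (auto simp: Bseq_def)
  have "E m \<le> B * real m" for m
  proof (cases "m = 0")
    case True
    then show ?thesis by (simp add: E_def)
  next
    case False
    then show ?thesis using B[of m] by (simp add: abs_le_iff divide_le_eq)
  qed
  with int show ?thesis unfolding E_def by (rule that)
qed

section \<open>Transfer between the tail subsample and the stationary process\<close>

locale tail_regression = score_process \<beta> N Y X
  for \<beta> :: "real^'k" and N :: "'v measure" and Y :: "int \<Rightarrow> 'v \<Rightarrow> real" and X :: "int \<Rightarrow> 'v \<Rightarrow> real^'k" +
  fixes M :: "'w measure" and y :: "nat \<Rightarrow> 'w \<Rightarrow> real" and x :: "nat \<Rightarrow> 'w \<Rightarrow> real^'k"
    and w :: "nat \<Rightarrow> 'w \<Rightarrow> real" and \<kappa> :: real and bhat :: "nat \<Rightarrow> 'w \<Rightarrow> real^'k"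
    and \<Sigma>xx V :: "real^'k^'k" and \<Gamma> :: "int \<Rightarrow> real^'k^'k"
  assumes prob_M: "prob_space M"
    and y_meas [measurable]: "\<And>t. y t \<in> borel_measurable M"
    and x_meas [measurable]: "\<And>t. x t \<in> borel_measurable M"
    and w_meas [measurable]: "\<And>n. w n \<in> borel_measurable M"
    and \<kappa>_pos: "\<kappa> > 0"
    and ols: "ols_estimator M y x w \<kappa> bhat"
    and A1: "A1 M y x w \<kappa> N Y X"
    and A3: "A3 N X \<Sigma>xx"
    and A4a: "A4a \<beta> N Y X \<Gamma> V"
begin

sublocale M: prob_space M by (rule prob_M)

abbreviation "m n \<equiv> tail_size \<kappa> n"
abbreviation "PS n \<equiv> \<Pi>\<^sub>M \<tau>\<in>{1..m n}. (borel :: (real \<times> (real^'k)) measure)"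

definition "tail_obs n \<omega> = (\<lambda>\<tau>\<in>{1..m n}. (subsample y w y n \<tau> \<omega> / w n \<omega>, subsample y w x n \<tau> \<omega>))"
definition "limit_obs n \<omega> = (\<lambda>\<tau>\<in>{1..m n}. Z (int \<tau>) \<omega>)"

lemma tail_obs_measurable: "tail_obs n \<in> M \<rightarrow>\<^sub>M PS n"
  unfolding tail_obs_def
proof (rule measurable_restrict)
  fix \<tau>
  note [measurable] = subsample_measurable[OF y_meas w_meas y_meas] subsample_measurable[OF y_meas w_meas x_meas]
  show "(\<lambda>\<omega>. (subsample y w y n \<tau> \<omega> / w n \<omega>, subsample y w x n \<tau> \<omega>)) \<in> borel_measurable M"
    by measurable
qed

lemma limit_obs_measurable: "limit_obs n \<in> N \<rightarrow>\<^sub>M PS n"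
  unfolding limit_obs_def by (rule measurable_restrict) (rule Z_measurable)

lemma obs_distr: "distr M (PS n) (tail_obs n) = distr N (PS n) (limit_obs n)"
  using A1 unfolding A1_def tail_obs_def[abs_def] limit_obs_def[abs_def] by blast

text \<open>(A1) equates the laws of finite stretches for each \<open>n\<close> separately.
  Expectations and probabilities therefore pass from \<open>N\<close> to \<open>M\<close>, whereas
  almost sure limits in general do not; the limit theorems are brought into the former shape before
  they are transferred.\<close>

lemma obs_integral:
  fixes f :: "_ \<Rightarrow> 'b::{banach, second_countable_topology}"
  assumes "f \<in> borel_measurable (PS n)"
  shows "(\<integral>\<omega>. f (tail_obs n \<omega>) \<partial>M) = (\<integral>\<omega>. f (limit_obs n \<omega>) \<partial>N)"
  using integral_distr[OF tail_obs_measurable assms] integral_distr[OF limit_obs_measurable assms]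
  unfolding obs_distr by (simp only:)

lemma obs_prob:
  fixes f :: "_ \<Rightarrow> real"
  assumes [measurable]: "f \<in> borel_measurable (PS n)"
  shows "measure M {\<omega> \<in> space M. f (tail_obs n \<omega>) > a} = measure N {\<omega> \<in> space N. f (limit_obs n \<omega>) > a}"
proof -
  let ?A = "{u \<in> space (PS n). f u > a}"
  have A: "?A \<in> sets (PS n)" by measurable
  have "measure M (tail_obs n -` ?A \<inter> space M) = measure N (limit_obs n -` ?A \<inter> space N)"
    using measure_distr[OF tail_obs_measurable A] measure_distr[OF limit_obs_measurable A]
    unfolding obs_distr by (simp only:)
  moreover have "tail_obs n -` ?A \<inter> space M = {\<omega> \<in> space M. f (tail_obs n \<omega>) > a}"
    using measurable_space[OF tail_obs_measurable] by auto
  moreover have "limit_obs n -` ?A \<inter> space N = {\<omega> \<in> space N. f (limit_obs n \<omega>) > a}"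
    using measurable_space[OF limit_obs_measurable] by auto
  ultimately show ?thesis by simp
qed

definition "sxx n u = (1 / real (m n)) *\<^sub>R (\<Sum>\<tau>=1..m n. outer (snd (u \<tau>)) (snd (u \<tau>)))"
definition "sg n u = (\<Sum>\<tau>=1..m n. score_fun (u \<tau>))"

lemma obs_component_measurable:
  assumes "\<tau> \<in> {1..m n}"
  shows "(\<lambda>u. u \<tau>) \<in> borel_measurable (PS n)" "(\<lambda>u. snd (u \<tau>)) \<in> borel_measurable (PS n)"
proof -
  show 1: "(\<lambda>u. u \<tau>) \<in> borel_measurable (PS n)"
    using assms by (rule measurable_component_singleton)
  have "snd \<in> borel_measurable (borel :: (real \<times> (real^'k)) measure)"
    unfolding borel_prod[symmetric] by (rule measurable_snd)
  from measurable_compose[OF 1 this] show "(\<lambda>u. snd (u \<tau>)) \<in> borel_measurable (PS n)" .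
qed

lemma sxx_measurable [measurable]: "sxx n \<in> borel_measurable (PS n)"
  unfolding sxx_def
  by (intro borel_measurable_scaleR borel_measurable_const borel_measurable_sum borel_measurable_outer obs_component_measurable)

lemma sg_measurable [measurable]: "sg n \<in> borel_measurable (PS n)"
  unfolding sg_def
  by (intro borel_measurable_sum measurable_compose[OF obs_component_measurable(1) score_fun_measurable])

lemma sxx_limit: "sxx n (limit_obs n \<omega>) = (1 / real (m n)) *\<^sub>R (\<Sum>\<tau>=1..m n. outer (X (int \<tau>) \<omega>) (X (int \<tau>) \<omega>))"
  unfolding sxx_def limit_obs_def by (intro arg_cong2[where f=scaleR] sum.cong) auto

lemma sg_limit: "sg n (limit_obs n \<omega>) = (\<Sum>\<tau>=1..m n. g (int \<tau>) \<omega>)"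
  unfolding sg_def limit_obs_def by (intro sum.cong) (auto simp: score_eq)

lemma ols_normal_equation:
  assumes "is_arg_min (ssr y x w \<kappa> n \<omega>) (\<lambda>_. True) b"
  shows "sxx n (tail_obs n \<omega>) *v (b - \<beta>) = (1 / real (m n)) *\<^sub>R sg n (tail_obs n \<omega>)"
proof -
  let ?z = "\<lambda>\<tau>. loglog (subsample y w y n \<tau> \<omega>) (w n \<omega>)" and ?x = "\<lambda>\<tau>. subsample y w x n \<tau> \<omega>"
  have "is_arg_min (\<lambda>b. \<Sum>\<tau>=1..m n. (?z \<tau> - ?x \<tau> \<bullet> b)\<^sup>2) (\<lambda>_. True) b"
    using assms unfolding ssr_def[abs_def] .
  then have "(\<Sum>\<tau>=1..m n. (?z \<tau> - ?x \<tau> \<bullet> b) *\<^sub>R ?x \<tau>) = 0"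
    by (rule least_squares_normal_equations)
  moreover have "(?z \<tau> - ?x \<tau> \<bullet> b) *\<^sub>R ?x \<tau> = (?z \<tau> - ?x \<tau> \<bullet> \<beta>) *\<^sub>R ?x \<tau> - outer (?x \<tau>) (?x \<tau>) *v (b - \<beta>)" for \<tau>
    by (simp add: outer_vector_mult inner_diff_right algebra_simps)
  ultimately have "(\<Sum>\<tau>=1..m n. outer (?x \<tau>) (?x \<tau>)) *v (b - \<beta>) = (\<Sum>\<tau>=1..m n. (?z \<tau> - ?x \<tau> \<bullet> \<beta>) *\<^sub>R ?x \<tau>)"
    by (simp add: sum_subtractf sum_matrix_vector_mult)
  moreover have "sxx n (tail_obs n \<omega>) = (1 / real (m n)) *\<^sub>R (\<Sum>\<tau>=1..m n. outer (?x \<tau>) (?x \<tau>))"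
    unfolding sxx_def tail_obs_def by (intro arg_cong2[where f=scaleR] sum.cong) auto
  \<comment> \<open>Since \<open>loglog\<close> depends on its arguments only through their
    quotient, dividing the observation by the threshold and taking threshold 1 leaves the regressand
    unchanged.\<close>
  moreover have "sg n (tail_obs n \<omega>) = (\<Sum>\<tau>=1..m n. (?z \<tau> - ?x \<tau> \<bullet> \<beta>) *\<^sub>R ?x \<tau>)"
    unfolding sg_def tail_obs_def by (intro sum.cong) (auto simp: score_fun_def loglog_def)
  ultimately show ?thesis by (simp add: scaleR_matrix_vector_assoc[symmetric])
qed

lemma \<Sigma>xx_symmetric: "transpose \<Sigma>xx = \<Sigma>xx"
proof -
  have "has_bochner_integral N (\<lambda>\<omega>. outer (X 0 \<omega>) (X 0 \<omega>) $ a $ b) (\<Sigma>xx $ a $ b)" for a b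
    by (rule has_bochner_integral_bounded_linear[OF bounded_linear_matrix_component]) (use A3 in \<open>auto simp: A3_def\<close>)
  then have "(\<integral>\<omega>. X 0 \<omega> $ a * X 0 \<omega> $ b \<partial>N) = \<Sigma>xx $ a $ b" for a b
    by (simp add: outer_def has_bochner_integral_iff)
  from this[symmetric] show ?thesis by (simp add: vec_eq_iff transpose_def mult.commute)
qed

lemma tail_linear_estimator:
  obtains B where "linear_estimator M m (\<lambda>n \<omega>. sxx n (tail_obs n \<omega>)) (\<lambda>n \<omega>. sg n (tail_obs n \<omega>)) bhat \<beta> \<Sigma>xx B"
proof -
  obtain B where B: "\<And>m. integrable N (\<lambda>\<omega>. (norm (\<Sum>\<tau>=1..m. g (int \<tau>) \<omega>))\<^sup>2)"
    "\<And>m. (\<integral>\<omega>. (norm (\<Sum>\<tau>=1..m. g (int \<tau>) \<omega>))\<^sup>2 \<partial>N) \<le> B * real m"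
    using score_sum_second_moment_bound[OF A4a] by blast
  have "linear_estimator M m (\<lambda>n \<omega>. sxx n (tail_obs n \<omega>)) (\<lambda>n \<omega>. sg n (tail_obs n \<omega>)) bhat \<beta> \<Sigma>xx B"
  proof
    show "(\<lambda>\<omega>. sxx n (tail_obs n \<omega>)) \<in> borel_measurable M" for n
      by (rule measurable_compose[OF tail_obs_measurable sxx_measurable])
    show "(\<lambda>\<omega>. sg n (tail_obs n \<omega>)) \<in> borel_measurable M" for n
      by (rule measurable_compose[OF tail_obs_measurable sg_measurable])
    show "bhat n \<in> borel_measurable M" for n using ols by (simp add: ols_estimator_def)
    show m_top: "filterlim m at_top sequentially" by (rule tail_size_at_top[OF \<kappa>_pos])
    show "AE \<omega> in M. sxx n (tail_obs n \<omega>) *v (bhat n \<omega> - \<beta>) = (1 / real (m n)) *\<^sub>R sg n (tail_obs n \<omega>)" for n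
    proof -
      have "AE \<omega> in M. is_arg_min (ssr y x w \<kappa> n \<omega>) (\<lambda>_. True) (bhat n \<omega>)"
        using ols by (simp add: ols_estimator_def)
      then show ?thesis by eventually_elim (rule ols_normal_equation)
    qed
    show "invertible \<Sigma>xx" using A3 by (simp add: A3_def)
    show "(\<lambda>n. measure M {\<omega> \<in> space M. norm (sxx n (tail_obs n \<omega>) - \<Sigma>xx) > d}) \<longlonglongrightarrow> 0" if "d > 0" for d
    proof -
      have "(\<lambda>u. norm (sxx n u - \<Sigma>xx)) \<in> borel_measurable (PS n)" for n by measurable
      from obs_prob[OF this] show ?thesis
        using filterlim_compose[OF second_moment_tendsto[OF A3 that] m_top] by (simp add: sxx_limit)
    qed
    show "measure M {\<omega> \<in> space M. norm (sg n (tail_obs n \<omega>)) > a} \<le> B * real (m n) / a\<^sup>2" if a: "a > 0" for n a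
    proof -
      let ?G = "\<lambda>\<omega>. \<Sum>\<tau>=1..m n. g (int \<tau>) \<omega>"
      have [measurable]: "?G \<in> borel_measurable N" by measurable
      have "(\<lambda>u. norm (sg n u)) \<in> borel_measurable (PS n)" by measurable
      from obs_prob[OF this, of a]
      have "measure M {\<omega> \<in> space M. norm (sg n (tail_obs n \<omega>)) > a} = measure N {\<omega> \<in> space N. norm (?G \<omega>) > a}"
        by (simp add: sg_limit)
      also have "\<dots> \<le> measure N {\<omega> \<in> space N. (norm (?G \<omega>))\<^sup>2 \<ge> a\<^sup>2}"
        using a by (intro N.finite_measure_mono) (auto intro: power_mono)
      also have "\<dots> \<le> (\<integral>\<omega>. (norm (?G \<omega>))\<^sup>2 \<partial>N) / a\<^sup>2"
        using a B(1) by (intro integral_Markov_inequality_measure[where A="space N"]) auto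
      also have "\<dots> \<le> B * real (m n) / a\<^sup>2"
        by (intro divide_right_mono B(2)) simp
      finally show ?thesis .
    qed
  qed
  then show ?thesis by (rule that)
qed

lemma ols_consistent: "tendsto_in_prob M bhat \<beta>"
proof -
  obtain B where "linear_estimator M m (\<lambda>n \<omega>. sxx n (tail_obs n \<omega>)) (\<lambda>n \<omega>. sg n (tail_obs n \<omega>)) bhat \<beta> \<Sigma>xx B"
    by (rule tail_linear_estimator)
  then show ?thesis by (rule linear_estimator.consistency)
qed

lemma ols_asymptotically_normal:
  assumes A4b: "A4b \<beta> N Y X" and A4c: "A4c \<beta> N Y X"
  shows "tendsto_in_distribution M (\<lambda>n \<omega>. sqrt (real (m n)) *\<^sub>R (bhat n \<omega> - \<beta>))
     (multi_normal 0 (matrix_inv \<Sigma>xx ** V ** matrix_inv \<Sigma>xx))"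
proof -
  obtain B where le: "linear_estimator M m (\<lambda>n \<omega>. sxx n (tail_obs n \<omega>)) (\<lambda>n \<omega>. sg n (tail_obs n \<omega>)) bhat \<beta> \<Sigma>xx B"
    by (rule tail_linear_estimator)
  have clt: "(\<lambda>n. \<integral>\<omega>. iexp (1 / sqrt (real (m n)) * (c \<bullet> sg n (tail_obs n \<omega>))) \<partial>M)
      \<longlonglongrightarrow> of_real (exp (- (c \<bullet> (V *v c)) / 2))" for c
  proof -
    have "(\<integral>\<omega>. iexp (1 / sqrt (real (m n)) * (c \<bullet> sg n (tail_obs n \<omega>))) \<partial>M)
      = (\<integral>\<omega>. iexp (1 / sqrt (real (m n)) * (\<Sum>\<tau>=1..m n. c \<bullet> g (int \<tau>) \<omega>)) \<partial>N)" for n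
    proof -
      have "(\<lambda>u. iexp (1 / sqrt (real (m n)) * (c \<bullet> sg n u))) \<in> borel_measurable (PS n)" by measurable
      from obs_integral[OF this] show ?thesis by (simp only: sg_limit inner_sum_right)
    qed
    moreover have "(\<lambda>n. \<integral>\<omega>. iexp (1 / sqrt (real (m n)) * (\<Sum>\<tau>=1..m n. c \<bullet> g (int \<tau>) \<omega>)) \<partial>N)
      \<longlonglongrightarrow> of_real (exp (- (1\<^sup>2 * (c \<bullet> (V *v c)) / 2)))"
      by (rule filterlim_compose[OF score_clt[OF A4a A4b A4c] tail_size_at_top[OF \<kappa>_pos]])
    ultimately show ?thesis by simp
  qed
  have "pos_def V" using A4a by (simp add: A4a_def)
  from linear_estimator.asymptotic_normality[OF le \<Sigma>xx_symmetric this clt] show ?thesis .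
qed

end

theorem theorem1:
  fixes M :: "'w measure"
    and y :: "nat \<Rightarrow> 'w \<Rightarrow> real"
    and x :: "nat \<Rightarrow> 'w \<Rightarrow> real^'k"
    and w :: "nat \<Rightarrow> 'w \<Rightarrow> real"
    and \<kappa> :: real
    and \<beta> :: "real^'k"
    and bhat :: "nat \<Rightarrow> 'w \<Rightarrow> real^'k"
    and N :: "'v measure"
    and Y :: "int \<Rightarrow> 'v \<Rightarrow> real"
    and X :: "int \<Rightarrow> 'v \<Rightarrow> real^'k"
    and \<Sigma>xx V :: "real^'k^'k"
    and \<Gamma> :: "int \<Rightarrow> real^'k^'k"
  assumes "prob_space M"
    and "\<And>t. y t \<in> borel_measurable M"
    and "\<And>t. x t \<in> borel_measurable M"
    and "\<And>n. w n \<in> borel_measurable M"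
    and "\<And>n \<omega>. \<omega> \<in> space M \<Longrightarrow> w n \<omega> > 0"
    and "0 < \<kappa>" and "\<kappa> \<le> 1"
    and "\<And>n. AE \<omega> in M. card (tail_set y w n \<omega>) = tail_size \<kappa> n"
    and "pareto_tail M y x w \<beta>"
    and "ols_estimator M y x w \<kappa> bhat"
  shows "(A1 M y x w \<kappa> N Y X \<and> A2 \<beta> N Y X \<and> A3 N X \<Sigma>xx \<and> A4a \<beta> N Y X \<Gamma> V
            \<longrightarrow> tendsto_in_prob M bhat \<beta>)
       \<and> (A1 M y x w \<kappa> N Y X \<and> A2 \<beta> N Y X \<and> A3 N X \<Sigma>xx \<and> A4a \<beta> N Y X \<Gamma> V
            \<and> A4b \<beta> N Y X \<and> A4c \<beta> N Y X
            \<longrightarrow> tendsto_in_distribution M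
                  (\<lambda>n \<omega>. sqrt (real (tail_size \<kappa> n)) *\<^sub>R (bhat n \<omega> - \<beta>))
                  (multi_normal 0 (matrix_inv \<Sigma>xx ** V ** matrix_inv \<Sigma>xx)))"
proof -
  have tail: "tail_regression \<beta> N Y X M y x w \<kappa> bhat \<Sigma>xx V \<Gamma>"
    if "A1 M y x w \<kappa> N Y X" "A3 N X \<Sigma>xx" "A4a \<beta> N Y X \<Gamma> V"
  proof (intro tail_regression.intro score_process.intro tail_regression_axioms.intro)
    show "ergodic_stationary N (\<lambda>\<tau> \<omega>. (Y \<tau> \<omega>, X \<tau> \<omega>))" using that(1) by (simp add: A1_def)
  qed (rule assms that)+
  show ?thesis
    using tail_regression.ols_consistent[OF tail] tail_regression.ols_asymptotically_normal[OF tail] by blast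
qed

end
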